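(* Suppose that there exist $a,b\in(0,1)$ such that: (1) $a<b$; (2) $f_1$ is strictly concave on $[0,a]$ and strictly convex on $[a,1]$, and $f_2$ is strictly convex on $[0,b]$ and strictly concave on $[b,1]$; (3) $f_i,g_i\in C^2[0,1]$ for $i=1,2$; (4) for all $(x,y)\in[0,a]\times[b,1]$ there exists $(\hat x,\hat y)\in(0,a]\times[b,1)$ with $f_1(\hat x)>g_1(y)\frac{\hat x}{y}$ and $f_2(\hat y)>g_2(x)\frac{1-\hat y}{1-x}$. Suppose that $(D_{[0,\ell_*]},D_{[r_*,1]})$ is a solution to the Dynkin problem (DP) such that $(\ell_*,r_* )\in(0,a)\times(b,1)$ and $$\left|\frac{\partial_{xy}U_1(\ell_*,r_* )}{\partial_{xx}U_1(\ell_*,r_* )}\cdot\frac{\partial_{xy}U_2(\ell_*,r_* )}{\partial_{yy}U_2(\ell_*,r_* )}\right|<1$$ (in particular, the quotients are well defined). Then the equilibrium $(D_{[0,\ell_*]},D_{[r_*,1]})$ in the DP is locally stable.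
   Context: Process. Let $W=(W_t)_{t\ge0}$ be a one-dimensional standard Brownian motion on a filtered probability space with universally completed filtration $\mathbb F=(\mathcal F_t)_{t\ge0}$. Let $E=(0,1)$, $\zeta=\inf\{t\ge0: W_t\notin E\}$, and let $X_t=W_t$ for $0\le t<\zeta$ and $X_t=\Delta$ for $t\ge\zeta$ (including $t=\infty$), where $\Delta$ is a cemetery state. $\mathbb P^x,\mathbb E^x$ denote probability and expectation when the process starts at $x$ (for $x\in\{0,1\}$, $\zeta=0$ and the process is at $\Delta$ from time $0$). Every function $\phi$ is extended by $\phi(\Delta)=0$. $\mathcal T$ is the set of $\mathbb F$-stopping times with values in $[0,\infty]$. For a measurable set $A$, $D_A=\inf\{t\ge0: X_t\in A\}$ with $\inf\emptyset=\zeta$. Rewards. For $i=1,2$, $f_i,g_i,h_i$ are bounded continuous real functions on $[0,1]$ with $f_i\le h_i\le g_i$, vanishing at $0$ and $1$ (and at $\Delta$). Game (DP). Writing $-i$ for the player other than $i$, for $\tau_1,\tau_2\in\mathcal T$, $$M_i^x(\tau_1,\tau_2)=\mathbb E^x\big[f_i(X_{\tau_i})1_{\{\tau_i<\tau_{-i}\}}+g_i(X_{\tau_{-i}})1_{\{\tau_{-i}<\tau_i\}}+h_i(X_{\tau_i})1_{\{\tau_i=\tau_{-i}\}}\big].$$ A pair $(\tau_1^*,\tau_2^* )\in\mathcal T\times\mathcal T$ is a solution to the DP if for every $x\in E$, $M_1^x(\tau_1^*,\tau_2^* )=\sup_{\tau_1\in\mathcal T}M_1^x(\tau_1,\tau_2^*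 )$ and $M_2^x(\tau_1^*,\tau_2^* )=\sup_{\tau_2\in\mathcal T}M_2^x(\tau_1^*,\tau_2)$. Utilities. For $0\le x<y\le1$, $$U_1(x,y)=\frac{f_1(x)-g_1(y)\frac{x}{y}}{y-x},\qquad U_2(x,y)=\frac{f_2(y)-g_2(x)\frac{1-y}{1-x}}{y-x}.$$ Iteration in the DP. Given $\ell^{(1)}\in[0,a]$, put $A_1=[0,\ell^{(1)}]$ and for $n\ge1$ $$V_{2n}(x)=\sup_{\tau\in\mathcal T}\mathbb E^x\big[f_2(X_\tau)1_{\{\tau<D_{A_{2n-1}}\}}+g_2(X_{D_{A_{2n-1}}})1_{\{\tau\ge D_{A_{2n-1}}\}}\big],\quad A_{2n}=\{x\in[0,1]\setminus A_{2n-1}: V_{2n}(x)=f_2(x)\},$$ $$V_{2n+1}(x)=\sup_{\tau\in\mathcal T}\mathbb E^x\big[f_1(X_\tau)1_{\{\tau<D_{A_{2n}}\}}+g_1(X_{D_{A_{2n}}})1_{\{\tau\ge D_{A_{2n}}\}}\big],\quad A_{2n+1}=\{x\in[0,1]\setminus A_{2n}: V_{2n+1}(x)=f_1(x)\}.$$ Local stability. A solution $(D_{[0,\ell']},D_{[r',1]})$ of the DP is locally stable if there is a neighbourhood of $\ell'$ such that for every $\ell^{(1)}\in[0,a]$ in this neighbourhood the iteration satisfies $\liminf_n A_{2n-1}=\limsup_n A_{2n-1}=[0,\ell']$ and $\liminf_n A_{2n}=\limsup_n A_{2n}=[r',1]$, where limits of sequences of sets are in the Painlevé–Kuratowski sense.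 *)

theory Defs
  imports "HOL-Probability.Probability"
begin

section \<open>Brownian motion on a universally complete filtered space\<close>

text \<open>A sigma-algebra is universally complete if it contains every set that is measurable for the
  completion of each probability measure on it. This is implied by completeness with respect to the
  laws \<open>P\<^sup>\<mu>\<close> of a Markov process started from its arbitrary initial distributions \<open>\<mu>\<close>.\<close>

definition universally_complete :: "'w measure \<Rightarrow> bool" where
  "universally_complete N \<longleftrightarrow>
     (\<forall>A\<subseteq>space N.
        (\<forall>Q. prob_space Q \<longrightarrow> sets Q = sets N \<longrightarrow> A \<in> sets (completion Q)) \<longrightarrow> A \<in> sets N)"

text \<open>\<open>M\<close> only supplies the underlying measurable space; its measure is not used. The probability
  measures are \<open>P x\<close>, one for each starting point \<open>x\<close>.
  The filtration is indexed by \<open>[0,\<infinity>]\<close> so that \<^const>\<open>stopping_time\<close> describes stopping times with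
  values in \<open>[0,\<infinity>]\<close>: at index \<open>\<infinity>\<close> it requires nothing, and \<open>F \<infinity>\<close> can be any sigma-algebra between
  the union of the \<open>F t\<close> and \<open>M\<close>. Only times \<open>t \<ge> 0\<close> of \<open>W\<close> matter.\<close>

locale brownian_setting = filtration "space M" F
  for M :: "'w measure" and F :: "ennreal \<Rightarrow> 'w measure" +
  fixes W :: "real \<Rightarrow> 'w \<Rightarrow> real" and P :: "real \<Rightarrow> 'w measure"
  assumes subalgebra_F: "\<And>t. subalgebra M (F t)"
    and complete_F: "\<And>t::real. t \<ge> 0 \<Longrightarrow> universally_complete (F (ennreal t))"
    and adapted: "\<And>t. t \<ge> 0 \<Longrightarrow> W t \<in> borel_measurable (F (ennreal t))"
    and continuous_paths: "\<And>\<omega>. \<omega> \<in> space M \<Longrightarrow> continuous_on {0..} (\<lambda>t. W t \<omega>)"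
    and prob_P: "\<And>x. x \<in> {0..1} \<Longrightarrow> prob_space (P x)"
    and sets_P: "\<And>x. x \<in> {0..1} \<Longrightarrow> sets (P x) = sets M"
    and start: "\<And>x. x \<in> {0..1} \<Longrightarrow> AE \<omega> in P x. W 0 \<omega> = x"
    and normal_increments: "\<And>x s t. x \<in> {0..1} \<Longrightarrow> 0 \<le> s \<Longrightarrow> s < t \<Longrightarrow>
      distributed (P x) lborel (\<lambda>\<omega>. W t \<omega> - W s \<omega>) (normal_density 0 (sqrt (t - s)))"
    and independent_increments: "\<And>x s t. x \<in> {0..1} \<Longrightarrow> 0 \<le> s \<Longrightarrow> s < t \<Longrightarrow>
      prob_space.indep_set (P x) (sets (F (ennreal s)))
        (sets (vimage_algebra (space M) (\<lambda>\<omega>. W t \<omega> - W s \<omega>) borel))"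

section \<open>The process killed on leaving \<open>(0,1)\<close>\<close>

definition lifetime :: "(real \<Rightarrow> 'w \<Rightarrow> real) \<Rightarrow> 'w \<Rightarrow> ennreal" where
  "lifetime W \<omega> = Inf {ennreal t | t. t \<ge> 0 \<and> W t \<omega> \<notin> {0<..<1}}"

text \<open>The cemetery state is \<^const>\<open>None\<close>.\<close>

definition killed :: "(real \<Rightarrow> 'w \<Rightarrow> real) \<Rightarrow> ennreal \<Rightarrow> 'w \<Rightarrow> real option" where
  "killed W t \<omega> = (if t < lifetime W \<omega> then Some (W (enn2real t) \<omega>) else None)"

definition ext0 :: "(real \<Rightarrow> real) \<Rightarrow> real option \<Rightarrow> real" where
  "ext0 \<phi> z = (case z of None \<Rightarrow> 0 | Some y \<Rightarrow> \<phi> y)"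

text \<open>\<open>hit W A\<close> is \<open>D\<^sub>A\<close>. If the process never visits \<open>A\<close>, its value is the lifetime, not \<open>\<infinity>\<close>.\<close>

definition hit :: "(real \<Rightarrow> 'w \<Rightarrow> real) \<Rightarrow> real set \<Rightarrow> 'w \<Rightarrow> ennreal" where
  "hit W A \<omega> =
     (let H = {t. t < \<infinity> \<and> killed W t \<omega> \<in> Some ` A} in if H = {} then lifetime W \<omega> else Inf H)"

section \<open>The Dynkin game\<close>

definition admissible_rewards :: "(real \<Rightarrow> real) \<Rightarrow> (real \<Rightarrow> real) \<Rightarrow> (real \<Rightarrow> real) \<Rightarrow> bool" where
  "admissible_rewards f g h \<longleftrightarrow>
     (\<forall>\<phi>\<in>{f, g, h}. continuous_on {0..1} \<phi> \<and> bounded (\<phi> ` {0..1}) \<and> \<phi> 0 = 0 \<and> \<phi> 1 = 0) \<and>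
     (\<forall>x\<in>{0..1}. f x \<le> h x \<and> h x \<le> g x)"

text \<open>Expected reward of a player who stops at \<open>\<sigma>\<close> against an opponent stopping at \<open>\<rho>\<close>.\<close>

definition payoff ::
  "(real \<Rightarrow> 'w \<Rightarrow> real) \<Rightarrow> (real \<Rightarrow> 'w measure) \<Rightarrow> (real \<Rightarrow> real) \<Rightarrow> (real \<Rightarrow> real) \<Rightarrow> (real \<Rightarrow> real) \<Rightarrow>
   real \<Rightarrow> ('w \<Rightarrow> ennreal) \<Rightarrow> ('w \<Rightarrow> ennreal) \<Rightarrow> real" where
  "payoff W P f g h x \<sigma> \<rho> =
     (\<integral>\<omega>. ext0 f (killed W (\<sigma> \<omega>) \<omega>) * of_bool (\<sigma> \<omega> < \<rho> \<omega>)
        + ext0 g (killed W (\<rho> \<omega>) \<omega>) * of_bool (\<rho> \<omega> < \<sigma> \<omega>)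
        + ext0 h (killed W (\<sigma> \<omega>) \<omega>) * of_bool (\<sigma> \<omega> = \<rho> \<omega>) \<partial>P x)"

text \<open>From here on the rewards \<open>f i\<close>, \<open>g i\<close>, \<open>h i\<close> are indexed by the players \<open>i = 1, 2\<close>.\<close>

definition DP_solution ::
  "(ennreal \<Rightarrow> 'w measure) \<Rightarrow> (real \<Rightarrow> 'w \<Rightarrow> real) \<Rightarrow> (real \<Rightarrow> 'w measure) \<Rightarrow>
   (nat \<Rightarrow> real \<Rightarrow> real) \<Rightarrow> (nat \<Rightarrow> real \<Rightarrow> real) \<Rightarrow> (nat \<Rightarrow> real \<Rightarrow> real) \<Rightarrow>
   ('w \<Rightarrow> ennreal) \<Rightarrow> ('w \<Rightarrow> ennreal) \<Rightarrow> bool" where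
  "DP_solution F W P f g h \<tau>1 \<tau>2 \<longleftrightarrow>
     stopping_time F \<tau>1 \<and> stopping_time F \<tau>2 \<and>
     (\<forall>x\<in>{0<..<1}.
        payoff W P (f 1) (g 1) (h 1) x \<tau>1 \<tau>2 =
          (SUP \<sigma>\<in>Collect (stopping_time F). payoff W P (f 1) (g 1) (h 1) x \<sigma> \<tau>2) \<and>
        payoff W P (f 2) (g 2) (h 2) x \<tau>2 \<tau>1 =
          (SUP \<sigma>\<in>Collect (stopping_time F). payoff W P (f 2) (g 2) (h 2) x \<sigma> \<tau>1))"

section \<open>Utilities and partial derivatives\<close>

definition U1 :: "(real \<Rightarrow> real) \<Rightarrow> (real \<Rightarrow> real) \<Rightarrow> real \<Rightarrow> real \<Rightarrow> real" where
  "U1 f1 g1 x y = (f1 x - g1 y * (x / y)) / (y - x)"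

definition U2 :: "(real \<Rightarrow> real) \<Rightarrow> (real \<Rightarrow> real) \<Rightarrow> real \<Rightarrow> real \<Rightarrow> real" where
  "U2 f2 g2 x y = (f2 y - g2 x * ((1 - y) / (1 - x))) / (y - x)"

definition pd_x :: "(real \<Rightarrow> real \<Rightarrow> real) \<Rightarrow> real \<Rightarrow> real \<Rightarrow> real" where
  "pd_x U x y = deriv (\<lambda>s. U s y) x"

definition pd_y :: "(real \<Rightarrow> real \<Rightarrow> real) \<Rightarrow> real \<Rightarrow> real \<Rightarrow> real" where
  "pd_y U x y = deriv (\<lambda>s. U x s) y"

section \<open>Regularity and strict convexity\<close>

text \<open>At the endpoints of \<open>S\<close> the derivatives are one-sided.\<close>

definition C2_on :: "real set \<Rightarrow> (real \<Rightarrow> real) \<Rightarrow> bool" where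
  "C2_on S \<phi> \<longleftrightarrow> (\<exists>\<phi>' \<phi>''.
     (\<forall>x\<in>S. (\<phi> has_real_derivative \<phi>' x) (at x within S)) \<and>
     (\<forall>x\<in>S. (\<phi>' has_real_derivative \<phi>'' x) (at x within S)) \<and>
     continuous_on S \<phi>'')"

definition strictly_convex_on :: "real set \<Rightarrow> (real \<Rightarrow> real) \<Rightarrow> bool" where
  "strictly_convex_on S \<phi> \<longleftrightarrow> convex S \<and>
     (\<forall>x\<in>S. \<forall>y\<in>S. \<forall>t. x \<noteq> y \<longrightarrow> 0 < t \<longrightarrow> t < 1 \<longrightarrow>
        \<phi> ((1 - t) * x + t * y) < (1 - t) * \<phi> x + t * \<phi> y)"

definition strictly_concave_on :: "real set \<Rightarrow> (real \<Rightarrow> real) \<Rightarrow> bool" where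
  "strictly_concave_on S \<phi> \<longleftrightarrow> strictly_convex_on S (\<lambda>x. - \<phi> x)"

section \<open>Best-response iteration and local stability\<close>

text \<open>Value of optimally stopping for \<open>f\<close> when the opponent stops on \<open>A\<close>.\<close>

definition value_against ::
  "(ennreal \<Rightarrow> 'w measure) \<Rightarrow> (real \<Rightarrow> 'w \<Rightarrow> real) \<Rightarrow> (real \<Rightarrow> 'w measure) \<Rightarrow>
   (real \<Rightarrow> real) \<Rightarrow> (real \<Rightarrow> real) \<Rightarrow> real set \<Rightarrow> real \<Rightarrow> real" where
  "value_against F W P f g A x =
     (SUP \<tau>\<in>Collect (stopping_time F).
        (\<integral>\<omega>. ext0 f (killed W (\<tau> \<omega>) \<omega>) * of_bool (\<tau> \<omega> < hit W A \<omega>)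
           + ext0 g (killed W (hit W A \<omega>) \<omega>) * of_bool (\<tau> \<omega> \<ge> hit W A \<omega>) \<partial>P x))"

definition response_set ::
  "(ennreal \<Rightarrow> 'w measure) \<Rightarrow> (real \<Rightarrow> 'w \<Rightarrow> real) \<Rightarrow> (real \<Rightarrow> 'w measure) \<Rightarrow>
   (real \<Rightarrow> real) \<Rightarrow> (real \<Rightarrow> real) \<Rightarrow> real set \<Rightarrow> real set" where
  "response_set F W P f g A = {x \<in> {0..1} - A. value_against F W P f g A x = f x}"

text \<open>\<open>iter_set F W P f g l n\<close> is \<open>A\<^sub>n\<close> for \<open>n \<ge> 1\<close>, started from \<open>A\<^sub>1 = [0,l]\<close>; the index 0 is a dummy.
  Sets with even index belong to player 2, sets with odd index to player 1.\<close>

fun iter_set ::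
  "(ennreal \<Rightarrow> 'w measure) \<Rightarrow> (real \<Rightarrow> 'w \<Rightarrow> real) \<Rightarrow> (real \<Rightarrow> 'w measure) \<Rightarrow>
   (nat \<Rightarrow> real \<Rightarrow> real) \<Rightarrow> (nat \<Rightarrow> real \<Rightarrow> real) \<Rightarrow> real \<Rightarrow> nat \<Rightarrow> real set" where
  "iter_set F W P f g l 0 = {}"
| "iter_set F W P f g l (Suc 0) = {0..l}"
| "iter_set F W P f g l (Suc (Suc n)) =
     (if even n then response_set F W P (f 2) (g 2) (iter_set F W P f g l (Suc n))
      else response_set F W P (f 1) (g 1) (iter_set F W P f g l (Suc n)))"

text \<open>Painleve-Kuratowski lower and upper limits of a sequence of sets.\<close>

definition PK_liminf :: "(nat \<Rightarrow> 'a::topological_space set) \<Rightarrow> 'a set" where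
  "PK_liminf A = {x. \<forall>U. open U \<longrightarrow> x \<in> U \<longrightarrow> (\<forall>\<^sub>F n in sequentially. A n \<inter> U \<noteq> {})}"

definition PK_limsup :: "(nat \<Rightarrow> 'a::topological_space set) \<Rightarrow> 'a set" where
  "PK_limsup A = {x. \<forall>U. open U \<longrightarrow> x \<in> U \<longrightarrow> (\<exists>\<^sub>F n in sequentially. A n \<inter> U \<noteq> {})}"

definition locally_stable ::
  "(ennreal \<Rightarrow> 'w measure) \<Rightarrow> (real \<Rightarrow> 'w \<Rightarrow> real) \<Rightarrow> (real \<Rightarrow> 'w measure) \<Rightarrow>
   (nat \<Rightarrow> real \<Rightarrow> real) \<Rightarrow> (nat \<Rightarrow> real \<Rightarrow> real) \<Rightarrow> (nat \<Rightarrow> real \<Rightarrow> real) \<Rightarrow>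
   real \<Rightarrow> real \<Rightarrow> real \<Rightarrow> bool" where
  "locally_stable F W P f g h a l' r' \<longleftrightarrow>
     DP_solution F W P f g h (hit W {0..l'}) (hit W {r'..1}) \<and>
     (\<forall>\<^sub>F l in nhds l'. l \<in> {0..a} \<longrightarrow>
        (let A = iter_set F W P f g l in
           PK_liminf (\<lambda>n. A (2 * n + 1)) = {0..l'} \<and> PK_limsup (\<lambda>n. A (2 * n + 1)) = {0..l'} \<and>
           PK_liminf (\<lambda>n. A (2 * n + 2)) = {r'..1} \<and> PK_limsup (\<lambda>n. A (2 * n + 2)) = {r'..1}))"

end

theory Submission
  imports Defs
begin

text \<open>Killed Brownian motion is in natural scale, so by optional stopping an affine function that
  dominates the rewards bounds the value of a stopping problem, and stopping on leaving an interval
  realises chords. Hence the best response of player 2 to \<open>[0, x]\<close> is \<open>[r, 1]\<close>, where \<open>r\<close> maximises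
  the slope of the chord from \<open>(x, g x)\<close> to \<open>(y, f y)\<close>; this slope differs from \<open>U\<^sub>2(x, y)\<close> only by a
  function of \<open>x\<close>. Player 1 is the mirror image of player 2 under \<open>x \<mapsto> 1 - x\<close>.

  The maximiser is read off from the sign of the first-order condition. Expanding that condition
  at the equilibrium shows that one round of best responses multiplies the distance to \<open>\<ell>\<^sub>*\<close> by at
  most a constant below \<open>1\<close>, which can be taken arbitrarily close to the product in the
  assumption. So the thresholds converge geometrically.\<close>

section \<open>Exit times of an interval\<close>

text \<open>The shape hypotheses enter as follows. Strict convexity of \<open>f 2\<close> on
  \<open>{0..b}\<close> and \<open>f x \<le> g x\<close> keep \<open>f 2\<close> below every affine
  function that dominates \<open>g 2\<close> at \<open>x\<close> and \<open>f 2\<close> at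
  \<open>b\<close>. So player 2 never stops between \<open>x\<close> and \<open>b\<close>, and
  chords need to be compared on \<open>{b..1}\<close> only. Condition (4) puts some point of the
  graph above the chord from \<open>(x, g x)\<close> to \<open>(1, 0)\<close>, which keeps the
  maximiser below 1; strict concavity makes it unique. The constant comes from implicit
  differentiation of \<open>f y - g x - f' y * (y - x) = 0\<close> at the equilibrium: the solution
  \<open>y\<close> has derivative \<open>(f' r - g' l) / (f'' r * (r - l))\<close> in
  \<open>x\<close>, which is minus the quotient of the mixed and the pure second derivative of
  \<open>U2\<close>. No differentiable branch of best responses is selected: the sign of the
  left-hand side is tested at \<open>y = r + K * \<bar>x - l\<bar>\<close> and
  \<open>y = r - K * \<bar>x - l\<bar>\<close>. This needs \<open>K\<close> strictly above the
  modulus of that derivative, and the strict inequality for the product leaves room for it. The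
  equilibrium is given in terms of payoffs; deviations to other thresholds turn it into maximality
  of a chord slope.\<close>

definition exit_time :: "(real \<Rightarrow> 'w \<Rightarrow> real) \<Rightarrow> real \<Rightarrow> real \<Rightarrow> 'w \<Rightarrow> ennreal" where
  "exit_time W c d \<omega> = Inf {ennreal t | t. t \<ge> 0 \<and> W t \<omega> \<notin> {c<..<d}}"

lemma lifetime_eq_exit_time: "lifetime W = exit_time W 0 1"
  by (simp add: lifetime_def exit_time_def fun_eq_iff)

text \<open>The infimum is attained: the complement of the open interval is closed and paths are
  continuous. A path that is inside on all of \<open>{0..t}\<close> stays inside for a further time
  \<open>e\<close>, which pushes the infimum beyond \<open>t\<close>.\<close>

lemma (in brownian_setting) exit_time_le_iff:
  assumes "\<omega> \<in> space M" "t \<ge> 0"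
  shows "exit_time W c d \<omega> \<le> ennreal t \<longleftrightarrow> (\<exists>s\<in>{0..t}. W s \<omega> \<notin> {c<..<d})"
proof
  assume "\<exists>s\<in>{0..t}. W s \<omega> \<notin> {c<..<d}"
  then obtain s where s: "s \<in> {0..t}" "W s \<omega> \<notin> {c<..<d}" by blast
  then have "exit_time W c d \<omega> \<le> ennreal s"
    unfolding exit_time_def by (intro Inf_lower) auto
  also have "\<dots> \<le> ennreal t" using s by (intro ennreal_leI) auto
  finally show "exit_time W c d \<omega> \<le> ennreal t" .
next
  assume le: "exit_time W c d \<omega> \<le> ennreal t"
  show "\<exists>s\<in>{0..t}. W s \<omega> \<notin> {c<..<d}"
  proof (rule ccontr)
    assume "\<not> ?thesis"
    then have inside: "W s \<omega> \<in> {c<..<d}" if "s \<in> {0..t}" for s using that by auto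
    have "((\<lambda>s. W s \<omega>) \<longlongrightarrow> W t \<omega>) (at t within {0..})"
      using continuous_paths[OF assms(1)] assms(2) by (auto simp: continuous_on_def)
    then have "\<forall>\<^sub>F s in at t within {0..}. W s \<omega> \<in> {c<..<d}"
      by (rule topological_tendstoD) (use inside[of t] assms in auto)
    then obtain e where e: "e > 0" "\<And>s. s \<in> {0..} \<Longrightarrow> s \<noteq> t \<Longrightarrow> dist s t < e \<Longrightarrow> W s \<omega> \<in> {c<..<d}"
      unfolding eventually_at by blast
    have "ennreal (t + e / 2) \<le> exit_time W c d \<omega>"
      unfolding exit_time_def
    proof (rule Inf_greatest, clarify)
      fix s assume s: "0 \<le> s" "W s \<omega> \<notin> {c<..<d}"
      have "t + e / 2 \<le> s"
      proof (rule ccontr)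
        assume "\<not> ?thesis"
        then have "s \<le> t \<or> dist s t < e" using e by (auto simp: dist_real_def)
        then show False using s inside[of s] e(2)[of s] inside[of t] assms by (cases "s = t") auto
      qed
      then show "ennreal (t + e / 2) \<le> ennreal s" by (rule ennreal_leI)
    qed
    then have "ennreal (t + e / 2) \<le> ennreal t" using le by simp
    then show False using e assms by simp
  qed
qed

lemma (in brownian_setting) inside_before_exit:
  assumes "\<omega> \<in> space M" "t \<ge> 0" "ennreal t < exit_time W c d \<omega>"
  shows "W t \<omega> \<in> {c<..<d}"
proof (rule ccontr)
  assume "\<not> ?thesis"
  then have "exit_time W c d \<omega> \<le> ennreal t"
    using exit_time_le_iff[OF assms(1,2)] assms(2) by auto
  then show False using assms(3) by simp
qed

lemma (in brownian_setting) outside_at_exit: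
  assumes "\<omega> \<in> space M" "exit_time W c d \<omega> = ennreal t" "t \<ge> 0"
  shows "W t \<omega> \<notin> {c<..<d}"
proof
  assume inside: "W t \<omega> \<in> {c<..<d}"
  obtain s where s: "s \<in> {0..t}" "W s \<omega> \<notin> {c<..<d}"
    using exit_time_le_iff[OF assms(1,3), of c d] assms by auto
  then have "exit_time W c d \<omega> \<le> ennreal s"
    using exit_time_le_iff[OF assms(1), of s c d] by auto
  then have "t \<le> s" using assms(2) s by auto
  with s inside show False by auto
qed

text \<open>All earlier values lie in the open interval, so the value at \<open>t\<close> is a limit
  from the left of such values. At \<open>t = 0\<close> there are no earlier values and the
  hypothesis on the start takes over.\<close>

lemma (in brownian_setting) closed_before_exit:
  assumes "\<omega> \<in> space M" "t \<ge> 0" "ennreal t \<le> exit_time W c d \<omega>" "W 0 \<omega> \<in> {c..d}"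
  shows "W t \<omega> \<in> {c..d}"
proof (cases "t = 0")
  case False
  have "((\<lambda>s. W s \<omega>) \<longlongrightarrow> W t \<omega>) (at t within {0..})"
    using continuous_paths[OF assms(1)] assms(2) by (auto simp: continuous_on_def)
  then have "((\<lambda>s. W s \<omega>) \<longlongrightarrow> W t \<omega>) (at t within {0..<t})"
    by (rule tendsto_within_subset) auto
  moreover have "at t within {0..<t} \<noteq> bot"
    using False assms(2) by (simp add: at_within_eq_bot_iff)
  moreover have "\<forall>\<^sub>F s in at t within {0..<t}. W s \<omega> \<in> {c..d}"
    unfolding eventually_at_filter
  proof (intro always_eventually allI impI)
    fix s assume "s \<in> {0..<t}"
    then have "ennreal s < exit_time W c d \<omega>"
      using assms by (metis atLeastLessThan_iff ennreal_lessI order_less_le_trans le_less_trans)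
    then show "W s \<omega> \<in> {c..d}"
      using inside_before_exit[OF assms(1), of s c d] \<open>s \<in> {0..<t}\<close> by auto
  qed
  ultimately show ?thesis
    by (intro Lim_in_closed_set[OF closed_atLeastAtMost])
qed (use assms in simp)

lemma (in brownian_setting) endpoint_at_exit:
  assumes "\<omega> \<in> space M" "exit_time W c d \<omega> = ennreal t" "t \<ge> 0" "W 0 \<omega> \<in> {c..d}"
  shows "W t \<omega> = c \<or> W t \<omega> = d"
  using closed_before_exit[of \<omega> t c d] outside_at_exit[of \<omega> c d t] assms by auto

lemma exit_time_mono:
  assumes "c \<le> c'" "d' \<le> d"
  shows "exit_time W c' d' \<omega> \<le> exit_time W c d \<omega>"
  unfolding exit_time_def using assms by (intro Inf_superset_mono) auto

text \<open>The uncountable condition over \<open>{0..s}\<close> is made countable.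
  \<open>?\<phi>\<close> is positive exactly inside the interval; on the compact set
  \<open>{0..s}\<close> it reaches a value at most 0 iff it falls below every
  \<open>1 / (n + 1)\<close>, and by continuity the latter can be seen at countably many
  times.\<close>

lemma (in brownian_setting) stopping_time_exit_time: "stopping_time F (exit_time W c d)"
proof
  fix t :: ennreal
  show "Measurable.pred (F t) (\<lambda>\<omega>. exit_time W c d \<omega> \<le> t)"
  proof (cases "t = \<infinity>")
    case True
    then show ?thesis by simp
  next
    case False
    then obtain s where s: "t = ennreal s" "s \<ge> 0" by (cases t) auto
    let ?\<phi> = "\<lambda>\<omega> q. min (W q \<omega> - c) (d - W q \<omega>)"
    \<comment> \<open>Rational times are found to the right of a given \<open>q < s\<close>; the
      endpoint \<open>s\<close> has nothing of \<open>{0..s}\<close> to its right and may be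
      irrational, so it is added.\<close>
    let ?Q = "insert s (\<rat> \<inter> {0..s})"
    have *: "exit_time W c d \<omega> \<le> t \<longleftrightarrow> (\<forall>n::nat. \<exists>q\<in>?Q. ?\<phi> \<omega> q < 1 / real (Suc n))"
      if \<omega>: "\<omega> \<in> space M" for \<omega>
    proof -
      have cont: "continuous_on {0..s} (?\<phi> \<omega>)"
        by (intro continuous_intros continuous_on_subset[OF continuous_paths[OF \<omega>]]) auto
      have "exit_time W c d \<omega> \<le> t \<longleftrightarrow> (\<exists>q\<in>{0..s}. ?\<phi> \<omega> q \<le> 0)"
        unfolding s(1) exit_time_le_iff[OF \<omega> s(2)]
        by (intro bex_cong refl) (auto simp: min_le_iff_disj)
      also have "\<dots> \<longleftrightarrow> (\<forall>n::nat. \<exists>q\<in>?Q. ?\<phi> \<omega> q < 1 / real (Suc n))"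
      proof (intro iffI allI)
        fix n assume "\<exists>q\<in>{0..s}. ?\<phi> \<omega> q \<le> 0"
        then obtain q where q: "q \<in> {0..s}" "?\<phi> \<omega> q \<le> 0" by blast
        show "\<exists>q\<in>?Q. ?\<phi> \<omega> q < 1 / real (Suc n)"
        proof (cases "q = s")
          case True
          then show ?thesis using q by (intro bexI[of _ s]) (auto intro: le_less_trans)
        next
          case False
          have "(?\<phi> \<omega> \<longlongrightarrow> ?\<phi> \<omega> q) (at q within {0..s})"
            using cont q(1) unfolding continuous_on_def by blast
          then have "\<forall>\<^sub>F x in at q within {0..s}. ?\<phi> \<omega> x < 1 / real (Suc n)"
            by (rule order_tendstoD(2)) (use q in \<open>auto intro: le_less_trans\<close>)
          then obtain e where e: "e > 0" "\<And>x. x \<in> {0..s} \<Longrightarrow> x \<noteq> q \<Longrightarrow> dist x q < e \<Longrightarrow> ?\<phi> \<omega> x < 1 / real (Suc n)"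
            unfolding eventually_at by blast
          have "q < min s (q + e)" using q False e by auto
          then obtain p where p: "p \<in> \<rat>" "q < p" "p < min s (q + e)" using Rats_dense_in_real by blast
          then show ?thesis using e(2)[of p] p q by (intro bexI[of _ p]) (auto simp: dist_real_def)
        qed
      next
        assume R: "\<forall>n::nat. \<exists>q\<in>?Q. ?\<phi> \<omega> q < 1 / real (Suc n)"
        have "compact {0..s}" "{0..s} \<noteq> {}" using s(2) by auto
        then obtain q where q: "q \<in> {0..s}" "\<And>y. y \<in> {0..s} \<Longrightarrow> ?\<phi> \<omega> q \<le> ?\<phi> \<omega> y"
          using continuous_attains_inf[OF _ _ cont] by blast
        have "?\<phi> \<omega> q \<le> 0"
        proof (rule ccontr)
          assume "\<not> ?thesis"
          then obtain n where n: "1 / real (Suc n) < ?\<phi> \<omega> q"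
            by (metis not_le nat_approx_posE)
          obtain p where "p \<in> ?Q" "?\<phi> \<omega> p < 1 / real (Suc n)" using R by blast
          then show False using q(2)[of p] n s(2) by force
        qed
        then show "\<exists>q\<in>{0..s}. ?\<phi> \<omega> q \<le> 0" using q by blast
      qed
      finally show ?thesis .
    qed
    have W: "W q \<in> borel_measurable (F t)" if "q \<in> ?Q" for q
    proof -
      have "sets (F (ennreal q)) \<subseteq> sets (F t)"
        using that s by (intro sets_F_mono) (auto intro: ennreal_leI)
      then have "measurable (F (ennreal q)) borel \<subseteq> measurable (F t) borel"
        by (intro measurable_mono) (auto simp: space_F)
      then show ?thesis using adapted[of q] that s by auto
    qed
    have Q: "countable ?Q" by (auto simp: countable_rat)
    have "Measurable.pred (F t) (\<lambda>\<omega>. \<forall>n::nat. \<exists>q\<in>?Q. ?\<phi> \<omega> q < 1 / real (Suc n))"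
    proof (intro pred_intros_countable)
      fix n :: nat
      have "{\<omega> \<in> space (F t). ?\<phi> \<omega> q < 1 / real (Suc n)} \<in> sets (F t)" if "q \<in> ?Q" for q
        using W[OF that] by measurable
      then show "Measurable.pred (F t) (\<lambda>\<omega>. \<exists>q\<in>?Q. ?\<phi> \<omega> q < 1 / real (Suc n))"
        unfolding pred_def by (intro sets.sets_Collect_countable_Ex' Q)
    qed
    then show ?thesis
      by (subst measurable_cong[where g="\<lambda>\<omega>. \<forall>n::nat. \<exists>q\<in>?Q. ?\<phi> \<omega> q < 1 / real (Suc n)"])
        (auto simp: space_F *)
  qed
qed

text \<open>The set matters only inside \<open>(0,1)\<close>, where the process is alive. If the
  exit happens at the lifetime, the set is never visited and \<open>hit\<close> takes its default
  value, the lifetime, so the two times agree in that case as well.\<close>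

lemma (in brownian_setting) hit_eq_exit_time:
  assumes \<omega>: "\<omega> \<in> space M" and cd: "0 \<le> c" "d \<le> 1"
    and A: "A \<inter> {0<..<1} = {0<..<1} - {c<..<d}"
  shows "hit W A \<omega> = exit_time W c d \<omega>"
proof -
  define H where "H = {t. t < \<infinity> \<and> killed W t \<omega> \<in> Some ` A}"
  have H_iff: "t \<in> H \<longleftrightarrow> t < \<infinity> \<and> t < lifetime W \<omega> \<and> W (enn2real t) \<omega> \<in> A" for t
    by (auto simp: H_def killed_def)
  have le: "exit_time W c d \<omega> \<le> lifetime W \<omega>"
    unfolding lifetime_eq_exit_time by (rule exit_time_mono) (use cd in auto)
  have lower: "exit_time W c d \<omega> \<le> t" if "t \<in> H" for t
  proof -
    obtain s where s: "t = ennreal s" "s \<ge> 0" using \<open>t \<in> H\<close> by (cases t) (auto simp: H_iff)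
    then have "W s \<omega> \<in> {0<..<1}"
      using \<open>t \<in> H\<close> inside_before_exit[OF \<omega> s(2), of 0 1] by (auto simp: H_iff lifetime_eq_exit_time)
    moreover have "W s \<omega> \<in> A" using \<open>t \<in> H\<close> s by (auto simp: H_iff)
    ultimately have "W s \<omega> \<notin> {c<..<d}" using A by blast
    then show ?thesis using exit_time_le_iff[OF \<omega> s(2), of c d] s by auto
  qed
  show ?thesis
  proof (cases "exit_time W c d \<omega> = lifetime W \<omega>")
    case True
    then have "H = {}" using lower H_iff by (metis equals0I not_le)
    then show ?thesis using True unfolding hit_def Let_def H_def[symmetric] by simp
  next
    case False
    then have less: "exit_time W c d \<omega> < lifetime W \<omega>" using le by simp
    then obtain s where s: "exit_time W c d \<omega> = ennreal s" "s \<ge> 0"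
      by (cases "exit_time W c d \<omega>") auto
    have "W s \<omega> \<in> {0<..<1} - {c<..<d}"
      using outside_at_exit[OF \<omega> s] inside_before_exit[OF \<omega> s(2), of 0 1] less s(1)
      by (simp add: lifetime_eq_exit_time)
    then have "W s \<omega> \<in> A" using A by blast
    then have "exit_time W c d \<omega> \<in> H" using less s by (auto simp: H_iff)
    then have "H \<noteq> {}" "Inf H = exit_time W c d \<omega>"
      using lower by (auto intro!: Inf_eqI)
    then show ?thesis unfolding hit_def Let_def H_def[symmetric] by simp
  qed
qed

lemma (in brownian_setting) hit_lower_eq_exit_time:
  "\<omega> \<in> space M \<Longrightarrow> l \<in> {0<..<1} \<Longrightarrow> hit W {0..l} \<omega> = exit_time W l 1 \<omega>"
  by (rule hit_eq_exit_time) auto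

lemma (in brownian_setting) hit_upper_eq_exit_time:
  "\<omega> \<in> space M \<Longrightarrow> r \<in> {0<..<1} \<Longrightarrow> hit W {r..1} \<omega> = exit_time W 0 r \<omega>"
  by (rule hit_eq_exit_time) auto

section \<open>Optional stopping\<close>

lemma diff_inverse_le_divide:
  fixes a c n :: real
  assumes "a * n - 1 \<le> c" "n > 0" shows "a - 1 / n \<le> c / n"
proof -
  have "a - 1 / n = (a * n - 1) / n" using assms by (simp add: diff_divide_distrib)
  also have "\<dots> \<le> c / n" using assms by (intro divide_right_mono) auto
  finally show ?thesis .
qed

lemma (in brownian_setting) measurable_path_value:
  assumes "t \<ge> 0" shows "W t \<in> borel_measurable M"
  using measurable_from_subalg[OF subalgebra_F adapted[OF assms]] .

lemma (in brownian_setting) measurable_at_grid_time: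
  assumes [measurable]: "m \<in> M \<rightarrow>\<^sub>M count_space UNIV"
  shows "(\<lambda>\<omega>. W (real (m \<omega>) / real (Suc k)) \<omega>) \<in> borel_measurable M"
  by (rule measurable_compose_countable[where f="\<lambda>i \<omega>. W (real i / real (Suc k)) \<omega>" and g=m])
    (auto intro!: measurable_path_value)

text \<open>Rounding down to a grid gives random times with countably many values; continuity of
  paths passes to the limit of finer grids.\<close>

lemma (in brownian_setting) measurable_at_random_time:
  assumes [measurable]: "T \<in> borel_measurable M" and nonneg: "\<And>\<omega>. \<omega> \<in> space M \<Longrightarrow> 0 \<le> T \<omega>"
  shows "(\<lambda>\<omega>. W (T \<omega>) \<omega>) \<in> borel_measurable M"
proof (rule borel_measurable_LIMSEQ_real)
  fix k :: nat
  show "(\<lambda>\<omega>. W (real (nat \<lfloor>T \<omega> * real (Suc k)\<rfloor>) / real (Suc k)) \<omega>) \<in> borel_measurable M"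
    by (rule measurable_at_grid_time) measurable
next
  fix \<omega> assume \<omega>: "\<omega> \<in> space M"
  have "(\<lambda>k. real (nat \<lfloor>T \<omega> * real (Suc k)\<rfloor>) / real (Suc k)) \<longlonglongrightarrow> T \<omega>"
  proof (rule tendsto_sandwich[where f="\<lambda>k. T \<omega> - 1 / real (Suc k)" and h="\<lambda>_. T \<omega>"])
    have eq: "real (nat \<lfloor>T \<omega> * real (Suc k)\<rfloor>) = of_int \<lfloor>T \<omega> * real (Suc k)\<rfloor>" for k
      using nonneg[OF \<omega>] by (intro of_nat_nat) auto
    show "\<forall>\<^sub>F k in sequentially. T \<omega> - 1 / real (Suc k) \<le> real (nat \<lfloor>T \<omega> * real (Suc k)\<rfloor>) / real (Suc k)"
      unfolding eq
    proof (intro always_eventually allI)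
      fix k
      have "T \<omega> * real (Suc k) - 1 \<le> of_int \<lfloor>T \<omega> * real (Suc k)\<rfloor>" by linarith
      then show "T \<omega> - 1 / real (Suc k) \<le> of_int \<lfloor>T \<omega> * real (Suc k)\<rfloor> / real (Suc k)"
        by (rule diff_inverse_le_divide) simp
    qed
    show "\<forall>\<^sub>F k in sequentially. real (nat \<lfloor>T \<omega> * real (Suc k)\<rfloor>) / real (Suc k) \<le> T \<omega>"
      unfolding eq by (intro always_eventually allI) (simp add: pos_divide_le_eq)
    show "(\<lambda>k. T \<omega> - 1 / real (Suc k)) \<longlonglongrightarrow> T \<omega>"
      using tendsto_diff[OF tendsto_const[of "T \<omega>"] LIMSEQ_inverse_real_of_nat] by (simp add: inverse_eq_divide)
  qed simp
  then show "(\<lambda>k. W (real (nat \<lfloor>T \<omega> * real (Suc k)\<rfloor>) / real (Suc k)) \<omega>) \<longlonglongrightarrow> W (T \<omega>) \<omega>"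
    by (intro continuous_on_tendsto_compose[OF continuous_paths[OF \<omega>]])
      (use nonneg[OF \<omega>] in auto)
qed

text \<open>Fourth moments are taken because over a grid of mesh \<open>1 / (k + 1)\<close> the
  second moments of the increments add up to the length of the time interval, whereas the fourth
  moments add up to a quantity of order \<open>1 / k\<close>.\<close>

lemma (in brownian_setting) increment_moments:
  assumes x: "x \<in> {0..1}" and st: "0 \<le> s" "s < t"
  shows "integrable (P x) (\<lambda>\<omega>. W t \<omega> - W s \<omega>)"
    and "(\<integral>\<omega>. W t \<omega> - W s \<omega> \<partial>P x) = 0"
    and "integrable (P x) (\<lambda>\<omega>. (W t \<omega> - W s \<omega>) ^ 4)"
    and "(\<integral>\<omega>. (W t \<omega> - W s \<omega>) ^ 4 \<partial>P x) = 3 * (t - s)\<^sup>2"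
proof -
  let ?\<sigma> = "sqrt (t - s)"
  have pos: "?\<sigma> > 0" using st by simp
  have D: "distributed (P x) lborel (\<lambda>\<omega>. W t \<omega> - W s \<omega>) (normal_density 0 ?\<sigma>)"
    by (rule normal_increments[OF x st])
  have nn: "\<And>y. y \<in> space lborel \<Longrightarrow> 0 \<le> normal_density 0 ?\<sigma> y" by simp
  show "integrable (P x) (\<lambda>\<omega>. W t \<omega> - W s \<omega>)"
    using distributed_integrable[OF D _ nn, of "\<lambda>y. y"] integrable_normal_moment[OF pos, of 0 1] by simp
  show "(\<integral>\<omega>. W t \<omega> - W s \<omega> \<partial>P x) = 0"
    using distributed_integral[OF D _ nn, of "\<lambda>y. y"] integral_normal_moment_odd[OF pos, of 0 0] by simp
  show "integrable (P x) (\<lambda>\<omega>. (W t \<omega> - W s \<omega>) ^ 4)"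
    using distributed_integrable[OF D _ nn, of "\<lambda>y. y ^ 4"] integrable_normal_moment[OF pos, of 0 4] by simp
  have "fact 4 / ((2 / ?\<sigma>\<^sup>2)\<^sup>2 * fact 2) = 3 * (t - s)\<^sup>2"
    using st by (simp add: fact_numeral power_divide field_simps)
  then show "(\<integral>\<omega>. (W t \<omega> - W s \<omega>) ^ 4 \<partial>P x) = 3 * (t - s)\<^sup>2"
    using distributed_integral[OF D _ nn, of "\<lambda>y. y ^ 4"] integral_normal_moment_even[OF pos, of 0 2] by simp
qed

text \<open>The indicator of \<open>A\<close> generates a sigma-algebra inside \<open>F s\<close>,
  hence is independent of the increment, and the expectation factors into one with mean 0. This is
  the martingale property in the form that a sum over grid steps needs.\<close>

lemma (in brownian_setting) increment_orthogonal:
  assumes x: "x \<in> {0..1}" and st: "0 \<le> s" "s < t" and A: "A \<in> sets (F (ennreal s))"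
  shows "integrable (P x) (\<lambda>\<omega>. indicator A \<omega> * (W t \<omega> - W s \<omega>))"
    and "(\<integral>\<omega>. indicator A \<omega> * (W t \<omega> - W s \<omega>) \<partial>P x) = 0"
proof -
  interpret prob_space "P x" by (rule prob_P[OF x])
  note sets_P[OF x, measurable_cong]
  have space: "space (P x) = space M" by (rule sets_eq_imp_space_eq[OF sets_P[OF x]])
  have [measurable]: "W t \<in> borel_measurable M" "W s \<in> borel_measurable M"
    using st by (auto intro: measurable_path_value)
  have AM[measurable]: "A \<in> sets M" using A subalgebra_F[of "ennreal s"] by (auto simp: subalgebra_def)
  have "indep_var borel (indicator A :: _ \<Rightarrow> real) borel (\<lambda>\<omega>. W t \<omega> - W s \<omega>)"
    unfolding indep_var_eq
  proof (intro conjI)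
    show "indicator A \<in> borel_measurable (P x)" "(\<lambda>\<omega>. W t \<omega> - W s \<omega>) \<in> borel_measurable (P x)"
      by measurable
    have sub: "sigma_sets (space (P x)) {indicator A -` B \<inter> space (P x) |B::real set. B \<in> sets borel} \<subseteq> sets (F (ennreal s))"
      unfolding space space_F[of "ennreal s", symmetric]
    proof (rule sets.sigma_sets_subset, clarify)
      fix B :: "real set" assume "B \<in> sets borel"
      moreover have "indicator A \<in> borel_measurable (F (ennreal s))" using A by measurable
      ultimately show "indicator A -` B \<inter> space (F (ennreal s)) \<in> sets (F (ennreal s))"
        by (rule measurable_sets[rotated])
    qed
    show "indep_set (sigma_sets (space (P x)) {indicator A -` B \<inter> space (P x) |B::real set. B \<in> sets borel})
        (sigma_sets (space (P x)) {(\<lambda>\<omega>. W t \<omega> - W s \<omega>) -` B \<inter> space (P x) |B. B \<in> sets borel})"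
      using independent_increments[OF x st] sub
      unfolding indep_sets2_eq sets_vimage_algebra space by blast
  qed
  note I = this
  have int: "integrable (P x) (indicator A :: _ \<Rightarrow> real)"
    by (intro integrable_const_bound[where B=1]) (auto split: split_indicator)
  show "integrable (P x) (\<lambda>\<omega>. indicator A \<omega> * (W t \<omega> - W s \<omega>))"
    by (rule indep_var_integrable[OF I int increment_moments(1)[OF x st]])
  show "(\<integral>\<omega>. indicator A \<omega> * (W t \<omega> - W s \<omega>) \<partial>P x) = 0"
    by (subst indep_var_lebesgue_integral[OF I int increment_moments(1)[OF x st]])
      (simp add: increment_moments(2)[OF x st])
qed

text \<open>Above the level \<open>\<delta>\<close> the fourth power takes over. The free
  \<open>\<delta>\<close> turns smallness of fourth moments into smallness of first absolute
  moments.\<close>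

lemma abs_le_fourth_power:
  fixes u \<delta> :: real
  assumes "\<delta> > 0"
  shows "\<bar>u\<bar> \<le> \<delta> + u ^ 4 / \<delta> ^ 3"
proof (cases "\<bar>u\<bar> \<le> \<delta>")
  case False
  then have "\<delta> ^ 3 * \<bar>u\<bar> \<le> \<bar>u\<bar> ^ 3 * \<bar>u\<bar>"
    using assms by (intro mult_right_mono power_mono) auto
  also have "\<dots> = u ^ 4" by (simp add: power_Suc2[symmetric] power_even_abs_numeral)
  finally have "\<bar>u\<bar> \<le> u ^ 4 / \<delta> ^ 3" using assms by (simp add: field_simps)
  then show ?thesis using assms by simp
qed (use assms in \<open>simp add: add_increasing2\<close>)

text \<open>The values at the last grid point before \<open>T\<close> are bounded, so they converge in mean; those at the
  next grid point have mean \<open>x\<close>. The two differ by one of the grid increments, which are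
  uniformly small in mean because their fourth moments add up to \<open>O(1/k)\<close>.\<close>

lemma (in brownian_setting) optional_stopping_bounded:
  fixes N :: nat
  assumes x: "x \<in> {0..1}" and T: "\<And>\<omega>. \<omega> \<in> space M \<Longrightarrow> T \<omega> \<in> {0..real N}"
    and stop: "\<And>t. t \<ge> 0 \<Longrightarrow> Measurable.pred (F (ennreal t)) (\<lambda>\<omega>. T \<omega> \<le> t)"
    and bdd: "AE \<omega> in P x. \<forall>t\<in>{0..T \<omega>}. W t \<omega> \<in> {0..1}"
  shows "(\<integral>\<omega>. W (T \<omega>) \<omega> \<partial>P x) = x"
proof -
  interpret prob_space "P x" by (rule prob_P[OF x])
  note sets_P[OF x, measurable_cong]
  have space: "space (P x) = space M" by (rule sets_eq_imp_space_eq[OF sets_P[OF x]])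
  have [measurable]: "T \<in> borel_measurable M"
  proof (rule borel_measurableI_le)
    fix t
    show "{\<omega> \<in> space M. T \<omega> \<le> t} \<in> sets M"
    proof (cases "t \<ge> 0")
      case True
      then show ?thesis using stop[OF True] subalgebra_F[of "ennreal t"]
        by (auto simp: pred_def space_F subalgebra_def)
    next
      case False
      then have "{\<omega> \<in> space M. T \<omega> \<le> t} = {}" using T by force
      then show ?thesis by (simp only: sets.empty_sets)
    qed
  qed
  define m where "m k \<omega> = nat \<lceil>T \<omega> * real (Suc k)\<rceil>" for k \<omega>
  define R where "R k \<omega> = W (real (m k \<omega>) / real (Suc k)) \<omega>" for k \<omega>
  \<comment> \<open>If \<open>T \<omega> = 0\<close>, then \<open>m k \<omega> = 0\<close> and
    truncated subtraction makes \<open>L\<close> and \<open>R\<close> both equal to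
    \<open>W 0\<close>.\<close>
  define L where "L k \<omega> = W (real (m k \<omega> - 1) / real (Suc k)) \<omega>" for k \<omega>
  define \<Delta> where "\<Delta> k j \<omega> = W (real (Suc j) / real (Suc k)) \<omega> - W (real j / real (Suc k)) \<omega>" for k j \<omega>
  define Y where "Y k j \<omega> = indicator {\<omega> \<in> space M. real j / real (Suc k) < T \<omega>} \<omega> * \<Delta> k j \<omega>" for k j \<omega>
  have m_meas[measurable]: "m k \<in> M \<rightarrow>\<^sub>M count_space UNIV" for k unfolding m_def by measurable
  have [measurable]: "R k \<in> borel_measurable M" "L k \<in> borel_measurable M" for k
    unfolding R_def L_def by (rule measurable_at_grid_time; measurable)+
  have W0[measurable]: "W 0 \<in> borel_measurable M" by (rule measurable_path_value) simp
  \<comment> \<open>The strict inequality makes the event that step \<open>j\<close> still takes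
    place the complement of \<open>T \<omega> \<le> j / (k + 1)\<close>, so it is known at the start
    of that step.\<close>
  have m_less: "j < m k \<omega> \<longleftrightarrow> real j / real (Suc k) < T \<omega>" for j k \<omega>
    unfolding m_def by (simp add: zless_nat_eq_int_zless less_ceiling_iff pos_divide_less_eq)
  have m_le: "m k \<omega> \<le> N * Suc k" if "\<omega> \<in> space M" for k \<omega>
  proof (rule ccontr)
    assume "\<not> ?thesis"
    then have "real (N * Suc k) / real (Suc k) < T \<omega>" using m_less[of "N * Suc k" k \<omega>] by simp
    moreover have "real (N * Suc k) / real (Suc k) = real N"
      by (subst of_nat_mult) (rule nonzero_mult_div_cancel_right, simp)
    ultimately show False using T[OF that] by simp
  qed
  have grid_le: "real (m k \<omega> - 1) / real (Suc k) \<in> {0..T \<omega>}" if "\<omega> \<in> space M" for k \<omega>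
    using m_less[of "m k \<omega> - 1" k \<omega>] T[OF that] by (cases "m k \<omega>") auto
  have grid_ge: "T \<omega> - 1 / real (Suc k) \<le> real (m k \<omega> - 1) / real (Suc k)" for k \<omega>
  proof -
    have "T \<omega> * real (Suc k) \<le> real (m k \<omega>)" unfolding m_def by linarith
    then have "T \<omega> * real (Suc k) - 1 \<le> real (m k \<omega> - 1)" by linarith
    then show ?thesis by (rule diff_inverse_le_divide) simp
  qed
  have step: "real j / real (Suc k) < real (Suc j) / real (Suc k)" for j k
    by (intro divide_strict_right_mono) auto
  have moments: "integrable (P x) (\<lambda>\<omega>. \<Delta> k j \<omega> ^ 4)"
      "(\<integral>\<omega>. \<Delta> k j \<omega> ^ 4 \<partial>P x) = 3 / (real (Suc k))\<^sup>2" for k j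
  proof -
    have diff: "real (Suc j) / real (Suc k) - real j / real (Suc k) = 1 / real (Suc k)"
      by (simp add: diff_divide_distrib[symmetric])
    show "integrable (P x) (\<lambda>\<omega>. \<Delta> k j \<omega> ^ 4)" "(\<integral>\<omega>. \<Delta> k j \<omega> ^ 4 \<partial>P x) = 3 / (real (Suc k))\<^sup>2"
      using increment_moments(3,4)[OF x _ step[of j k]]
      unfolding \<Delta>_def diff by (simp_all add: power_divide)
  qed
  have R_sum: "R k \<omega> = W 0 \<omega> + (\<Sum>j<N * Suc k. Y k j \<omega>)"
    if \<omega>: "\<omega> \<in> space M" for k \<omega>
  proof -
    have "(\<Sum>j<N * Suc k. Y k j \<omega>)
        = (\<Sum>j<m k \<omega>. \<Delta> k j \<omega>)"
    proof (intro sum.mono_neutral_cong_right ballI)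
      show "{..<m k \<omega>} \<subseteq> {..<N * Suc k}" using m_le[OF \<omega>, of k] by auto
    next
      fix j assume "j \<in> {..<N * Suc k} - {..<m k \<omega>}"
      then have "\<not> real j / real (Suc k) < T \<omega>" unfolding m_less[symmetric] by simp
      then show "Y k j \<omega> = 0"
        by (simp only: Y_def indicator_def mem_Collect_eq simp_thms of_bool_eq mult_zero_left)
    next
      fix j assume "j \<in> {..<m k \<omega>}"
      then have "real j / real (Suc k) < T \<omega>" unfolding m_less[symmetric] by simp
      then show "Y k j \<omega> = \<Delta> k j \<omega>"
        using \<omega> by (simp only: Y_def indicator_def mem_Collect_eq simp_thms of_bool_eq mult_1_left)
    qed simp
    also have "\<dots> = R k \<omega> - W 0 \<omega>"
      unfolding \<Delta>_def R_def by (subst sum_lessThan_telescope) simp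
    finally show ?thesis by simp
  qed
  have W0_int: "integrable (P x) (W 0)" "(\<integral>\<omega>. W 0 \<omega> \<partial>P x) = x"
  proof -
    show "integrable (P x) (W 0)"
      by (rule integrable_const_bound[where B="\<bar>x\<bar>"]) (use eventually_mono[OF start[OF x]] in auto)
    have "(\<integral>\<omega>. W 0 \<omega> \<partial>P x) = (\<integral>\<omega>. x \<partial>P x)"
      by (rule integral_cong_AE) (use start[OF x] in auto)
    then show "(\<integral>\<omega>. W 0 \<omega> \<partial>P x) = x" by (simp add: prob_space)
  qed
  have terms: "integrable (P x) (Y k j)"
      "(\<integral>\<omega>. Y k j \<omega> \<partial>P x) = 0" for j k
  proof -
    have "Measurable.pred (F (ennreal (real j / real (Suc k)))) (\<lambda>\<omega>. \<not> T \<omega> \<le> real j / real (Suc k))"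
      by (intro pred_intros_logic stop) auto
    then have "{\<omega> \<in> space M. real j / real (Suc k) < T \<omega>} \<in> sets (F (ennreal (real j / real (Suc k))))"
      by (simp add: pred_def space_F not_le)
    from increment_orthogonal[OF x _ step this]
    show "integrable (P x) (Y k j)"
      "(\<integral>\<omega>. Y k j \<omega> \<partial>P x) = 0"
      unfolding \<Delta>_def Y_def by auto
  qed
  have R_int: "integrable (P x) (R k)" "(\<integral>\<omega>. R k \<omega> \<partial>P x) = x" for k
  proof -
    have cong: "integrable (P x) (R k) = integrable (P x) (\<lambda>\<omega>. W 0 \<omega> + (\<Sum>j<N * Suc k. Y k j \<omega>))"
      "(\<integral>\<omega>. R k \<omega> \<partial>P x) = (\<integral>\<omega>. W 0 \<omega> + (\<Sum>j<N * Suc k. Y k j \<omega>) \<partial>P x)"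
      using R_sum by (auto intro!: Bochner_Integration.integrable_cong Bochner_Integration.integral_cong simp: space)
    show "integrable (P x) (R k)"
      unfolding cong by (intro Bochner_Integration.integrable_add Bochner_Integration.integrable_sum W0_int terms)
    show "(\<integral>\<omega>. R k \<omega> \<partial>P x) = x"
      unfolding cong
      by (subst Bochner_Integration.integral_add)
        (auto simp: W0_int terms Bochner_Integration.integral_sum simp del: mult_Suc_right
          intro!: Bochner_Integration.integrable_sum)
  qed
  have L_bdd: "AE \<omega> in P x. norm (L k \<omega>) \<le> 1" for k
    using bdd AE_space
  proof eventually_elim
    case (elim \<omega>)
    then have "L k \<omega> \<in> {0..1}" unfolding L_def using grid_le[of \<omega> k] space by blast
    then show ?case by auto
  qed
  have L_int: "integrable (P x) (L k)" for k
    by (rule integrable_const_bound[OF L_bdd]) measurable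
  have gap: "\<bar>(\<integral>\<omega>. L k \<omega> \<partial>P x) - x\<bar> \<le> \<delta> + 3 * real N / \<delta> ^ 3 * (1 / real (Suc k))" if \<delta>: "\<delta> > 0" for k \<delta>
  proof -
    have S_int: "integrable (P x) (\<lambda>\<omega>. \<delta> + (\<Sum>j<N * Suc k. \<Delta> k j \<omega> ^ 4) / \<delta> ^ 3)"
      by (intro Bochner_Integration.integrable_add integrable_divide_zero Bochner_Integration.integrable_sum moments) simp_all
    \<comment> \<open>The index of the increment that separates \<open>L\<close> from
      \<open>R\<close> is random; bounding its fourth power by the sum over all steps removes the
      dependence on it. The mean of that sum is \<open>3 * N / (k + 1)\<close>.\<close>
    have pointwise: "\<bar>R k \<omega> - L k \<omega>\<bar> \<le> \<delta> + (\<Sum>j<N * Suc k. \<Delta> k j \<omega> ^ 4) / \<delta> ^ 3" if \<omega>: "\<omega> \<in> space M" for \<omega>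
    proof (cases "m k \<omega>")
      case 0
      then show ?thesis using \<delta> by (simp add: R_def L_def sum_nonneg)
    next
      case (Suc i)
      then have "R k \<omega> - L k \<omega> = \<Delta> k i \<omega>" by (simp add: R_def L_def \<Delta>_def)
      moreover have "\<Delta> k i \<omega> ^ 4 \<le> (\<Sum>j<N * Suc k. \<Delta> k j \<omega> ^ 4)"
        using m_le[OF \<omega>, of k] Suc by (intro member_le_sum) auto
      ultimately show ?thesis
        using abs_le_fourth_power[OF \<delta>, of "\<Delta> k i \<omega>"] \<delta>
        by (smt (verit) divide_right_mono zero_le_power)
    qed
    have "\<bar>(\<integral>\<omega>. L k \<omega> \<partial>P x) - x\<bar> = \<bar>\<integral>\<omega>. R k \<omega> - L k \<omega> \<partial>P x\<bar>"
      using R_int L_int by (subst Bochner_Integration.integral_diff) auto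
    also have "\<dots> \<le> (\<integral>\<omega>. \<bar>R k \<omega> - L k \<omega>\<bar> \<partial>P x)"
      by (rule integral_abs_bound)
    also have "\<dots> \<le> (\<integral>\<omega>. \<delta> + (\<Sum>j<N * Suc k. \<Delta> k j \<omega> ^ 4) / \<delta> ^ 3 \<partial>P x)"
      by (intro integral_mono S_int pointwise integrable_abs Bochner_Integration.integrable_diff R_int L_int)
        (simp add: space)
    also have "\<dots> = \<delta> + (\<Sum>j<N * Suc k. 3 / (real (Suc k))\<^sup>2) / \<delta> ^ 3"
      by (subst Bochner_Integration.integral_add)
        (auto simp: moments Bochner_Integration.integral_sum prob_space
          intro!: integrable_divide_zero Bochner_Integration.integrable_sum)
    also have "\<dots> = \<delta> + 3 * real N / \<delta> ^ 3 * (1 / real (Suc k))"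
    proof -
      have "u * n * (3 / n\<^sup>2) / d = 3 * u / d * (1 / n)" if "n \<noteq> 0" for u n d :: real
        using that by (simp add: power2_eq_square mult.commute)
      from this[of "real (Suc k)" "real N" "\<delta> ^ 3"] show ?thesis
        by (simp only: sum_constant card_lessThan of_nat_mult of_nat_eq_0_iff nat.distinct simp_thms)
    qed
    finally show ?thesis .
  qed
  have WT[measurable]: "(\<lambda>\<omega>. W (T \<omega>) \<omega>) \<in> borel_measurable M"
    by (rule measurable_at_random_time) (use T in auto)
  have lim: "(\<lambda>k. \<integral>\<omega>. L k \<omega> \<partial>P x) \<longlonglongrightarrow> (\<integral>\<omega>. W (T \<omega>) \<omega> \<partial>P x)"
  proof (rule integral_dominated_convergence[where w="\<lambda>_. 1"])
    show "AE \<omega> in P x. (\<lambda>k. L k \<omega>) \<longlonglongrightarrow> W (T \<omega>) \<omega>"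
    proof (rule AE_I2)
      fix \<omega> assume "\<omega> \<in> space (P x)"
      then have \<omega>: "\<omega> \<in> space M" by (simp add: space)
      have "(\<lambda>k. T \<omega> - 1 / real (Suc k)) \<longlonglongrightarrow> T \<omega>"
        using tendsto_diff[OF tendsto_const[of "T \<omega>"] LIMSEQ_inverse_real_of_nat] by (simp add: inverse_eq_divide)
      then have "(\<lambda>k. real (m k \<omega> - 1) / real (Suc k)) \<longlonglongrightarrow> T \<omega>"
        by (rule tendsto_sandwich[rotated 2, OF _ tendsto_const])
          (use grid_ge[of \<omega>] grid_le[OF \<omega>] in \<open>auto intro!: always_eventually\<close>)
      then show "(\<lambda>k. L k \<omega>) \<longlonglongrightarrow> W (T \<omega>) \<omega>"
        unfolding L_def
        by (intro continuous_on_tendsto_compose[OF continuous_paths[OF \<omega>]]) (use T[OF \<omega>] in auto)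
    qed
  qed (use L_bdd in auto)
  \<comment> \<open>The order of the limits matters: \<open>k\<close> goes to infinity with
    \<open>\<delta>\<close> fixed, so that \<open>3 * N / \<delta> ^ 3\<close> stays constant, and
    only then \<open>\<delta>\<close> shrinks.\<close>
  have "\<bar>(\<integral>\<omega>. W (T \<omega>) \<omega> \<partial>P x) - x\<bar> \<le> \<delta>" if \<delta>: "\<delta> > 0" for \<delta>
  proof (rule LIMSEQ_le)
    show "(\<lambda>k. \<bar>(\<integral>\<omega>. L k \<omega> \<partial>P x) - x\<bar>) \<longlonglongrightarrow> \<bar>(\<integral>\<omega>. W (T \<omega>) \<omega> \<partial>P x) - x\<bar>"
      by (intro tendsto_intros lim)
    show "(\<lambda>k. \<delta> + 3 * real N / \<delta> ^ 3 * (1 / real (Suc k))) \<longlonglongrightarrow> \<delta>"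
      using tendsto_add[OF tendsto_const[of \<delta>] tendsto_mult[OF tendsto_const[of "3 * real N / \<delta> ^ 3"] LIMSEQ_inverse_real_of_nat]]
      by (simp add: inverse_eq_divide)
  qed (use gap[OF \<delta>] in auto)
  then have "\<bar>(\<integral>\<omega>. W (T \<omega>) \<omega> \<partial>P x) - x\<bar> \<le> 0"
    by (rule field_le_epsilon) simp
  then show ?thesis by simp
qed

section \<open>Finiteness of exit times and optional stopping on leaving an interval\<close>

lemma (in brownian_setting) measurable_stopping_time_M:
  "stopping_time F T \<Longrightarrow> T \<in> borel_measurable M"
  by (rule measurable_stopping_time[where F=F]) (use subalgebra_F in \<open>auto simp: subalgebra_def space_F\<close>)

text \<open>A path that never leaves satisfies \<open>\<bar>W (n + 1) - W 0\<bar> \<le> 1\<close>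
  for every \<open>n\<close>. The normal density is at most its peak
  \<open>1 / sqrt (2 * pi * (n + 1))\<close>, so the probability of this event on an interval of
  length 2 tends to 0.\<close>

lemma (in brownian_setting) exit_time_finite:
  assumes x: "x \<in> {0..1}" and cd: "0 \<le> c" "d \<le> 1"
  shows "AE \<omega> in P x. exit_time W c d \<omega> < \<infinity>"
proof -
  interpret prob_space "P x" by (rule prob_P[OF x])
  note sets_P[OF x, measurable_cong]
  have space: "space (P x) = space M" by (rule sets_eq_imp_space_eq[OF sets_P[OF x]])
  have [measurable]: "exit_time W c d \<in> borel_measurable M"
    by (rule measurable_stopping_time_M[OF stopping_time_exit_time])
  let ?B = "{\<omega> \<in> space (P x). exit_time W c d \<omega> = \<infinity>}"
  have B[measurable]: "?B \<in> sets (P x)" by measurable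
  have bound: "emeasure (P x) ?B \<le> ennreal (2 / sqrt (2 * pi * real (Suc n)))" for n
  proof -
    let ?\<sigma> = "sqrt (real (Suc n) - 0)" and ?X = "\<lambda>\<omega>. W (real (Suc n)) \<omega> - W 0 \<omega>"
    have D: "distributed (P x) lborel ?X (normal_density 0 ?\<sigma>)"
      by (rule normal_increments[OF x]) auto
    have [measurable]: "W (real (Suc n)) \<in> borel_measurable M" "W 0 \<in> borel_measurable M"
      by (rule measurable_path_value; simp)+
    have "?B \<subseteq> ?X -` {-1..1} \<inter> space (P x)"
    proof
      fix \<omega> assume "\<omega> \<in> ?B"
      then have \<omega>: "\<omega> \<in> space (P x)" and inf: "exit_time W c d \<omega> = \<infinity>" by auto
      have "W t \<omega> \<in> {c<..<d}" if "t \<ge> 0" for t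
        using inside_before_exit[of \<omega> t c d] \<omega> inf that by (simp add: space)
      from this[of "real (Suc n)"] this[of 0] show "\<omega> \<in> ?X -` {-1..1} \<inter> space (P x)" using cd \<omega> by simp
    qed
    then have "emeasure (P x) ?B \<le> emeasure (P x) (?X -` {-1..1} \<inter> space (P x))"
      by (intro emeasure_mono) measurable
    also have "\<dots> = (\<integral>\<^sup>+y. ennreal (normal_density 0 ?\<sigma> y) * indicator {-1..1} y \<partial>lborel)"
      by (rule distributed_emeasure[OF D]) simp
    also have "\<dots> \<le> (\<integral>\<^sup>+y. ennreal (1 / sqrt (2 * pi * real (Suc n))) * indicator {-1..1::real} y \<partial>lborel)"
    proof (intro nn_integral_mono mult_right_mono ennreal_leI)
      fix y :: real
      have "normal_density 0 ?\<sigma> y = 1 / sqrt (2 * pi * real (Suc n)) * exp (- y\<^sup>2 / (2 * real (Suc n)))"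
        by (simp add: normal_density_def)
      also have "\<dots> \<le> 1 / sqrt (2 * pi * real (Suc n)) * 1"
        by (intro mult_left_mono) auto
      finally show "normal_density 0 ?\<sigma> y \<le> 1 / sqrt (2 * pi * real (Suc n))" by simp
    qed simp
    also have "\<dots> = ennreal (1 / sqrt (2 * pi * real (Suc n))) * ennreal 2"
      by (subst nn_integral_cmult_indicator) simp_all
    also have "\<dots> = ennreal (2 / sqrt (2 * pi * real (Suc n)))"
      by (subst ennreal_mult[symmetric]) simp_all
    finally show ?thesis .
  qed
  have "(\<lambda>n. 2 / sqrt (2 * pi * real (Suc n))) \<longlonglongrightarrow> 0"
  proof -
    have "(\<lambda>n. 2 / sqrt (2 * pi) * sqrt (inverse (real (Suc n)))) \<longlonglongrightarrow> 2 / sqrt (2 * pi) * sqrt 0"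
      by (intro tendsto_intros LIMSEQ_inverse_real_of_nat)
    moreover have "2 / sqrt (2 * pi) * sqrt (inverse (real (Suc n))) = 2 / sqrt (2 * pi * real (Suc n))" for n
      unfolding real_sqrt_mult[of "2 * pi" "real (Suc n)"] real_sqrt_inverse
      by (simp only: divide_inverse inverse_mult_distrib mult.assoc)
    ultimately show ?thesis by (simp only: real_sqrt_zero mult_zero_right)
  qed
  moreover have "measure (P x) ?B \<le> 2 / sqrt (2 * pi * real (Suc n))" for n
    using bound[of n] by (simp add: emeasure_eq_measure ennreal_le_iff)
  ultimately have "measure (P x) ?B \<le> 0"
    by (intro LIMSEQ_le_const) auto
  then have "emeasure (P x) ?B = 0" by (simp add: emeasure_eq_measure measure_le_0_iff)
  then have "AE \<omega> in P x. \<omega> \<notin> ?B" by (intro AE_not_in null_setsI B)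
  then show ?thesis using AE_space by eventually_elim (simp add: less_top)
qed

lemma (in brownian_setting) stays_in_interval:
  assumes "\<omega> \<in> space M" "W 0 \<omega> \<in> {c..d}" "exit_time W c d \<omega> < \<infinity>" "T \<le> exit_time W c d \<omega>"
    "t \<in> {0..enn2real T}"
  shows "W t \<omega> \<in> {c..d}"
proof (rule closed_before_exit[OF assms(1)])
  have "T < \<infinity>" using assms by (auto intro: le_less_trans)
  then have "ennreal t \<le> T" using assms(5) by (cases T) (auto intro: ennreal_leI)
  then show "ennreal t \<le> exit_time W c d \<omega>" using assms(4) by simp
qed (use assms in auto)

text \<open>Truncating at \<open>n\<close> reduces to bounded times. The exit time is almost surely
  finite, so the truncated times eventually equal \<open>S\<close>, and the values stay in
  \<open>{0..1}\<close>, which permits dominated convergence. \<open>enn2real\<close> turns an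
  infinite time into 0, but only on a null set.\<close>

lemma (in brownian_setting) optional_stopping:
  fixes T :: "'w \<Rightarrow> ennreal" and c d x :: real
  defines "S \<equiv> \<lambda>\<omega>. enn2real (min (T \<omega>) (exit_time W c d \<omega>))"
  assumes cd: "0 \<le> c" "d \<le> 1" and x: "x \<in> {c<..<d}" and T: "stopping_time F T"
  shows "(\<lambda>\<omega>. W (S \<omega>) \<omega>) \<in> borel_measurable M"
    and "AE \<omega> in P x. W (S \<omega>) \<omega> \<in> {c..d}"
    and "(\<integral>\<omega>. W (S \<omega>) \<omega> \<partial>P x) = x"
proof -
  have x01: "x \<in> {0..1}" using x cd by auto
  interpret prob_space "P x" by (rule prob_P[OF x01])
  note sets_P[OF x01, measurable_cong]
  have space: "space (P x) = space M" by (rule sets_eq_imp_space_eq[OF sets_P[OF x01]])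
  let ?\<rho> = "exit_time W c d"
  have \<rho>: "stopping_time F ?\<rho>" by (rule stopping_time_exit_time)
  have [measurable]: "?\<rho> \<in> borel_measurable M" "T \<in> borel_measurable M"
    by (intro measurable_stopping_time_M \<rho> T)+
  show S_meas[measurable]: "(\<lambda>\<omega>. W (S \<omega>) \<omega>) \<in> borel_measurable M"
    unfolding S_def by (rule measurable_at_random_time) auto
  have good: "AE \<omega> in P x. \<omega> \<in> space M \<and> W 0 \<omega> = x \<and> ?\<rho> \<omega> < \<infinity>"
    using start[OF x01] exit_time_finite[OF x01 cd] AE_space by eventually_elim (simp add: space)
  show "AE \<omega> in P x. W (S \<omega>) \<omega> \<in> {c..d}"
    using good
  proof eventually_elim
    case (elim \<omega>)
    show ?case unfolding S_def
      by (rule stays_in_interval[of \<omega> c d "min (T \<omega>) (?\<rho> \<omega>)"]) (use elim x in auto)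
  qed
  define S' where "S' n \<omega> = enn2real (min (min (T \<omega>) (?\<rho> \<omega>)) (ennreal (real n)))" for n :: nat and \<omega>
  have S'_fin: "min (min (T \<omega>) (?\<rho> \<omega>)) (ennreal (real n)) = ennreal (S' n \<omega>)" for n \<omega>
    unfolding S'_def by (intro ennreal_enn2real[symmetric]) (auto simp: min_less_iff_disj)
  have S'_nonneg: "0 \<le> S' n \<omega>" for n \<omega> by (simp add: S'_def)
  have S'_meas[measurable]: "(\<lambda>\<omega>. W (S' n \<omega>) \<omega>) \<in> borel_measurable M" for n
    by (rule measurable_at_random_time) (auto simp: S'_def)
  have in01: "AE \<omega> in P x. \<forall>t\<in>{0..S' n \<omega>}. W t \<omega> \<in> {0..1}" for n
    using good
  proof eventually_elim
    case (elim \<omega>)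
    show ?case
    proof
      fix t assume t: "t \<in> {0..S' n \<omega>}"
      have "W t \<omega> \<in> {c..d}"
        by (rule stays_in_interval[of \<omega> c d "min (min (T \<omega>) (?\<rho> \<omega>)) (ennreal (real n))"])
          (use elim x t in \<open>auto simp: S'_def[symmetric] min.coboundedI1\<close>)
      then show "W t \<omega> \<in> {0..1}" using cd by auto
    qed
  qed
  have mean: "(\<integral>\<omega>. W (S' n \<omega>) \<omega> \<partial>P x) = x" for n
  proof (rule optional_stopping_bounded[OF x01 _ _ in01])
    fix \<omega>
    have "ennreal (S' n \<omega>) \<le> ennreal (real n)" by (simp add: S'_fin[symmetric])
    then show "S' n \<omega> \<in> {0..real n}" using S'_nonneg by simp
  next
    fix t :: real assume "t \<ge> 0"
    have "stopping_time F (\<lambda>\<omega>. min (min (T \<omega>) (?\<rho> \<omega>)) (ennreal (real n)))"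
      by (intro stopping_time_min T \<rho> stopping_time_const)
    then have "Measurable.pred (F (ennreal t)) (\<lambda>\<omega>. ennreal (S' n \<omega>) \<le> ennreal t)"
      unfolding S'_fin by (rule stopping_timeD)
    then show "Measurable.pred (F (ennreal t)) (\<lambda>\<omega>. S' n \<omega> \<le> t)"
      using \<open>t \<ge> 0\<close> by simp
  qed
  have "(\<lambda>n. \<integral>\<omega>. W (S' n \<omega>) \<omega> \<partial>P x) \<longlonglongrightarrow> (\<integral>\<omega>. W (S \<omega>) \<omega> \<partial>P x)"
  proof (rule integral_dominated_convergence[where w="\<lambda>_. 1"])
    show "AE \<omega> in P x. (\<lambda>n. W (S' n \<omega>) \<omega>) \<longlonglongrightarrow> W (S \<omega>) \<omega>"
      using good
    proof eventually_elim
      case (elim \<omega>)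
      then have "min (T \<omega>) (?\<rho> \<omega>) < \<infinity>" by (simp add: min_less_iff_disj)
      then obtain s where s: "min (T \<omega>) (?\<rho> \<omega>) = ennreal s" "s \<ge> 0"
        by (cases "min (T \<omega>) (?\<rho> \<omega>)") auto
      obtain n0 :: nat where n0: "s \<le> real n0" using real_arch_simple by blast
      have "S' n \<omega> = S \<omega>" if "n \<ge> n0" for n
      proof -
        have "s \<le> real n" using n0 that by linarith
        then show ?thesis unfolding S'_def S_def s by (simp add: min_absorb1 ennreal_leI)
      qed
      then show ?case
        by (intro tendsto_eventually eventually_sequentiallyI[of n0]) simp
    qed
    show "AE \<omega> in P x. norm (W (S' n \<omega>) \<omega>) \<le> 1" for n
      using in01[of n] by eventually_elim (use S'_nonneg in force)
  qed auto
  then show "(\<integral>\<omega>. W (S \<omega>) \<omega> \<partial>P x) = x"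
    unfolding mean by (simp add: LIMSEQ_const_iff)
qed

section \<open>Rewards at stopping times\<close>

lemma (in brownian_setting) inside_before_exit':
  assumes "\<omega> \<in> space M" "t < exit_time W c d \<omega>"
  shows "W (enn2real t) \<omega> \<in> {c<..<d}"
proof (rule inside_before_exit[OF assms(1)])
  have "t < \<infinity>" using assms(2) by (metis infinity_ennreal_def less_top order_less_imp_not_less order.strict_trans)
  then show "ennreal (enn2real t) < exit_time W c d \<omega>" using assms(2) by simp
qed simp

lemma (in brownian_setting) measurable_ext0_killed:
  assumes \<phi>: "continuous_on {0..1} \<phi>" and [measurable]: "T \<in> borel_measurable M"
  shows "(\<lambda>\<omega>. ext0 \<phi> (killed W (T \<omega>) \<omega>)) \<in> borel_measurable M"
proof -
  \<comment> \<open>Clamping extends \<open>\<phi>\<close>, which is continuous on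
    \<open>{0..1}\<close> only, to a continuous function on the line; the surviving process lies in
    \<open>(0,1)\<close>, where both agree.\<close>
  define \<psi> where "\<psi> z = \<phi> (max 0 (min 1 z))" for z :: real
  have "continuous_on UNIV \<psi>"
    unfolding \<psi>_def by (intro continuous_on_compose2[OF \<phi>] continuous_intros) auto
  then have [measurable]: "\<psi> \<in> borel_measurable borel" by (rule borel_measurable_continuous_onI)
  have [measurable]: "exit_time W 0 1 \<in> borel_measurable M"
    by (rule measurable_stopping_time_M[OF stopping_time_exit_time])
  have [measurable]: "(\<lambda>\<omega>. W (enn2real (T \<omega>)) \<omega>) \<in> borel_measurable M"
    by (rule measurable_at_random_time) auto
  have "ext0 \<phi> (killed W (T \<omega>) \<omega>) =
      (if T \<omega> < exit_time W 0 1 \<omega> then \<psi> (W (enn2real (T \<omega>)) \<omega>) else 0)" if \<omega>: "\<omega> \<in> space M" for \<omega>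
  proof (cases "T \<omega> < exit_time W 0 1 \<omega>")
    case True
    then have "W (enn2real (T \<omega>)) \<omega> \<in> {0<..<1}"
      by (rule inside_before_exit'[OF \<omega>])
    then show ?thesis using True by (simp add: killed_def ext0_def lifetime_eq_exit_time \<psi>_def)
  qed (simp add: killed_def ext0_def lifetime_eq_exit_time)
  then show ?thesis by (subst measurable_cong) auto
qed

lemma (in brownian_setting) ext0_killed_bound:
  assumes \<omega>: "\<omega> \<in> space M" and C: "C \<ge> 0" "\<And>z. z \<in> {0..1} \<Longrightarrow> \<bar>\<phi> z\<bar> \<le> C"
  shows "\<bar>ext0 \<phi> (killed W t \<omega>)\<bar> \<le> C"
proof (cases "t < exit_time W 0 1 \<omega>")
  case True
  then have "W (enn2real t) \<omega> \<in> {0<..<1}"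
    by (rule inside_before_exit'[OF \<omega>])
  then show ?thesis using C by (simp add: killed_def ext0_def)
qed (simp add: killed_def ext0_def lifetime_eq_exit_time C)

lemma admissible_rewards_bound:
  assumes "admissible_rewards f g h"
  obtains C where "C \<ge> 0" "\<And>z. z \<in> {0..1} \<Longrightarrow> \<bar>f z\<bar> \<le> C" "\<And>z. z \<in> {0..1} \<Longrightarrow> \<bar>g z\<bar> \<le> C"
    "\<And>z. z \<in> {0..1} \<Longrightarrow> \<bar>h z\<bar> \<le> C"
proof -
  have "bounded (f ` {0..1} \<union> g ` {0..1} \<union> h ` {0..1})"
    using assms unfolding admissible_rewards_def by (simp only: bounded_Un) blast
  then obtain C where C: "\<And>z. z \<in> f ` {0..1} \<union> g ` {0..1} \<union> h ` {0..1} \<Longrightarrow> norm z \<le> C"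
    unfolding bounded_iff by blast
  show thesis
    by (rule that[of "max C 0"]) (use C in \<open>force simp: le_max_iff_disj\<close>)+
qed

lemma (in brownian_setting) stopped_value_cases:
  fixes T :: "'w \<Rightarrow> ennreal" and \<omega> c d
  defines "S \<equiv> enn2real (min (T \<omega>) (exit_time W c d \<omega>))"
  assumes \<omega>: "\<omega> \<in> space M" and W0: "W 0 \<omega> \<in> {c<..<d}" and fin: "exit_time W c d \<omega> < \<infinity>"
  shows "T \<omega> < exit_time W c d \<omega> \<Longrightarrow> W S \<omega> \<in> {c<..<d}"
    and "exit_time W c d \<omega> \<le> T \<omega> \<Longrightarrow> W S \<omega> = c \<or> W S \<omega> = d"
proof -
  assume "T \<omega> < exit_time W c d \<omega>"
  then show "W S \<omega> \<in> {c<..<d}"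
    using inside_before_exit'[OF \<omega>, of "T \<omega>" c d] by (simp add: S_def min_absorb1)
next
  assume "exit_time W c d \<omega> \<le> T \<omega>"
  then have "exit_time W c d \<omega> = ennreal S" using fin by (simp add: S_def min_absorb2)
  then show "W S \<omega> = c \<or> W S \<omega> = d"
    using W0 by (intro endpoint_at_exit[OF \<omega>]) (auto simp: S_def)
qed

definition stopping_reward ::
  "(real \<Rightarrow> 'w \<Rightarrow> real) \<Rightarrow> (real \<Rightarrow> real) \<Rightarrow> (real \<Rightarrow> real) \<Rightarrow> ('w \<Rightarrow> ennreal) \<Rightarrow> ('w \<Rightarrow> ennreal) \<Rightarrow> 'w \<Rightarrow> real" where
  "stopping_reward W f g \<tau> \<rho> \<omega> =
     ext0 f (killed W (\<tau> \<omega>) \<omega>) * of_bool (\<tau> \<omega> < \<rho> \<omega>) + ext0 g (killed W (\<rho> \<omega>) \<omega>) * of_bool (\<tau> \<omega> \<ge> \<rho> \<omega>)"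

text \<open>Killing becomes invisible: if the exit is at 0 or 1, the process is already in the
  cemetery and pays 0, which is also the value of \<open>g\<close> there. The reward is thus a
  function of the Brownian position alone, and optional stopping applies.\<close>

lemma (in brownian_setting) stopping_reward_eq:
  assumes cd: "0 \<le> c" "d \<le> 1" and \<omega>: "\<omega> \<in> space M" and W0: "W 0 \<omega> \<in> {c<..<d}"
    and fin: "exit_time W c d \<omega> < \<infinity>" and g: "g 0 = 0" "g 1 = 0"
  shows "stopping_reward W f g T (exit_time W c d) \<omega> =
    (if T \<omega> < exit_time W c d \<omega> then f else g) (W (enn2real (min (T \<omega>) (exit_time W c d \<omega>))) \<omega>)"
proof -
  have le: "exit_time W c d \<omega> \<le> exit_time W 0 1 \<omega>" by (rule exit_time_mono) (use cd in auto)
  show ?thesis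
  proof (cases "T \<omega> < exit_time W c d \<omega>")
    case True
    then show ?thesis using le
      by (auto simp: stopping_reward_def ext0_def killed_def lifetime_eq_exit_time min_def)
  next
    case False
    let ?s = "enn2real (exit_time W c d \<omega>)"
    have s: "exit_time W c d \<omega> = ennreal ?s" using fin by simp
    have "ext0 g (killed W (exit_time W c d \<omega>) \<omega>) = g (W ?s \<omega>)"
    proof (cases "exit_time W c d \<omega> < exit_time W 0 1 \<omega>")
      case True
      then show ?thesis by (simp add: ext0_def killed_def lifetime_eq_exit_time)
    next
      case False
      then have "exit_time W 0 1 \<omega> = ennreal ?s" using le s by simp
      then have "W ?s \<omega> = 0 \<or> W ?s \<omega> = 1"
        using W0 cd by (intro endpoint_at_exit[OF \<omega>]) auto
      then show ?thesis using False g by (auto simp: ext0_def killed_def lifetime_eq_exit_time)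
    qed
    then show ?thesis using False by (auto simp: stopping_reward_def min_absorb2)
  qed
qed

lemma (in brownian_setting) measurable_stopping_reward:
  assumes "continuous_on {0..1} f" "continuous_on {0..1} g"
    and [measurable]: "T \<in> borel_measurable M" "S \<in> borel_measurable M"
  shows "stopping_reward W f g T S \<in> borel_measurable M"
proof -
  have [measurable]: "(\<lambda>\<omega>. ext0 f (killed W (T \<omega>) \<omega>)) \<in> borel_measurable M"
    "(\<lambda>\<omega>. ext0 g (killed W (S \<omega>) \<omega>)) \<in> borel_measurable M"
    by (intro measurable_ext0_killed assms)+
  show ?thesis unfolding stopping_reward_def of_bool_def by measurable
qed

lemma (in brownian_setting) AE_start_exit:
  assumes "0 \<le> c" "d \<le> 1" "x \<in> {c<..<d}"
  shows "AE \<omega> in P x. \<omega> \<in> space M \<and> W 0 \<omega> = x \<and> exit_time W c d \<omega> < \<infinity>"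
proof -
  have x: "x \<in> {0..1}" using assms by auto
  have "space (P x) = space M" by (rule sets_eq_imp_space_eq[OF sets_P[OF x]])
  then show ?thesis
    using start[OF x] exit_time_finite[OF x assms(1,2)] AE_space[of "P x"] by (auto elim: eventually_elim2)
qed

text \<open>Domination of \<open>g\<close> is required at \<open>c\<close> and \<open>d\<close>
  only, since a player who does not stop first is paid at one of these two points; a player who does
  stop first is paid inside the interval. The affine function itself keeps its mean by
  \<open>optional_stopping\<close>.\<close>

lemma (in brownian_setting) stopping_reward_integral_le:
  assumes cd: "0 \<le> c" "d \<le> 1" and x: "x \<in> {c<..<d}" and adm: "admissible_rewards f g h"
    and T: "stopping_time F T"
    and f_le: "\<And>z. z \<in> {c<..<d} \<Longrightarrow> f z \<le> \<alpha> * z + \<beta>"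
    and g_le: "g c \<le> \<alpha> * c + \<beta>" "g d \<le> \<alpha> * d + \<beta>"
  shows "(\<integral>\<omega>. stopping_reward W f g T (exit_time W c d) \<omega> \<partial>P x) \<le> \<alpha> * x + \<beta>"
proof -
  have x01: "x \<in> {0..1}" using x cd by auto
  interpret prob_space "P x" by (rule prob_P[OF x01])
  note sets_P[OF x01, measurable_cong]
  let ?\<rho> = "exit_time W c d" and ?S = "\<lambda>\<omega>. enn2real (min (T \<omega>) (exit_time W c d \<omega>))"
  have [measurable]: "?\<rho> \<in> borel_measurable M" "T \<in> borel_measurable M"
    by (intro measurable_stopping_time_M stopping_time_exit_time T)+
  have cont: "continuous_on {0..1} f" "continuous_on {0..1} g" and g0: "g 0 = 0" "g 1 = 0"
    using adm by (auto simp: admissible_rewards_def)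
  have [measurable]: "stopping_reward W f g T ?\<rho> \<in> borel_measurable M"
    by (intro measurable_stopping_reward cont) measurable
  note opt = optional_stopping[OF cd x T]
  note [measurable] = opt(1)
  have W_int: "integrable (P x) (\<lambda>\<omega>. W (?S \<omega>) \<omega>)"
    by (rule integrable_const_bound[where B=1])
      (use eventually_mono[OF opt(2)] cd in auto)
  obtain C where C: "C \<ge> 0" "\<And>z. z \<in> {0..1} \<Longrightarrow> \<bar>f z\<bar> \<le> C" "\<And>z. z \<in> {0..1} \<Longrightarrow> \<bar>g z\<bar> \<le> C"
    using admissible_rewards_bound[OF adm] by metis
  have R_int: "integrable (P x) (stopping_reward W f g T ?\<rho>)"
  proof (rule integrable_const_bound[where B=C])
    show "AE \<omega> in P x. norm (stopping_reward W f g T ?\<rho> \<omega>) \<le> C"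
      using AE_start_exit[OF cd x]
    proof eventually_elim
      case (elim \<omega>)
      then have "\<bar>ext0 f (killed W (T \<omega>) \<omega>)\<bar> \<le> C" "\<bar>ext0 g (killed W (?\<rho> \<omega>) \<omega>)\<bar> \<le> C"
        using ext0_killed_bound[where \<phi>=f, OF _ C(1,2)] ext0_killed_bound[where \<phi>=g, OF _ C(1,3)] by blast+
      then show ?case by (auto simp: stopping_reward_def not_less)
    qed
  qed measurable
  have "(\<integral>\<omega>. stopping_reward W f g T ?\<rho> \<omega> \<partial>P x) \<le> (\<integral>\<omega>. \<alpha> * W (?S \<omega>) \<omega> + \<beta> \<partial>P x)"
  proof (rule integral_mono_AE[OF R_int])
    show "integrable (P x) (\<lambda>\<omega>. \<alpha> * W (?S \<omega>) \<omega> + \<beta>)" using W_int by simp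
    show "AE \<omega> in P x. stopping_reward W f g T ?\<rho> \<omega> \<le> \<alpha> * W (?S \<omega>) \<omega> + \<beta>"
      using AE_start_exit[OF cd x]
    proof eventually_elim
      case (elim \<omega>)
      then have \<omega>: "\<omega> \<in> space M" "W 0 \<omega> \<in> {c<..<d}" "?\<rho> \<omega> < \<infinity>" using x by auto
      show ?case
        unfolding stopping_reward_eq[OF cd \<omega> g0]
      proof (cases "T \<omega> < ?\<rho> \<omega>")
        case True
        then show "(if T \<omega> < ?\<rho> \<omega> then f else g) (W (?S \<omega>) \<omega>) \<le> \<alpha> * W (?S \<omega>) \<omega> + \<beta>"
          using stopped_value_cases(1)[OF \<omega>, of T] f_le by simp
      next
        case False
        then have "W (?S \<omega>) \<omega> = c \<or> W (?S \<omega>) \<omega> = d"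
          using stopped_value_cases(2)[OF \<omega>, of T] by simp
        then show "(if T \<omega> < ?\<rho> \<omega> then f else g) (W (?S \<omega>) \<omega>) \<le> \<alpha> * W (?S \<omega>) \<omega> + \<beta>"
          using False g_le by auto
      qed
    qed
  qed
  also have "\<dots> = \<alpha> * x + \<beta>" using W_int opt(3) by (simp add: prob_space)
  finally show ?thesis .
qed

text \<open>An end of the smaller interval that lies strictly inside \<open>(c,d)\<close> is reached
  before the opponent stops and pays \<open>f\<close>; an end shared with the larger interval is
  reached together with the opponent, and ties pay \<open>g\<close>. The two conditionals encode
  this.\<close>

lemma (in brownian_setting) stopping_reward_integral_exit:
  assumes cd: "0 \<le> c" "c \<le> c'" "d' \<le> d" "d \<le> 1" and x: "x \<in> {c'<..<d'}" and adm: "admissible_rewards f g h"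
    and left: "(if c' \<in> {c<..<d} then f else g) c' = \<alpha> * c' + \<beta>"
    and right: "(if d' \<in> {c<..<d} then f else g) d' = \<alpha> * d' + \<beta>"
  shows "(\<integral>\<omega>. stopping_reward W f g (exit_time W c' d') (exit_time W c d) \<omega> \<partial>P x) = \<alpha> * x + \<beta>"
proof -
  have x01: "x \<in> {0..1}" and x': "x \<in> {c<..<d}" using x cd by auto
  have cd': "0 \<le> c'" "d' \<le> 1" using cd by auto
  interpret prob_space "P x" by (rule prob_P[OF x01])
  note sets_P[OF x01, measurable_cong]
  let ?\<rho> = "exit_time W c d" and ?T = "exit_time W c' d'"
  have [measurable]: "?\<rho> \<in> borel_measurable M" "?T \<in> borel_measurable M"
    by (intro measurable_stopping_time_M stopping_time_exit_time)+
  have cont: "continuous_on {0..1} f" "continuous_on {0..1} g" and g0: "g 0 = 0" "g 1 = 0"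
    using adm by (auto simp: admissible_rewards_def)
  have [measurable]: "stopping_reward W f g ?T ?\<rho> \<in> borel_measurable M"
    by (intro measurable_stopping_reward cont) measurable
  note opt = optional_stopping[OF cd' x stopping_time_exit_time[of c' d'], unfolded min.idem]
  note [measurable] = opt(1)
  have W_int: "integrable (P x) (\<lambda>\<omega>. W (enn2real (?T \<omega>)) \<omega>)"
    by (rule integrable_const_bound[where B=1])
      (use eventually_mono[OF opt(2)] cd' in auto)
  have "(\<integral>\<omega>. stopping_reward W f g ?T ?\<rho> \<omega> \<partial>P x) = (\<integral>\<omega>. \<alpha> * W (enn2real (?T \<omega>)) \<omega> + \<beta> \<partial>P x)"
  proof (rule integral_cong_AE)
    show "AE \<omega> in P x. stopping_reward W f g ?T ?\<rho> \<omega> = \<alpha> * W (enn2real (?T \<omega>)) \<omega> + \<beta>"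
      using AE_start_exit[OF cd(1,4) x'] AE_start_exit[OF cd' x]
    proof eventually_elim
      case (elim \<omega>)
      then have \<omega>: "\<omega> \<in> space M" "W 0 \<omega> \<in> {c<..<d}" "?\<rho> \<omega> < \<infinity>" and \<omega>': "W 0 \<omega> \<in> {c'<..<d'}" "?T \<omega> < \<infinity>"
        using x x' by auto
      have le: "?T \<omega> \<le> ?\<rho> \<omega>" by (rule exit_time_mono) (use cd in auto)
      let ?z = "W (enn2real (?T \<omega>)) \<omega>"
      have ends: "?z = c' \<or> ?z = d'"
        using stopped_value_cases(2)[OF \<omega>(1) \<omega>', of ?T] by simp
      have "?T \<omega> < ?\<rho> \<omega> \<Longrightarrow> ?z \<in> {c<..<d}"
        using stopped_value_cases(1)[OF \<omega>, of ?T] le by (simp add: min_absorb1)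
      moreover have "?z \<notin> {c<..<d}" if "\<not> ?T \<omega> < ?\<rho> \<omega>"
        using stopped_value_cases(2)[OF \<omega>, of ?T] le that by (auto simp: min_absorb1)
      ultimately have iff: "?T \<omega> < ?\<rho> \<omega> \<longleftrightarrow> ?z \<in> {c<..<d}" by blast
      have "stopping_reward W f g ?T ?\<rho> \<omega> = (if ?z \<in> {c<..<d} then f else g) ?z"
        unfolding stopping_reward_eq[OF cd(1,4) \<omega> g0] iff min_absorb1[OF le] by simp
      then show ?case using ends left right by metis
    qed
  qed measurable
  also have "\<dots> = \<alpha> * x + \<beta>" using W_int opt(3) by (simp add: prob_space)
  finally show ?thesis .
qed

lemma (in brownian_setting) stopping_reward_integral_now:
  assumes cd: "0 \<le> c" "d \<le> 1" and x: "x \<in> {c<..<d}" and adm: "admissible_rewards f g h"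
  shows "(\<integral>\<omega>. stopping_reward W f g (\<lambda>_. 0) (exit_time W c d) \<omega> \<partial>P x) = f x"
proof -
  have x01: "x \<in> {0..1}" using x cd by auto
  interpret prob_space "P x" by (rule prob_P[OF x01])
  note sets_P[OF x01, measurable_cong]
  have [measurable]: "exit_time W c d \<in> borel_measurable M"
    by (rule measurable_stopping_time_M[OF stopping_time_exit_time])
  have cont: "continuous_on {0..1} f" "continuous_on {0..1} g" and g0: "g 0 = 0" "g 1 = 0"
    using adm by (auto simp: admissible_rewards_def)
  have [measurable]: "stopping_reward W f g (\<lambda>_. 0) (exit_time W c d) \<in> borel_measurable M"
    by (intro measurable_stopping_reward cont) measurable
  have "(\<integral>\<omega>. stopping_reward W f g (\<lambda>_. 0) (exit_time W c d) \<omega> \<partial>P x) = (\<integral>\<omega>. f x \<partial>P x)"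
  proof (rule integral_cong_AE)
    show "AE \<omega> in P x. stopping_reward W f g (\<lambda>_. 0) (exit_time W c d) \<omega> = f x"
      using AE_start_exit[OF cd x]
    proof eventually_elim
      case (elim \<omega>)
      then have \<omega>: "\<omega> \<in> space M" "W 0 \<omega> \<in> {c<..<d}" "exit_time W c d \<omega> < \<infinity>" using x by auto
      have "exit_time W c d \<omega> \<noteq> 0"
        using outside_at_exit[OF \<omega>(1), of c d 0] \<omega>(2) by auto
      then show ?case
        unfolding stopping_reward_eq[OF cd \<omega> g0] using elim by (simp add: zero_less_iff_neq_zero)
    qed
  qed measurable
  then show ?thesis by (simp add: prob_space)
qed

section \<open>Bounds for the value of stopping against an exit time\<close>

lemma (in brownian_setting) value_against_eq_SUP:
  assumes hit: "\<forall>\<omega>\<in>space M. hit W A \<omega> = exit_time W c d \<omega>" and x: "x \<in> {0..1}"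
  shows "value_against F W P f g A x =
    (SUP \<tau>\<in>Collect (stopping_time F). \<integral>\<omega>. stopping_reward W f g \<tau> (exit_time W c d) \<omega> \<partial>P x)"
proof -
  have "space (P x) = space M" by (rule sets_eq_imp_space_eq[OF sets_P[OF x]])
  then show ?thesis
    unfolding value_against_def stopping_reward_def
    by (intro SUP_cong refl Bochner_Integration.integral_cong) (simp_all add: hit)
qed

lemma (in brownian_setting) value_against_le:
  assumes hit: "\<forall>\<omega>\<in>space M. hit W A \<omega> = exit_time W c d \<omega>"
    and cd: "0 \<le> c" "d \<le> 1" and x: "x \<in> {c<..<d}" and adm: "admissible_rewards f g h"
    and f_le: "\<And>z. z \<in> {c<..<d} \<Longrightarrow> f z \<le> \<alpha> * z + \<beta>"
    and g_le: "g c \<le> \<alpha> * c + \<beta>" "g d \<le> \<alpha> * d + \<beta>"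
  shows "value_against F W P f g A x \<le> \<alpha> * x + \<beta>"
proof -
  have "x \<in> {0..1}" using x cd by auto
  then show ?thesis
    unfolding value_against_eq_SUP[OF hit \<open>x \<in> {0..1}\<close>]
    using stopping_reward_integral_le[OF cd x adm _ f_le g_le] stopping_time_const[of F 0]
    by (intro cSUP_least) auto
qed

lemma (in brownian_setting) value_against_ge:
  assumes hit: "\<forall>\<omega>\<in>space M. hit W A \<omega> = exit_time W c d \<omega>"
    and cd: "0 \<le> c" "d \<le> 1" and x: "x \<in> {c<..<d}" and adm: "admissible_rewards f g h"
    and T: "stopping_time F T"
  shows "(\<integral>\<omega>. stopping_reward W f g T (exit_time W c d) \<omega> \<partial>P x) \<le> value_against F W P f g A x"
proof -
  have x01: "x \<in> {0..1}" using x cd by auto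
  obtain C where C: "\<And>z. z \<in> {0..1} \<Longrightarrow> \<bar>f z\<bar> \<le> C" "\<And>z. z \<in> {0..1} \<Longrightarrow> \<bar>g z\<bar> \<le> C"
    using admissible_rewards_bound[OF adm] by metis
  \<comment> \<open>A constant is an affine majorant of slope 0. The uniform bound is what makes the
    real supremum an upper bound of its members.\<close>
  have "(\<integral>\<omega>. stopping_reward W f g \<tau> (exit_time W c d) \<omega> \<partial>P x) \<le> 0 * x + C" if "stopping_time F \<tau>" for \<tau>
  proof (rule stopping_reward_integral_le[OF cd x adm that])
    show "f z \<le> 0 * z + C" if "z \<in> {c<..<d}" for z using C(1)[of z] that cd by auto
    show "g c \<le> 0 * c + C" "g d \<le> 0 * d + C" using C(2)[of c] C(2)[of d] x cd by auto
  qed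
  then have "bdd_above ((\<lambda>\<tau>. \<integral>\<omega>. stopping_reward W f g \<tau> (exit_time W c d) \<omega> \<partial>P x) ` Collect (stopping_time F))"
    by (intro bdd_aboveI2[where M="0 * x + C"]) auto
  then show ?thesis
    unfolding value_against_eq_SUP[OF hit x01] by (intro cSUP_upper) (use T in auto)
qed

lemma (in brownian_setting) value_against_ge_now:
  assumes hit: "\<forall>\<omega>\<in>space M. hit W A \<omega> = exit_time W c d \<omega>"
    and cd: "0 \<le> c" "d \<le> 1" and x: "x \<in> {c<..<d}" and adm: "admissible_rewards f g h"
  shows "f x \<le> value_against F W P f g A x"
  using value_against_ge[OF hit cd x adm stopping_time_const[of F 0]]
    stopping_reward_integral_now[OF cd x adm] by simp

lemma (in brownian_setting) value_against_ge_exit: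
  assumes hit: "\<forall>\<omega>\<in>space M. hit W A \<omega> = exit_time W c d \<omega>"
    and cd: "0 \<le> c" "c \<le> c'" "d' \<le> d" "d \<le> 1" and x: "x \<in> {c'<..<d'}" and adm: "admissible_rewards f g h"
    and left: "(if c' \<in> {c<..<d} then f else g) c' = \<alpha> * c' + \<beta>"
    and right: "(if d' \<in> {c<..<d} then f else g) d' = \<alpha> * d' + \<beta>"
  shows "\<alpha> * x + \<beta> \<le> value_against F W P f g A x"
proof -
  have "x \<in> {c<..<d}" using x cd by auto
  from value_against_ge[OF hit cd(1,4) this adm stopping_time_exit_time[of c' d']]
  show ?thesis using stopping_reward_integral_exit[OF cd x adm left right] by simp
qed

text \<open>The process starts in the cemetery, where all rewards vanish. Since
  \<open>f 1 = 0\<close>, this puts the endpoint 1 into the response set.\<close>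

lemma (in brownian_setting) value_against_boundary:
  assumes x: "x \<in> {0, 1}"
  shows "value_against F W P f g A x = 0"
proof -
  have x01: "x \<in> {0..1}" using x by auto
  have space: "space (P x) = space M" by (rule sets_eq_imp_space_eq[OF sets_P[OF x01]])
  have "(\<integral>\<omega>. ext0 f (killed W (\<tau> \<omega>) \<omega>) * of_bool (\<tau> \<omega> < hit W A \<omega>)
           + ext0 g (killed W (hit W A \<omega>) \<omega>) * of_bool (\<tau> \<omega> \<ge> hit W A \<omega>) \<partial>P x) = 0" for \<tau>
  proof (rule integral_eq_zero_AE)
    show "AE \<omega> in P x. ext0 f (killed W (\<tau> \<omega>) \<omega>) * of_bool (\<tau> \<omega> < hit W A \<omega>)
           + ext0 g (killed W (hit W A \<omega>) \<omega>) * of_bool (\<tau> \<omega> \<ge> hit W A \<omega>) = 0"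
      using start[OF x01] AE_space
    proof eventually_elim
      case (elim \<omega>)
      then have "exit_time W 0 1 \<omega> \<le> ennreal 0"
        using exit_time_le_iff[of \<omega> 0 0 1] x by (auto simp: space)
      then have "killed W t \<omega> = None" for t
        by (simp add: killed_def lifetime_eq_exit_time)
      then show ?case by (simp add: ext0_def)
    qed
  qed
  then show ?thesis
    unfolding value_against_def using stopping_time_const[of F 0]
    by (simp only:) (rule cSUP_const, auto)
qed

section \<open>Payoffs of threshold strategies and the equilibrium slope\<close>

lemma (in brownian_setting) stopping_time_hit_upper:
  "r \<in> {0<..<1} \<Longrightarrow> stopping_time F (hit W {r..1})"
  using stopping_time_exit_time[of 0 r]
  by (subst stopping_time_cong[where S="exit_time W 0 r"]) (auto simp: space_F hit_upper_eq_exit_time)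

text \<open>The game ends when the path leaves \<open>(l,y)\<close>. It is then at \<open>l\<close>,
  where only the opponent stops, or at \<open>y\<close>, where only the player stops; both points
  lie in \<open>(0,1)\<close>, so the process is still alive and ties do not occur.\<close>

lemma (in brownian_setting) payoff_upper_lower:
  assumes ly: "0 < l" "y < 1" and x: "x \<in> {l<..<y}" and adm: "admissible_rewards f g h"
    and left: "g l = \<alpha> * l + \<beta>" and right: "f y = \<alpha> * y + \<beta>"
  shows "payoff W P f g h x (hit W {y..1}) (hit W {0..l}) = \<alpha> * x + \<beta>"
proof -
  have x01: "x \<in> {0..1}" and ly': "0 \<le> l" "y \<le> 1" "l \<in> {0<..<1}" "y \<in> {0<..<1}" using x ly by auto
  interpret prob_space "P x" by (rule prob_P[OF x01])
  note sets_P[OF x01, measurable_cong]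
  have space: "space (P x) = space M" by (rule sets_eq_imp_space_eq[OF sets_P[OF x01]])
  let ?\<sigma> = "exit_time W 0 y" and ?\<rho> = "exit_time W l 1" and ?T = "exit_time W l y"
  have [measurable]: "?\<rho> \<in> borel_measurable M" "?\<sigma> \<in> borel_measurable M"
    by (intro measurable_stopping_time_M stopping_time_exit_time)+
  have cont: "continuous_on {0..1} f" "continuous_on {0..1} g" "continuous_on {0..1} h"
    using adm by (auto simp: admissible_rewards_def)
  have [measurable]: "(\<lambda>\<omega>. ext0 f (killed W (?\<sigma> \<omega>) \<omega>)) \<in> borel_measurable M"
    "(\<lambda>\<omega>. ext0 g (killed W (?\<rho> \<omega>) \<omega>)) \<in> borel_measurable M"
    "(\<lambda>\<omega>. ext0 h (killed W (?\<sigma> \<omega>) \<omega>)) \<in> borel_measurable M"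
    by (intro measurable_ext0_killed cont; measurable)+
  note opt = optional_stopping[OF ly'(1,2) x stopping_time_exit_time[of l y], unfolded min.idem]
  note [measurable] = opt(1)
  have W_int: "integrable (P x) (\<lambda>\<omega>. W (enn2real (?T \<omega>)) \<omega>)"
    by (rule integrable_const_bound[where B=1])
      (use eventually_mono[OF opt(2)] ly' in auto)
  let ?R = "\<lambda>\<omega>. ext0 f (killed W (?\<sigma> \<omega>) \<omega>) * of_bool (?\<sigma> \<omega> < ?\<rho> \<omega>)
        + ext0 g (killed W (?\<rho> \<omega>) \<omega>) * of_bool (?\<rho> \<omega> < ?\<sigma> \<omega>)
        + ext0 h (killed W (?\<sigma> \<omega>) \<omega>) * of_bool (?\<sigma> \<omega> = ?\<rho> \<omega>)"
  have "payoff W P f g h x (hit W {y..1}) (hit W {0..l}) = (\<integral>\<omega>. ?R \<omega> \<partial>P x)"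
    unfolding payoff_def
    by (rule Bochner_Integration.integral_cong)
      (simp_all add: space hit_upper_eq_exit_time[OF _ ly'(4)] hit_lower_eq_exit_time[OF _ ly'(3)])
  also have "\<dots> = (\<integral>\<omega>. \<alpha> * W (enn2real (?T \<omega>)) \<omega> + \<beta> \<partial>P x)"
  proof (rule integral_cong_AE)
    show "?R \<in> borel_measurable (P x)" unfolding of_bool_def by measurable
    show "AE \<omega> in P x. ?R \<omega> = \<alpha> * W (enn2real (?T \<omega>)) \<omega> + \<beta>"
      using AE_start_exit[OF ly'(1,2) x]
    proof eventually_elim
      case (elim \<omega>)
      then have \<omega>: "\<omega> \<in> space M" "W 0 \<omega> \<in> {l<..<y}" "?T \<omega> < \<infinity>" using x by auto
      define t where "t = enn2real (?T \<omega>)"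
      have t: "?T \<omega> = ennreal t" "t \<ge> 0" using \<omega>(3) by (auto simp: t_def)
      have le: "?T \<omega> \<le> ?\<sigma> \<omega>" "?T \<omega> \<le> ?\<rho> \<omega>" "?T \<omega> \<le> exit_time W 0 1 \<omega>"
        using ly' by (auto intro!: exit_time_mono)
      have "W t \<omega> = l \<or> W t \<omega> = y"
        using endpoint_at_exit[OF \<omega>(1) t] \<omega>(2) by auto
      then have inside: "W t \<omega> \<in> {0<..<1}" using ly x by auto
      then have "exit_time W 0 1 \<omega> \<noteq> ennreal t"
        using outside_at_exit[OF \<omega>(1) _ t(2), of 0 1] by blast
      then have alive: "ennreal t < exit_time W 0 1 \<omega>" using le(3) t(1) by simp
      from \<open>W t \<omega> = l \<or> W t \<omega> = y\<close> show ?case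
      proof
        assume l: "W t \<omega> = l"
        then have "?\<rho> \<omega> \<le> ennreal t" using exit_time_le_iff[OF \<omega>(1) t(2), of l 1] t(2) by auto
        then have \<rho>: "?\<rho> \<omega> = ennreal t" using le t by simp
        have "?\<sigma> \<omega> \<noteq> ennreal t"
          using outside_at_exit[OF \<omega>(1) _ t(2), of 0 y] l x ly by auto
        then have "?\<rho> \<omega> < ?\<sigma> \<omega>" using le t \<rho> by simp
        then have "?\<rho> \<omega> < ?\<sigma> \<omega>" "\<not> ?\<sigma> \<omega> < ?\<rho> \<omega>" "?\<sigma> \<omega> \<noteq> ?\<rho> \<omega>" by auto
        then show ?thesis
          using \<rho> l left t alive by (simp add: killed_def lifetime_eq_exit_time ext0_def)
      next
        assume y: "W t \<omega> = y"
        then have "?\<sigma> \<omega> \<le> ennreal t" using exit_time_le_iff[OF \<omega>(1) t(2), of 0 y] t(2) by auto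
        then have \<sigma>: "?\<sigma> \<omega> = ennreal t" using le t by simp
        have "?\<rho> \<omega> \<noteq> ennreal t"
          using outside_at_exit[OF \<omega>(1) _ t(2), of l 1] y x ly by auto
        then have "?\<sigma> \<omega> < ?\<rho> \<omega>" using le t \<sigma> by simp
        then have "?\<sigma> \<omega> < ?\<rho> \<omega>" "\<not> ?\<rho> \<omega> < ?\<sigma> \<omega>" "?\<sigma> \<omega> \<noteq> ?\<rho> \<omega>" by auto
        then show ?thesis
          using \<sigma> y right t alive by (simp add: killed_def lifetime_eq_exit_time ext0_def)
      qed
    qed
  qed measurable
  also have "\<dots> = \<alpha> * x + \<beta>" using W_int opt(3) by (simp add: prob_space)
  finally show ?thesis .
qed

lemma (in brownian_setting) payoff_le:
  assumes x: "x \<in> {0..1}" and C: "C \<ge> 0" "\<And>z. z \<in> {0..1} \<Longrightarrow> \<bar>f z\<bar> \<le> C" "\<And>z. z \<in> {0..1} \<Longrightarrow> \<bar>g z\<bar> \<le> C"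
    "\<And>z. z \<in> {0..1} \<Longrightarrow> \<bar>h z\<bar> \<le> C"
  shows "payoff W P f g h x \<sigma> \<rho> \<le> C"
proof -
  interpret prob_space "P x" by (rule prob_P[OF x])
  have space: "space (P x) = space M" by (rule sets_eq_imp_space_eq[OF sets_P[OF x]])
  let ?R = "\<lambda>\<omega>. ext0 f (killed W (\<sigma> \<omega>) \<omega>) * of_bool (\<sigma> \<omega> < \<rho> \<omega>)
        + ext0 g (killed W (\<rho> \<omega>) \<omega>) * of_bool (\<rho> \<omega> < \<sigma> \<omega>)
        + ext0 h (killed W (\<sigma> \<omega>) \<omega>) * of_bool (\<sigma> \<omega> = \<rho> \<omega>)"
  have "?R \<omega> \<le> C" if "\<omega> \<in> space M" for \<omega>
    using ext0_killed_bound[where \<phi>=f, OF that C(1,2), of "\<sigma> \<omega>"]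
      ext0_killed_bound[where \<phi>=g, OF that C(1,3), of "\<rho> \<omega>"]
      ext0_killed_bound[where \<phi>=h, OF that C(1,4), of "\<sigma> \<omega>"] C(1)
    by (cases "\<sigma> \<omega>" "\<rho> \<omega>" rule: linorder_cases) auto
  \<comment> \<open>For arbitrary \<open>\<sigma>\<close> and \<open>\<rho>\<close> the integrand
    may fail to be integrable; the integral is then 0 by convention, which \<open>C \<ge> 0\<close>
    covers.\<close>
  then show ?thesis
    unfolding payoff_def
    by (cases "integrable (P x) ?R") (auto simp: space not_integrable_integral_eq C intro!: integral_le_const)
qed

text \<open>As functions of a start \<open>x\<close> between \<open>l\<close> and both thresholds,
  the payoffs of \<open>r\<close> and of the deviation \<open>y\<close> are affine and share the
  value \<open>g l\<close> at \<open>l\<close>. Comparing them at one such \<open>x\<close>, here a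
  midpoint, therefore compares slopes.\<close>

lemma (in brownian_setting) best_reply_slope:
  assumes lr: "l \<in> {0<..<1}" "r \<in> {l<..<1}" and y: "y \<in> {l<..<1}" and adm: "admissible_rewards f g h"
    and best: "\<And>x. x \<in> {0<..<1} \<Longrightarrow> payoff W P f g h x (hit W {r..1}) (hit W {0..l}) =
      (SUP \<sigma>\<in>Collect (stopping_time F). payoff W P f g h x \<sigma> (hit W {0..l}))"
  shows "(f y - g l) / (y - l) \<le> (f r - g l) / (r - l)"
proof -
  obtain C where C: "C \<ge> 0" "\<And>z. z \<in> {0..1} \<Longrightarrow> \<bar>f z\<bar> \<le> C" "\<And>z. z \<in> {0..1} \<Longrightarrow> \<bar>g z\<bar> \<le> C"
    "\<And>z. z \<in> {0..1} \<Longrightarrow> \<bar>h z\<bar> \<le> C"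
    using admissible_rewards_bound[OF adm] by metis
  define x where "x = (l + min y r) / 2"
  have x: "l < x" "x < y" "x < r" "x \<in> {0<..<1}" using lr y by (auto simp: x_def min_def)
  have affine: "payoff W P f g h x (hit W {z..1}) (hit W {0..l}) = g l + (f z - g l) / (z - l) * (x - l)"
    if "x < z" "z < 1" for z
  proof -
    define s where "s = (f z - g l) / (z - l)"
    have "s * (z - l) = f z - g l" using that x by (simp add: s_def)
    then have "f z = s * z + (g l - s * l)" by (simp add: algebra_simps)
    then have "payoff W P f g h x (hit W {z..1}) (hit W {0..l}) = s * x + (g l - s * l)"
      using that x lr by (intro payoff_upper_lower[OF _ _ _ adm]) auto
    then show ?thesis by (simp add: s_def[symmetric] algebra_simps)
  qed
  have "payoff W P f g h x (hit W {y..1}) (hit W {0..l}) \<le>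
      (SUP \<sigma>\<in>Collect (stopping_time F). payoff W P f g h x \<sigma> (hit W {0..l}))"
  proof (rule cSUP_upper)
    show "hit W {y..1} \<in> Collect (stopping_time F)" using stopping_time_hit_upper[of y] y lr by auto
    have "x \<in> {0..1}" using x by auto
    then show "bdd_above ((\<lambda>\<sigma>. payoff W P f g h x \<sigma> (hit W {0..l})) ` Collect (stopping_time F))"
      by (intro bdd_aboveI2[where M=C] payoff_le) (use C in auto)
  qed
  then have "payoff W P f g h x (hit W {y..1}) (hit W {0..l}) \<le> payoff W P f g h x (hit W {r..1}) (hit W {0..l})"
    using best[OF x(4)] by simp
  then have "(f y - g l) / (y - l) * (x - l) \<le> (f r - g l) / (r - l) * (x - l)"
    using affine[of y] affine[of r] x y lr by simp
  then show ?thesis by (rule mult_right_le_imp_le) (use x in simp)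
qed

section \<open>Best responses and chords\<close>

lemma strictly_convex_onD:
  assumes "strictly_convex_on S f" "x \<in> S" "y \<in> S" "x < z" "z < y"
    "f x \<le> \<alpha> * x + \<beta>" "f y \<le> \<alpha> * y + \<beta>"
  shows "f z < \<alpha> * z + \<beta>"
proof -
  define t where "t = (z - x) / (y - x)"
  have t01: "0 < t" "t < 1" using assms(4,5) by (auto simp: t_def)
  have "t * (y - x) = z - x" using assms(4,5) by (simp add: t_def)
  then have t: "0 < t" "t < 1" "z = (1 - t) * x + t * y"
    using t01 by (auto simp: algebra_simps)
  have "f z < (1 - t) * f x + t * f y"
    unfolding t(3) using assms(1-5) t(1,2) by (auto simp: strictly_convex_on_def)
  also have "\<dots> \<le> (1 - t) * (\<alpha> * x + \<beta>) + t * (\<alpha> * y + \<beta>)"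
    using assms(6,7) t by (intro add_mono mult_left_mono) auto
  also have "\<dots> = \<alpha> * z + \<beta>" unfolding t(3) by (simp add: algebra_simps)
  finally show ?thesis .
qed

lemma strictly_convex_on_imp_convex_on:
  assumes "strictly_convex_on S f" shows "convex_on S f"
proof (rule convex_onI)
  show "convex S" using assms by (simp add: strictly_convex_on_def)
next
  fix t x y :: real assume "0 < t" "t < 1" "x \<in> S" "y \<in> S"
  then show "f ((1 - t) *\<^sub>R x + t *\<^sub>R y) \<le> (1 - t) * f x + t * f y"
  proof (cases "x = y")
    case False
    then show ?thesis
      using assms \<open>0 < t\<close> \<open>t < 1\<close> \<open>x \<in> S\<close> \<open>y \<in> S\<close>
      by (auto simp: strictly_convex_on_def intro!: less_imp_le)
  qed (simp add: algebra_simps)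
qed

lemma strictly_concave_on_below_tangent:
  assumes conc: "strictly_concave_on {b..1} f" and y: "y \<in> {b<..<1}" and z: "z \<in> {b..1}"
    and f': "(f has_real_derivative D) (at y)"
  shows "f z \<le> f y + D * (z - y)"
proof -
  have "convex_on {b..1} (\<lambda>x. - f x)"
    using conc unfolding strictly_concave_on_def by (rule strictly_convex_on_imp_convex_on)
  moreover have "((\<lambda>x. - f x) has_real_derivative - D) (at y within {b..1})"
    using DERIV_minus[OF f'] by (rule has_field_derivative_at_within)
  ultimately have "- f z - (- f y) \<ge> (- D) * (z - y)"
    using y z by (intro convex_on_imp_above_tangent[where A="{b..1}"]) auto
  then show ?thesis by simp
qed

section \<open>Maximisers of the chord slope\<close>

definition chord_slope :: "(real \<Rightarrow> real) \<Rightarrow> (real \<Rightarrow> real) \<Rightarrow> real \<Rightarrow> real \<Rightarrow> real" where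
  "chord_slope f g x y = (f y - g x) / (y - x)"

text \<open>A relation, because a maximiser below 1 need not exist without condition (4). The
  competitors include 1, the maximiser does not: at 1 the process is dead, so a maximum there is no
  stopping threshold.\<close>

definition best_response ::
  "(real \<Rightarrow> real) \<Rightarrow> (real \<Rightarrow> real) \<Rightarrow> real \<Rightarrow> real \<Rightarrow> real \<Rightarrow> bool" where
  "best_response f g b x r \<longleftrightarrow>
     r \<in> {b..<1} \<and> (\<forall>y\<in>{b..1}. chord_slope f g x y \<le> chord_slope f g x r)"

lemma chord_slope_eq: "x < y \<Longrightarrow> f y = g x + chord_slope f g x y * (y - x)"
  by (simp add: chord_slope_def)

lemma chord_slope_le_iff: "x < y \<Longrightarrow> chord_slope f g x y \<le> s \<longleftrightarrow> f y \<le> g x + s * (y - x)"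
  by (simp add: chord_slope_def pos_divide_le_eq algebra_simps)

lemma best_response_le:
  assumes "best_response f g b x r" "x < b" "y \<in> {b..1}"
  shows "f y \<le> g x + chord_slope f g x r * (y - x)"
proof -
  have "chord_slope f g x y \<le> chord_slope f g x r" using assms by (simp add: best_response_def)
  moreover have "x < y" using assms by simp
  ultimately show ?thesis by (simp add: chord_slope_le_iff)
qed

text \<open>\<open>profit\<close> says that the graph of \<open>f\<close> has a point above the
  chord from \<open>(x, g x)\<close> to \<open>(1, 0)\<close>. The slope at 1 is therefore beaten,
  and the maximiser on the compact interval differs from 1.\<close>

lemma best_response_exists:
  assumes f: "continuous_on {b..1} f" "f 1 = 0" and x: "x < b" "b < 1"
    and profit: "\<exists>y\<in>{b..1}. f y > g x * ((1 - y) / (1 - x))"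
  shows "\<exists>r. best_response f g b x r"
proof -
  have "continuous_on {b..1} (chord_slope f g x)"
    unfolding chord_slope_def using x by (intro continuous_intros f) auto
  moreover have "compact {b..1}" "{b..1} \<noteq> {}" using x by auto
  ultimately obtain r where r: "r \<in> {b..1}" "\<And>y. y \<in> {b..1} \<Longrightarrow> chord_slope f g x y \<le> chord_slope f g x r"
    using continuous_attains_sup[of "{b..1}" "chord_slope f g x"] by blast
  obtain y where y: "y \<in> {b..1}" "f y > g x * ((1 - y) / (1 - x))" using profit by blast
  have "chord_slope f g x 1 < chord_slope f g x y"
  proof (rule ccontr)
    assume "\<not> ?thesis"
    then have "chord_slope f g x y \<le> chord_slope f g x 1" by simp
    moreover have "x < y" using x y by simp
    ultimately have "f y \<le> g x + chord_slope f g x 1 * (y - x)" by (simp add: chord_slope_le_iff)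
    also have "\<dots> = g x * ((1 - y) / (1 - x))"
      using x f(2) by (simp add: chord_slope_def field_simps)
    finally show False using y by simp
  qed
  then have "r \<noteq> 1" using r(2)[OF y(1)] by auto
  then show ?thesis using r by (auto simp: best_response_def intro!: exI[of _ r])
qed

text \<open>If \<open>f\<close> met the maximal line at a second point, strict concavity would lift
  it above the line at the midpoint of the two.\<close>

lemma best_response_strict:
  assumes conc: "strictly_concave_on {b..1} f" and br: "best_response f g b x r" and x: "x < b"
    and y: "y \<in> {b..1}" "y \<noteq> r"
  shows "f y < g x + chord_slope f g x r * (y - x)"
proof (rule ccontr)
  let ?s = "chord_slope f g x r"
  assume "\<not> ?thesis"
  then have fy: "f y = g x + ?s * (y - x)" using best_response_le[OF br x y(1)] by simp
  have r: "r \<in> {b..1}" using br by (auto simp: best_response_def)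
  then have fr: "f r = g x + ?s * (r - x)" using x by (intro chord_slope_eq) auto
  have conv: "strictly_convex_on {b..1} (\<lambda>x. - f x)" using conc by (simp add: strictly_concave_on_def)
  have eqs: "- f y \<le> (- ?s) * y + (?s * x - g x)" "- f r \<le> (- ?s) * r + (?s * x - g x)"
    unfolding fy fr by (simp_all add: algebra_simps)
  define m where "m = (y + r) / 2"
  have "- f m < (- ?s) * m + (?s * x - g x)"
  proof (cases "y < r")
    case True
    then show ?thesis by (intro strictly_convex_onD[OF conv y(1) r _ _ eqs]) (auto simp: m_def)
  next
    case False
    then show ?thesis using y(2) by (intro strictly_convex_onD[OF conv r y(1) _ _ eqs(2,1)]) (auto simp: m_def)
  qed
  moreover have "f m \<le> g x + ?s * (m - x)"
    by (rule best_response_le[OF br x]) (use y r in \<open>auto simp: m_def\<close>)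
  ultimately show False by (simp add: algebra_simps)
qed

lemma best_response_unique:
  assumes "strictly_concave_on {b..1} f" "best_response f g b x r" "best_response f g b x r'" "x < b"
  shows "r' = r"
proof (rule ccontr)
  assume neq: "r' \<noteq> r"
  have r: "r \<in> {b..1}" "r' \<in> {b..1}" using assms by (auto simp: best_response_def)
  have "chord_slope f g x r' = chord_slope f g x r"
    using assms(2,3) r by (intro antisym) (auto simp: best_response_def)
  then show False
    using best_response_strict[OF assms(1,2,4) r(2) neq] chord_slope_eq[of x r' f g] r assms(4) by simp
qed

text \<open>The sign of \<open>f y - g x - f' y (y - x)\<close> is that of the height, over \<open>(x, g x)\<close>, of the tangent
  to \<open>f\<close> at \<open>y\<close>; it tells on which side of \<open>y\<close> the best response lies.\<close>

lemma best_response_le_of_tangent_above: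
  assumes conc: "strictly_concave_on {b..1} f" and br: "best_response f g b x r" and x: "x < b"
    and y: "y \<in> {b<..<1}" and D: "(f has_real_derivative D) (at y)"
    and above: "f y - g x - D * (y - x) > 0"
  shows "r \<le> y"
proof (rule ccontr)
  let ?s = "chord_slope f g x r"
  assume "\<not> r \<le> y"
  then have yr: "y < r" by simp
  have r: "r \<in> {b..1}" using br by (auto simp: best_response_def)
  have fr: "f r = g x + ?s * (r - x)" using r x by (intro chord_slope_eq) auto
  have fy: "f y \<le> g x + ?s * (y - x)" using best_response_le[OF br x, of y] y by auto
  \<comment> \<open>At \<open>r\<close> the tangent is at least as high as the maximal line, while
    at \<open>y\<close> it is at most as high; hence it is at least as steep, and it lies below
    \<open>g x\<close> at \<open>x\<close>, against \<open>above\<close>.\<close>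
  have "f r \<le> f y + D * (r - y)" by (rule strictly_concave_on_below_tangent[OF conc y r D])
  then have "?s * (r - y) \<le> D * (r - y)" using fr fy by (simp add: algebra_simps)
  then have "?s \<le> D" using yr by simp
  then have "?s * (y - x) \<le> D * (y - x)" using x y by (intro mult_right_mono) auto
  then show False using fy above by simp
qed

lemma best_response_ge_of_tangent_below:
  assumes conc: "strictly_concave_on {b..1} f" and br: "best_response f g b x r" and x: "x < b"
    and y: "y \<in> {b<..<1}" and D: "(f has_real_derivative D) (at y)"
    and below: "f y - g x - D * (y - x) < 0"
  shows "y \<le> r"
proof (rule ccontr)
  let ?s = "chord_slope f g x r"
  assume "\<not> y \<le> r"
  then have ry: "r < y" by simp
  have r: "r \<in> {b..1}" using br by (auto simp: best_response_def)
  have fr: "f r = g x + ?s * (r - x)" using r x by (intro chord_slope_eq) auto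
  have fy: "f y \<le> g x + ?s * (y - x)" using best_response_le[OF br x, of y] y by auto
  have tan: "f r \<le> f y + D * (r - y)" by (rule strictly_concave_on_below_tangent[OF conc y r D])
  then have "D * (y - r) \<le> ?s * (y - r)" using fr fy by (simp add: algebra_simps)
  then have "D \<le> ?s" using ry by simp
  moreover have "?s * (r - x) < D * (r - x)" using tan fr below by (simp add: algebra_simps)
  ultimately show False using r x by simp
qed

lemma best_response_first_order:
  assumes br: "best_response f g b l r" and lr: "l < b" "r \<in> {b<..<1}"
    and D: "(f has_real_derivative D) (at r)"
  shows "f r - g l = D * (r - l)"
proof -
  have neq: "r - l \<noteq> 0" using lr by auto
  have "(chord_slope f g l has_real_derivative (D * (r - l) - (f r - g l) * 1) / (r - l)\<^sup>2) (at r)"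
    unfolding chord_slope_def
    by (rule derivative_eq_intros D refl neq | simp add: power2_eq_square)+
  moreover have "0 < min (r - b) (1 - r)" using lr by auto
  moreover have "\<forall>y. \<bar>r - y\<bar> < min (r - b) (1 - r) \<longrightarrow> chord_slope f g l y \<le> chord_slope f g l r"
  proof (intro allI impI)
    fix y assume "\<bar>r - y\<bar> < min (r - b) (1 - r)"
    then have "y \<in> {b..1}" by (simp add: abs_less_iff)
    then show "chord_slope f g l y \<le> chord_slope f g l r" using br by (simp add: best_response_def)
  qed
  ultimately have "(D * (r - l) - (f r - g l) * 1) / (r - l)\<^sup>2 = 0" by (rule DERIV_local_max)
  then show ?thesis using neq by simp
qed

text \<open>At \<open>(l,r)\<close> the function \<open>\<Gamma>\<close> vanishes and has the
  partial derivatives \<open>f' r - g'\<close> in \<open>x\<close> and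
  \<open>- f'' * (r - l)\<close> in \<open>y\<close>. The condition on \<open>K\<close> makes the
  second one prevail along the rays of direction \<open>(1, K)\<close> and \<open>(-1, K)\<close>
  and their opposites, so \<open>\<Gamma>\<close> is positive at \<open>r + K * t\<close> and
  negative at \<open>r - K * t\<close>. The best response is caught in between.\<close>

lemma best_response_local_estimate:
  assumes conc: "strictly_concave_on {b..1} f" and br: "best_response f g b l r"
    and lr: "l < b" "r \<in> {b<..<1}"
    and f': "\<And>y. y \<in> {b<..<1} \<Longrightarrow> (f has_real_derivative f' y) (at y)"
    and f'': "(f' has_real_derivative f'') (at r)" and g': "(g has_real_derivative g') (at l)"
    and K: "K > 0" "\<bar>f' r - g'\<bar> < K * (- f'') * (r - l)"
  shows "\<forall>\<^sub>F x in nhds l. \<forall>\<rho>. best_response f g b x \<rho> \<longrightarrow> \<bar>\<rho> - r\<bar> \<le> K * \<bar>x - l\<bar>"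
proof -
  define \<Gamma> where "\<Gamma> x y = f y - g x - f' y * (y - x)" for x y
  have zero: "\<Gamma> l r = 0"
    using best_response_first_order[OF br lr f'[OF lr(2)]] by (simp add: \<Gamma>_def)
  have deriv: "((\<lambda>t. \<Gamma> (l + \<sigma> * t) (r + \<kappa> * t)) has_real_derivative \<sigma> * (f' r - g') - \<kappa> * f'' * (r - l)) (at 0)" for \<sigma> \<kappa>
  proof -
    have y: "((\<lambda>t. r + \<kappa> * t) has_real_derivative \<kappa>) (at 0)" and x: "((\<lambda>t. l + \<sigma> * t) has_real_derivative \<sigma>) (at 0)"
      by (auto intro!: derivative_eq_intros)
    have "((\<lambda>t. f (r + \<kappa> * t)) has_real_derivative f' r * \<kappa>) (at 0)"
      using DERIV_chain2[OF _ y, of f "f' r"] f'[OF lr(2)] by simp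
    moreover have "((\<lambda>t. f' (r + \<kappa> * t)) has_real_derivative f'' * \<kappa>) (at 0)"
      using DERIV_chain2[OF _ y, of f' "f''"] f'' by simp
    moreover have "((\<lambda>t. g (l + \<sigma> * t)) has_real_derivative g' * \<sigma>) (at 0)"
      using DERIV_chain2[OF _ x, of g g'] g' by simp
    ultimately show ?thesis
      unfolding \<Gamma>_def by (auto intro!: derivative_eq_intros simp: algebra_simps)
  qed
  have pos: "\<exists>e>0. \<forall>t>0. t < e \<longrightarrow> \<Gamma> (l + \<sigma> * t) (r + K * t) > 0" if "\<bar>\<sigma>\<bar> = 1" for \<sigma>
  proof -
    have "\<bar>\<sigma> * (f' r - g')\<bar> = \<bar>f' r - g'\<bar>" using that by (simp add: abs_mult)
    then have "\<bar>\<sigma> * (f' r - g')\<bar> < - (K * f'' * (r - l))" using K(2) by simp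
    then have "0 < \<sigma> * (f' r - g') - K * f'' * (r - l)" by linarith
    from DERIV_pos_inc_right[OF deriv this] show ?thesis using zero by auto
  qed
  have neg: "\<exists>e>0. \<forall>t>0. t < e \<longrightarrow> \<Gamma> (l + \<sigma> * t) (r + (- K) * t) < 0" if "\<bar>\<sigma>\<bar> = 1" for \<sigma>
  proof -
    have "\<bar>\<sigma> * (f' r - g')\<bar> = \<bar>f' r - g'\<bar>" using that by (simp add: abs_mult)
    then have "\<bar>\<sigma> * (f' r - g')\<bar> < - (K * f'' * (r - l))" using K(2) by simp
    then have "\<sigma> * (f' r - g') + K * f'' * (r - l) < 0" by linarith
    then have "\<sigma> * (f' r - g') - (- K) * f'' * (r - l) < 0" by simp
    from DERIV_neg_dec_right[OF deriv this] show ?thesis using zero by auto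
  qed
  obtain e1 e2 e3 e4 where e: "e1 > 0" "e2 > 0" "e3 > 0" "e4 > 0"
    "\<And>t. 0 < t \<Longrightarrow> t < e1 \<Longrightarrow> \<Gamma> (l + t) (r + K * t) > 0"
    "\<And>t. 0 < t \<Longrightarrow> t < e2 \<Longrightarrow> \<Gamma> (l - t) (r + K * t) > 0"
    "\<And>t. 0 < t \<Longrightarrow> t < e3 \<Longrightarrow> \<Gamma> (l + t) (r - K * t) < 0"
    "\<And>t. 0 < t \<Longrightarrow> t < e4 \<Longrightarrow> \<Gamma> (l - t) (r - K * t) < 0"
    using pos[of 1] pos[of "-1"] neg[of 1] neg[of "-1"] by auto
  \<comment> \<open>The two quotients keep \<open>r + K * t\<close> and \<open>r - K * t\<close>
    inside \<open>(b,1)\<close>; \<open>b - l\<close> keeps \<open>x\<close> below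
    \<open>b\<close>.\<close>
  define e where "e = Min {e1, e2, e3, e4, (r - b) / K, (1 - r) / K, b - l}"
  have "e > 0" using e lr K by (auto simp: e_def)
  have e_le: "e \<le> v" if "v \<in> {e1, e2, e3, e4, (r - b) / K, (1 - r) / K, b - l}" for v
    unfolding e_def by (rule Min_le) (use that in auto)
  have "\<bar>\<rho> - r\<bar> \<le> K * \<bar>x - l\<bar>" if x: "dist x l < e" and \<rho>: "best_response f g b x \<rho>" for x \<rho>
  proof (cases "x = l")
    \<comment> \<open>The signs along the rays say nothing at \<open>t = 0\<close>; uniqueness of
      the maximiser settles this case.\<close>
    case True
    then show ?thesis using best_response_unique[OF conc br \<rho>[unfolded True] lr(1)] by simp
  next
    case False
    define t where "t = \<bar>x - l\<bar>"
    have "0 < t" "t < e" using x False by (simp_all add: t_def dist_real_def)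
    then have t: "0 < t" "t < e1" "t < e2" "t < e3" "t < e4" "t < (r - b) / K" "t < (1 - r) / K" "t < b - l"
      using e_le by (blast intro: less_le_trans)+
    then have Kt: "K * t < r - b" "K * t < 1 - r" "0 < K * t"
      using K(1) by (auto simp: pos_less_divide_eq mult.commute)
    have xb: "x < b" using t(8) by (simp add: t_def)
    have x_cases: "x = l + t \<or> x = l - t" unfolding t_def by linarith
    then have up: "\<Gamma> x (r + K * t) > 0" and down: "\<Gamma> x (r - K * t) < 0"
      using e(5-8)[OF t(1)] t(2-5) by blast+
    have y: "r + K * t \<in> {b<..<1}" "r - K * t \<in> {b<..<1}" using Kt lr by auto
    have "\<rho> \<le> r + K * t"
      by (rule best_response_le_of_tangent_above[OF conc \<rho> xb y(1) f'[OF y(1)]]) (use up in \<open>simp add: \<Gamma>_def\<close>)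
    moreover have "r - K * t \<le> \<rho>"
      by (rule best_response_ge_of_tangent_below[OF conc \<rho> xb y(2) f'[OF y(2)]]) (use down in \<open>simp add: \<Gamma>_def\<close>)
    ultimately show ?thesis unfolding t_def by (simp add: abs_le_iff)
  qed
  then show ?thesis unfolding eventually_nhds_metric using \<open>e > 0\<close> by blast
qed

section \<open>Painleve-Kuratowski limits of intervals\<close>

lemma PK_limits_interval:
  fixes u v :: "nat \<Rightarrow> real"
  assumes u: "u \<longlonglongrightarrow> p" and v: "v \<longlonglongrightarrow> q" and pq: "p < q"
  shows "PK_liminf (\<lambda>n. {u n..v n}) = {p..q}" "PK_limsup (\<lambda>n. {u n..v n}) = {p..q}"
proof -
  have lower: "{p..q} \<subseteq> PK_liminf (\<lambda>n. {u n..v n})"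
  proof
    fix x assume x: "x \<in> {p..q}"
    \<comment> \<open>This is the projection of \<open>x\<close> to \<open>{u n..v n}\<close>. It
      belongs to that interval as soon as the interval is nonempty, which \<open>p < q\<close>
      ensures eventually.\<close>
    have lim: "(\<lambda>n. max (u n) (min (v n) x)) \<longlonglongrightarrow> max p (min q x)"
      by (intro tendsto_intros u v)
    have "max p (min q x) = x" using x by auto
    then have lim: "(\<lambda>n. max (u n) (min (v n) x)) \<longlonglongrightarrow> x" using lim by simp
    obtain m where "p < m" "m < q" using dense[OF pq] by blast
    then have le: "\<forall>\<^sub>F n in sequentially. u n < v n"
      using order_tendstoD(2)[OF u, of m] order_tendstoD(1)[OF v, of m] by (auto elim: eventually_elim2)
    show "x \<in> PK_liminf (\<lambda>n. {u n..v n})"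
      unfolding PK_liminf_def
    proof (intro CollectI allI impI)
      fix U :: "real set" assume "open U" "x \<in> U"
      then have "\<forall>\<^sub>F n in sequentially. max (u n) (min (v n) x) \<in> U"
        using lim by (intro topological_tendstoD)
      with le show "\<forall>\<^sub>F n in sequentially. {u n..v n} \<inter> U \<noteq> {}"
      proof eventually_elim
        case (elim n)
        then have "max (u n) (min (v n) x) \<in> {u n..v n}" by auto
        then show ?case using elim(2) by blast
      qed
    qed
  qed
  have mid: "PK_liminf (\<lambda>n. {u n..v n}) \<subseteq> PK_limsup (\<lambda>n. {u n..v n})"
    unfolding PK_liminf_def PK_limsup_def
    using eventually_frequently[OF sequentially_bot] by blast
  have upper: "PK_limsup (\<lambda>n. {u n..v n}) \<subseteq> {p..q}"
  proof
    fix x assume x: "x \<in> PK_limsup (\<lambda>n. {u n..v n})"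
    show "x \<in> {p..q}"
    proof (rule ccontr)
      assume "x \<notin> {p..q}"
      then consider "x < p" | "q < x" by (metis atLeastAtMost_iff not_le)
      then show False
      proof cases
        case 1
        then obtain m where m: "x < m" "m < p" using dense by blast
        have "\<exists>\<^sub>F n in sequentially. {u n..v n} \<inter> {..<m} \<noteq> {}"
          using x m by (auto simp: PK_limsup_def)
        moreover have "\<forall>\<^sub>F n in sequentially. \<not> {u n..v n} \<inter> {..<m} \<noteq> {}"
          using order_tendstoD(1)[OF u m(2)] by eventually_elim auto
        ultimately show False by (simp add: frequently_def)
      next
        case 2
        then obtain m where m: "q < m" "m < x" using dense by blast
        have "\<exists>\<^sub>F n in sequentially. {u n..v n} \<inter> {m<..} \<noteq> {}"
          using x m by (auto simp: PK_limsup_def)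
        moreover have "\<forall>\<^sub>F n in sequentially. \<not> {u n..v n} \<inter> {m<..} \<noteq> {}"
          using order_tendstoD(2)[OF v m(1)] by eventually_elim auto
        ultimately show False by (simp add: frequently_def)
      qed
    qed
  qed
  show "PK_liminf (\<lambda>n. {u n..v n}) = {p..q}" "PK_limsup (\<lambda>n. {u n..v n}) = {p..q}"
    using lower mid upper by auto
qed

section \<open>Response sets of player 2\<close>

text \<open>To the left of \<open>r\<close>, waiting until the exit from \<open>(x,r)\<close> earns
  the chord, which is strictly above \<open>f\<close>. From \<open>r\<close> on, an affine function
  through \<open>(y, f y)\<close> dominates all rewards, so stopping at once is optimal.\<close>

lemma (in brownian_setting) response_set_eq:
  assumes x: "x \<in> {0<..<b}" and b: "b < 1" and adm: "admissible_rewards f g h"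
    and conv: "strictly_convex_on {0..b} f" and conc: "strictly_concave_on {b..1} f"
    and f': "\<And>y. y \<in> {b<..<1} \<Longrightarrow> (f has_real_derivative f' y) (at y)"
    and br: "best_response f g b x r"
  shows "response_set F W P f g {0..x} = {r..1}"
proof -
  let ?V = "value_against F W P f g {0..x}"
  define s where "s = chord_slope f g x r"
  have x01: "0 \<le> x" "x \<in> {0<..<1}" "(1::real) \<le> 1" using x b by auto
  have hit: "\<forall>\<omega>\<in>space M. hit W {0..x} \<omega> = exit_time W x 1 \<omega>"
    using hit_lower_eq_exit_time[OF _ x01(2)] by blast
  have r: "b \<le> r" "r < 1" using br by (auto simp: best_response_def)
  have fg1: "f 1 = 0" "g 1 = 0" using adm by (simp_all add: admissible_rewards_def)
  have "f x \<le> h x" "h x \<le> g x" using adm x01 by (simp_all add: admissible_rewards_def)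
  then have f_le_g: "f x \<le> g x" by simp
  have fr: "f r = s * r + (g x - s * x)"
    using chord_slope_eq[of x r f g] x r by (simp add: s_def algebra_simps)
  have f_le: "f y \<le> s * y + (g x - s * x)" if "y \<in> {b..1}" for y
    using best_response_le[OF br _ that] x by (simp add: s_def algebra_simps)
  have below: "f y < \<alpha> * y + \<beta>" if "y \<in> {x<..<b}" "g x \<le> \<alpha> * x + \<beta>" "f b \<le> \<alpha> * b + \<beta>" for y \<alpha> \<beta>
    using that x f_le_g by (intro strictly_convex_onD[OF conv, of x b]) auto
  have before: "f y < ?V y" if y: "y \<in> {x<..<r}" for y
  proof -
    have "f y < s * y + (g x - s * x)"
    proof (cases "y < b")
      case True
      then show ?thesis using y r b by (intro below f_le) auto
    next
      case False
      then show ?thesis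
        using best_response_strict[OF conc br, of y] x y r by (simp add: s_def algebra_simps)
    qed
    also have "s * y + (g x - s * x) \<le> ?V y"
      by (rule value_against_ge_exit[OF hit x01(1) order_refl _ x01(3) y adm]) (use r fr x in auto)
    finally show ?thesis .
  qed
  have after: "?V y = f y" if y: "r \<le> y" "y < 1" for y
  proof (rule antisym)
    have y': "y \<in> {x<..<1}" using y r x by auto
    show "f y \<le> ?V y" by (rule value_against_ge_now[OF hit x01(1,3) y' adm])
    \<comment> \<open>At \<open>y = r\<close>, which may be the point \<open>b\<close> where the
      slope of \<open>f\<close> is not controlled, the maximal chord serves. Further right it is the
      tangent at \<open>y\<close>: it is no steeper than the chord and not below it at
      \<open>r\<close>, hence not below \<open>g x\<close> at \<open>x\<close>.\<close>
    have "\<exists>\<alpha> \<beta>. f y = \<alpha> * y + \<beta> \<and> g x \<le> \<alpha> * x + \<beta> \<and> (\<forall>z\<in>{b..1}. f z \<le> \<alpha> * z + \<beta>)"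
    proof (cases "y = r")
      case True
      then show ?thesis using f_le fr by (intro exI[of _ s] exI[of _ "g x - s * x"]) auto
    next
      case False
      then have y'': "y \<in> {b<..<1}" and ry: "r < y" using y r by auto
      define D where "D = f' y"
      have tangent: "f z \<le> D * z + (f y - D * y)" if "z \<in> {b..1}" for z
        using strictly_concave_on_below_tangent[OF conc y'' that f'[OF y'']]
        by (simp add: D_def algebra_simps)
      have rb: "r \<in> {b..1}" "y \<in> {b..1}" using r y'' by auto
      have "D * (y - r) \<le> f y - f r" using tangent[OF rb(1)] by (simp add: algebra_simps)
      also have "\<dots> \<le> s * (y - r)" using f_le[OF rb(2)] fr by (simp add: algebra_simps)
      finally have "D \<le> s" using ry by simp
      then have "D * (r - x) \<le> s * (r - x)" using r x by (intro mult_right_mono) auto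
      then have "g x \<le> D * x + (f y - D * y)"
        using tangent[OF rb(1)] fr by (simp add: algebra_simps)
      then show ?thesis using tangent by (intro exI[of _ D] exI[of _ "f y - D * y"]) auto
    qed
    then obtain \<alpha> \<beta> where line: "f y = \<alpha> * y + \<beta>" "g x \<le> \<alpha> * x + \<beta>" "\<And>z. z \<in> {b..1} \<Longrightarrow> f z \<le> \<alpha> * z + \<beta>"
      by blast
    have "?V y \<le> \<alpha> * y + \<beta>"
    proof (rule value_against_le[OF hit x01(1,3) y' adm])
      show "f z \<le> \<alpha> * z + \<beta>" if "z \<in> {x<..<1}" for z
        using below[of z \<alpha> \<beta>] line(2) line(3)[of b] line(3)[of z] that b by (cases "z < b") auto
      show "g 1 \<le> \<alpha> * 1 + \<beta>" using line(3)[of 1] fg1 b by simp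
    qed (rule line(2))
    then show "?V y \<le> f y" using line(1) by simp
  qed
  have end_point: "?V 1 = f 1" using value_against_boundary[of 1] fg1 by simp
  show ?thesis
  proof (intro equalityI subsetI)
    fix y assume "y \<in> response_set F W P f g {0..x}"
    then have "y \<in> {x<..1}" "?V y = f y" using x01 by (auto simp: response_set_def)
    then show "y \<in> {r..1}" using before[of y] by (cases "y < r") auto
  next
    fix y assume "y \<in> {r..1}"
    then show "y \<in> response_set F W P f g {0..x}"
      using after[of y] end_point r x by (cases "y = 1") (auto simp: response_set_def)
  qed
qed

lemma (in brownian_setting) response_set_local:
  assumes lr: "l \<in> {0<..<b}" "r \<in> {b<..<1}" and adm: "admissible_rewards f g h"
    and conv: "strictly_convex_on {0..b} f" and conc: "strictly_concave_on {b..1} f"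
    and f': "\<And>y. y \<in> {0<..<1} \<Longrightarrow> (f has_real_derivative f' y) (at y)"
    and f'': "(f' has_real_derivative f'') (at r)" and g': "(g has_real_derivative g') (at l)"
    and br: "best_response f g b l r"
    and profit: "\<forall>\<^sub>F x in nhds l. \<exists>y\<in>{b..1}. f y > g x * ((1 - y) / (1 - x))"
    and K: "K > 0" "\<bar>f' r - g'\<bar> < K * (- f'') * (r - l)"
  shows "\<forall>\<^sub>F x in nhds l. \<exists>\<rho>. response_set F W P f g {0..x} = {\<rho>..1} \<and> \<bar>\<rho> - r\<bar> \<le> K * \<bar>x - l\<bar>"
proof -
  have b: "0 < b" "b < 1" using lr by auto
  have f'b: "(f has_real_derivative f' y) (at y)" if "y \<in> {b<..<1}" for y
    by (rule f') (use that b in auto)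
  have cont: "continuous_on {b..1} f" "f 1 = 0"
    using adm b by (auto simp: admissible_rewards_def intro: continuous_on_subset)
  have "\<forall>\<^sub>F x in nhds l. x \<in> {0<..<b}" using lr by (intro eventually_nhds_in_open) auto
  moreover have "\<forall>\<^sub>F x in nhds l. \<forall>\<rho>. best_response f g b x \<rho> \<longrightarrow> \<bar>\<rho> - r\<bar> \<le> K * \<bar>x - l\<bar>"
    by (rule best_response_local_estimate[OF conc br _ lr(2) f'b f'' g' K]) (use lr in auto)
  ultimately show ?thesis using profit
  proof eventually_elim
    case (elim x)
    then obtain \<rho> where \<rho>: "best_response f g b x \<rho>"
      using best_response_exists[OF cont _ b(2), of x g] by auto
    then show ?case
      using response_set_eq[OF elim(1) b(2) adm conv conc f'b] elim(2) by blast
  qed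
qed

text \<open>Deviations reach the thresholds \<open>y < 1\<close> only; the slope at 1 is compared as
  a limit from the left.\<close>

lemma (in brownian_setting) best_response_of_equilibrium:
  assumes lr: "l \<in> {0<..<b}" "r \<in> {b<..<1}" and adm: "admissible_rewards f g h"
    and best: "\<And>x. x \<in> {0<..<1} \<Longrightarrow> payoff W P f g h x (hit W {r..1}) (hit W {0..l}) =
      (SUP \<sigma>\<in>Collect (stopping_time F). payoff W P f g h x \<sigma> (hit W {0..l}))"
  shows "best_response f g b l r"
proof -
  have le: "chord_slope f g l y \<le> chord_slope f g l r" if "y \<in> {b..<1}" for y
    unfolding chord_slope_def by (rule best_reply_slope[OF _ _ _ adm best]) (use lr that in auto)
  have "continuous_on {b..1} f"
    using adm lr by (auto simp: admissible_rewards_def intro: continuous_on_subset)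
  then have "continuous_on {b..1} (chord_slope f g l)"
    unfolding chord_slope_def using lr by (intro continuous_intros) auto
  then have "(chord_slope f g l \<longlongrightarrow> chord_slope f g l 1) (at 1 within {b..1})"
    using lr by (auto simp: continuous_on_def)
  then have "(chord_slope f g l \<longlongrightarrow> chord_slope f g l 1) (at 1 within {b..<1})"
    by (rule tendsto_within_subset) auto
  moreover have "\<forall>\<^sub>F y in at 1 within {b..<1}. chord_slope f g l y \<le> chord_slope f g l r"
    unfolding eventually_at_filter by (rule always_eventually) (use le in blast)
  moreover have "at 1 within {b..<1} \<noteq> bot" using lr by (simp add: at_within_eq_bot_iff)
  ultimately have "chord_slope f g l 1 \<le> chord_slope f g l r" by (rule tendsto_upperbound)
  then have "chord_slope f g l y \<le> chord_slope f g l r" if "y \<in> {b..1}" for y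
    using that le[of y] by (cases "y = 1") auto
  then show ?thesis using lr by (auto simp: best_response_def)
qed

section \<open>Partial derivatives of the utilities\<close>

lemma C2_on_unit_interval:
  assumes "C2_on {0..1} \<phi>"
  obtains \<phi>' \<phi>'' where "\<And>x. x \<in> {0<..<1} \<Longrightarrow> (\<phi> has_real_derivative \<phi>' x) (at x)"
    "\<And>x. x \<in> {0<..<1} \<Longrightarrow> (\<phi>' has_real_derivative \<phi>'' x) (at x)"
proof -
  obtain \<phi>' \<phi>'' where *: "\<forall>x\<in>{0..1}. (\<phi> has_real_derivative \<phi>' x) (at x within {0..1})"
    "\<forall>x\<in>{0..1}. (\<phi>' has_real_derivative \<phi>'' x) (at x within {0..1})"
    using assms by (auto simp: C2_on_def)
  have eq: "at x within {0..1} = at x" if "x \<in> {0<..<1}" for x :: real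
    by (rule at_within_interior) (use that in auto)
  show thesis
  proof (rule that)
    fix x :: real assume x: "x \<in> {0<..<1}"
    then have "x \<in> {0..1}" by auto
    then show "(\<phi> has_real_derivative \<phi>' x) (at x)" "(\<phi>' has_real_derivative \<phi>'' x) (at x)"
      using * unfolding eq[OF x, symmetric] by blast+
  qed
qed

text \<open>If \<open>f''\<close> were positive, \<open>f'\<close> would increase just to the right
  of \<open>r\<close>, while the tangent inequalities at \<open>r\<close> and \<open>r + h\<close>
  add up to \<open>f' (r + h) \<le> f' r\<close>.\<close>

lemma strictly_concave_on_second_derivative:
  assumes conc: "strictly_concave_on {b..1} f" and r: "r \<in> {b<..<1}"
    and f': "\<And>y. y \<in> {b<..<1} \<Longrightarrow> (f has_real_derivative f' y) (at y)"
    and f'': "(f' has_real_derivative f'') (at r)"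
  shows "f'' \<le> 0"
proof (rule ccontr)
  assume "\<not> f'' \<le> 0"
  then obtain d where d: "d > 0" "\<And>h. h > 0 \<Longrightarrow> h < d \<Longrightarrow> f' r < f' (r + h)"
    using DERIV_pos_inc_right[OF f''] by auto
  define h where "h = min d (1 - r) / 2"
  have h: "0 < h" "h < d" "r + h \<in> {b<..<1}" using d r by (auto simp: h_def min_def field_simps)
  have "f (r + h) \<le> f r + f' r * h"
    using strictly_concave_on_below_tangent[OF conc r _ f'[OF r], of "r + h"] h by auto
  moreover have "f r \<le> f (r + h) + f' (r + h) * (- h)"
    using strictly_concave_on_below_tangent[OF conc h(3) _ f'[OF h(3)], of r] r by auto
  ultimately have "f' (r + h) * h \<le> f' r * h" by simp
  then have "f' (r + h) \<le> f' r" using h by simp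
  then show False using d(2)[OF h(1,2)] by simp
qed

text \<open>Where the numerator vanishes, the derivative of the denominator drops out. The
  first-order condition creates this situation at the equilibrium.\<close>

lemma DERIV_divide_zero:
  fixes N D :: "real \<Rightarrow> real"
  assumes "(N has_real_derivative N') (at x)" "(D has_real_derivative D') (at x)" "N x = 0" "D x \<noteq> 0"
  shows "((\<lambda>y. N y / D y) has_real_derivative N' / D x) (at x)"
  using DERIV_divide[OF assms(1,2,4)] assms(3,4) by simp

lemma U2_eq: "x < y \<Longrightarrow> x < 1 \<Longrightarrow> U2 f g x y = (f y - g x) / (y - x) + g x / (1 - x)"
  by (simp add: U2_def field_simps)

lemma U1_eq: "x < y \<Longrightarrow> 0 < y \<Longrightarrow> U1 f g x y = (f x - g y) / (y - x) + g y / y"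
  by (simp add: U1_def field_simps)

text \<open>The first-order condition \<open>foc\<close> removes all terms but one from each second
  derivative. In modulus the quotient of the two is the lower bound for \<open>K\<close> in
  \<open>best_response_local_estimate\<close>.\<close>

lemma pd_U2:
  assumes lr: "0 < l" "l < r" "r < 1"
    and f': "\<And>y. y \<in> {0<..<1} \<Longrightarrow> (f has_real_derivative f' y) (at y)"
    and f'': "(f' has_real_derivative f'') (at r)" and g': "(g has_real_derivative g') (at l)"
    and foc: "f r - g l = f' r * (r - l)"
  shows "pd_y (pd_y (U2 f g)) l r = f'' / (r - l)"
    and "pd_y (pd_x (U2 f g)) l r = - (f' r - g') / (r - l)\<^sup>2"
proof -
  have near: "\<forall>\<^sub>F y in nhds r. y \<in> {l<..<1}" using lr by (intro eventually_nhds_in_open) auto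
  have fr: "(f has_real_derivative f' r) (at r)" using f' lr by auto
  have sq: "((\<lambda>y. (y - l)\<^sup>2) has_real_derivative 2 * (r - l)) (at r)"
    by (auto intro!: derivative_eq_intros)
  have "pd_y (U2 f g) l y = (f' y * (y - l) - (f y - g l)) / (y - l)\<^sup>2" if y: "y \<in> {l<..<1}" for y
  proof -
    have "\<forall>\<^sub>F s in nhds y. s \<in> {l<..<1}" using y by (intro eventually_nhds_in_open) auto
    then have "\<forall>\<^sub>F s in nhds y. U2 f g l s = (f s - g l) / (s - l) + g l / (1 - l)"
      by eventually_elim (use lr in \<open>simp add: U2_eq\<close>)
    then have "pd_y (U2 f g) l y = deriv (\<lambda>s. (f s - g l) / (s - l) + g l / (1 - l)) y"
      unfolding pd_y_def by (intro deriv_cong_ev) auto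
    also have "\<dots> = (f' y * (y - l) - (f y - g l)) / (y - l)\<^sup>2"
      using f'[of y] y lr
      by (intro DERIV_imp_deriv) (auto intro!: derivative_eq_intros simp: power2_eq_square)
    finally show ?thesis .
  qed
  then have "\<forall>\<^sub>F y in nhds r. pd_y (U2 f g) l y = (f' y * (y - l) - (f y - g l)) / (y - l)\<^sup>2"
    using near by (auto elim: eventually_mono)
  then have "pd_y (pd_y (U2 f g)) l r = deriv (\<lambda>y. (f' y * (y - l) - (f y - g l)) / (y - l)\<^sup>2) r"
    unfolding pd_y_def[of "pd_y (U2 f g)"] by (intro deriv_cong_ev) auto
  also have "\<dots> = f'' * (r - l) / (r - l)\<^sup>2"
    by (intro DERIV_imp_deriv DERIV_divide_zero[OF _ sq])
      (use lr foc fr f'' in \<open>auto intro!: derivative_eq_intros\<close>)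
  finally show "pd_y (pd_y (U2 f g)) l r = f'' / (r - l)" by (simp add: power2_eq_square)
  \<comment> \<open>The derivative at \<open>l\<close> of \<open>g x / (1 - x)\<close>, the part of
    \<open>U2\<close> free of \<open>y\<close>; it disappears under the derivative in
    \<open>y\<close>.\<close>
  define C where "C = (g' * (1 - l) + g l) / (1 - l)\<^sup>2"
  have "pd_x (U2 f g) l y = (- g' * (y - l) + (f y - g l)) / (y - l)\<^sup>2 + C" if y: "y \<in> {l<..<1}" for y
  proof -
    have "\<forall>\<^sub>F s in nhds l. s \<in> {..<y}" using y by (intro eventually_nhds_in_open) auto
    then have "\<forall>\<^sub>F s in nhds l. U2 f g s y = (f y - g s) / (y - s) + g s / (1 - s)"
      by eventually_elim (use y in \<open>simp add: U2_eq\<close>)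
    then have "pd_x (U2 f g) l y = deriv (\<lambda>s. (f y - g s) / (y - s) + g s / (1 - s)) l"
      unfolding pd_x_def by (intro deriv_cong_ev) auto
    also have "\<dots> = (- g' * (y - l) + (f y - g l)) / (y - l)\<^sup>2 + C"
      unfolding C_def using g' y lr
      by (intro DERIV_imp_deriv) (auto intro!: derivative_eq_intros simp: power2_eq_square)
    finally show ?thesis .
  qed
  then have "\<forall>\<^sub>F y in nhds r. pd_x (U2 f g) l y = (- g' * (y - l) + (f y - g l)) / (y - l)\<^sup>2 + C"
    using near by (auto elim: eventually_mono)
  then have "pd_y (pd_x (U2 f g)) l r = deriv (\<lambda>y. (- g' * (y - l) + (f y - g l)) / (y - l)\<^sup>2 + C) r"
    unfolding pd_y_def by (intro deriv_cong_ev) auto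
  also have "\<dots> = ((- g' + f' r) * (r - l)\<^sup>2 - (- g' * (r - l) + (f r - g l)) * (2 * (r - l))) / ((r - l)\<^sup>2 * (r - l)\<^sup>2)"
  proof -
    have "((\<lambda>y. - g' * (y - l) + (f y - g l)) has_real_derivative - g' + f' r) (at r)"
      using fr by (auto intro!: derivative_eq_intros)
    from DERIV_add[OF DERIV_divide[OF this sq] DERIV_const[of C]] show ?thesis
      using lr by (intro DERIV_imp_deriv) simp
  qed
  also have "\<dots> = - (f' r - g') * (r - l)\<^sup>2 / ((r - l)\<^sup>2 * (r - l)\<^sup>2)"
    unfolding foc by (simp add: power2_eq_square algebra_simps)
  also have "\<dots> = - (f' r - g') / (r - l)\<^sup>2"
    by (rule nonzero_mult_divide_mult_cancel_right) (use lr in simp)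
  finally show "pd_y (pd_x (U2 f g)) l r = - (f' r - g') / (r - l)\<^sup>2" .
qed

text \<open>Reflection turns \<open>U1\<close> into \<open>U2\<close> but exchanges the variables,
  and with them the order of differentiation in the mixed derivative; the formulas are therefore
  computed directly. Here the first derivative is in the player's own variable, so the term
  \<open>g y / y\<close> drops out at once.\<close>

lemma pd_U1:
  assumes lr: "0 < l" "l < r" "r < 1"
    and f': "\<And>y. y \<in> {0<..<1} \<Longrightarrow> (f has_real_derivative f' y) (at y)"
    and f'': "(f' has_real_derivative f'') (at l)" and g': "(g has_real_derivative g') (at r)"
    and foc: "f l - g r = - f' l * (r - l)"
  shows "pd_x (pd_x (U1 f g)) l r = f'' / (r - l)"
    and "pd_y (pd_x (U1 f g)) l r = (f' l - g') / (r - l)\<^sup>2"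
proof -
  have fl: "(f has_real_derivative f' l) (at l)" using f' lr by auto
  have pd_x: "pd_x (U1 f g) x y = (f' x * (y - x) + (f x - g y)) / (y - x)\<^sup>2" if xy: "0 < x" "x < y" "y < 1" for x y
  proof -
    have "\<forall>\<^sub>F s in nhds x. s \<in> {0<..<y}" using xy by (intro eventually_nhds_in_open) auto
    then have "\<forall>\<^sub>F s in nhds x. U1 f g s y = (f s - g y) / (y - s) + g y / y"
      by eventually_elim (use xy in \<open>simp add: U1_eq\<close>)
    then have "pd_x (U1 f g) x y = deriv (\<lambda>s. (f s - g y) / (y - s) + g y / y) x"
      unfolding pd_x_def by (intro deriv_cong_ev) auto
    also have "\<dots> = (f' x * (y - x) + (f x - g y)) / (y - x)\<^sup>2"
      using f'[of x] xy
      by (intro DERIV_imp_deriv) (auto intro!: derivative_eq_intros simp: power2_eq_square)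
    finally show ?thesis .
  qed
  have "\<forall>\<^sub>F x in nhds l. x \<in> {0<..<r}" using lr by (intro eventually_nhds_in_open) auto
  then have "\<forall>\<^sub>F x in nhds l. pd_x (U1 f g) x r = (f' x * (r - x) + (f x - g r)) / (r - x)\<^sup>2"
    by eventually_elim (use pd_x lr in auto)
  then have "pd_x (pd_x (U1 f g)) l r = deriv (\<lambda>x. (f' x * (r - x) + (f x - g r)) / (r - x)\<^sup>2) l"
    unfolding pd_x_def[of "pd_x (U1 f g)"] by (intro deriv_cong_ev) auto
  also have "\<dots> = f'' * (r - l) / (r - l)\<^sup>2"
  proof -
    have "((\<lambda>x. (r - x)\<^sup>2) has_real_derivative - 2 * (r - l)) (at l)"
      by (auto intro!: derivative_eq_intros)
    then show ?thesis
      by (intro DERIV_imp_deriv DERIV_divide_zero)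
        (use lr foc fl f'' in \<open>auto intro!: derivative_eq_intros\<close>)
  qed
  finally show "pd_x (pd_x (U1 f g)) l r = f'' / (r - l)" by (simp add: power2_eq_square)
  have "\<forall>\<^sub>F y in nhds r. y \<in> {l<..<1}" using lr by (intro eventually_nhds_in_open) auto
  then have "\<forall>\<^sub>F y in nhds r. pd_x (U1 f g) l y = (f' l * (y - l) + (f l - g y)) / (y - l)\<^sup>2"
    by eventually_elim (use pd_x lr in auto)
  then have "pd_y (pd_x (U1 f g)) l r = deriv (\<lambda>y. (f' l * (y - l) + (f l - g y)) / (y - l)\<^sup>2) r"
    unfolding pd_y_def by (intro deriv_cong_ev) auto
  also have "\<dots> = (f' l - g') / (r - l)\<^sup>2"
  proof -
    have "((\<lambda>y. (y - l)\<^sup>2) has_real_derivative 2 * (r - l)) (at r)"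
      by (auto intro!: derivative_eq_intros)
    then show ?thesis
      by (intro DERIV_imp_deriv DERIV_divide_zero)
        (use lr foc g' in \<open>auto intro!: derivative_eq_intros\<close>)
  qed
  finally show "pd_y (pd_x (U1 f g)) l r = (f' l - g') / (r - l)\<^sup>2" .
qed

text \<open>The local estimates demand constants strictly above the two quotients, and positive ones
  even if a quotient is 0.\<close>

lemma product_less_one_perturb:
  fixes p q :: real
  assumes "0 \<le> p" "0 \<le> q" "p * q < 1"
  obtains p' q' where "p < p'" "q < q'" "p' * q' < 1"
proof -
  have "((\<lambda>t. (p + t) * (q + t)) \<longlongrightarrow> (p + 0) * (q + 0)) (at_right 0)"
    by (intro tendsto_intros)
  then have "\<forall>\<^sub>F t in at_right 0. (p + t) * (q + t) < 1"
    by (rule order_tendstoD(2)) (use assms in simp)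
  moreover have "\<forall>\<^sub>F t::real in at_right 0. 0 < t" by (rule eventually_at_right_less)
  ultimately have "\<forall>\<^sub>F t in at_right 0. 0 < t \<and> (p + t) * (q + t) < 1" by eventually_elim simp
  then obtain t where "0 < t" "(p + t) * (q + t) < 1"
    using eventually_happens' trivial_limit_at_right_real by blast
  then show thesis by (intro that[of "p + t" "q + t"]) auto
qed

section \<open>Reflection and response sets of player 1\<close>

text \<open>Polymorphic, so that it serves for the rewards and also for the family \<open>P\<close>
  of laws indexed by the start.\<close>

definition reflect :: "(real \<Rightarrow> 'a) \<Rightarrow> real \<Rightarrow> 'a" where
  "reflect \<phi> x = \<phi> (1 - x)"

lemma (in brownian_setting) brownian_setting_reflect:
  "brownian_setting M F (\<lambda>t \<omega>. 1 - W t \<omega>) (reflect P)"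
proof (rule brownian_setting.intro[OF filtration_axioms brownian_setting_axioms.intro])
  fix t :: real assume t: "t \<ge> 0"
  show "universally_complete (F (ennreal t))" by (rule complete_F[OF t])
  show "(\<lambda>\<omega>. 1 - W t \<omega>) \<in> borel_measurable (F (ennreal t))" using adapted[OF t] by measurable
next
  fix \<omega> assume "\<omega> \<in> space M"
  then show "continuous_on {0..} (\<lambda>t. 1 - W t \<omega>)" by (intro continuous_intros continuous_paths)
next
  fix x :: real assume "x \<in> {0..1}"
  then have x: "1 - x \<in> {0..1}" by auto
  show "prob_space (reflect P x)" "sets (reflect P x) = sets M"
    using prob_P[OF x] sets_P[OF x] by (simp_all add: reflect_def)
  show "AE \<omega> in reflect P x. 1 - W 0 \<omega> = x"
    unfolding reflect_def using start[OF x] by eventually_elim simp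
  fix s t :: real assume st: "0 \<le> s" "s < t"
  \<comment> \<open>The coefficients 0 and -1 fit the rule for affine images of normal variables;
    the modulus of -1 leaves the standard deviation unchanged.\<close>
  have diff: "(\<lambda>\<omega>. (1 - W t \<omega>) - (1 - W s \<omega>)) = (\<lambda>\<omega>. 0 + (- 1) * (W t \<omega> - W s \<omega>))" by auto
  have "distributed (P (1 - x)) lborel (\<lambda>\<omega>. 0 + (- 1) * (W t \<omega> - W s \<omega>))
      (normal_density (0 + (- 1) * 0) (\<bar>- 1\<bar> * sqrt (t - s)))"
    by (rule prob_space.normal_density_affine[OF prob_P[OF x] normal_increments[OF x st]])
      (use st in auto)
  then show "distributed (reflect P x) lborel (\<lambda>\<omega>. (1 - W t \<omega>) - (1 - W s \<omega>)) (normal_density 0 (sqrt (t - s)))"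
    unfolding diff reflect_def by simp
  let ?V = "vimage_algebra (space M) (\<lambda>\<omega>. W t \<omega> - W s \<omega>) borel"
  have [measurable]: "(\<lambda>\<omega>. W t \<omega> - W s \<omega>) \<in> borel_measurable ?V"
    by (rule measurable_vimage_algebra1) simp
  have "(\<lambda>\<omega>. 0 + (- 1) * (W t \<omega> - W s \<omega>)) \<in> borel_measurable ?V" by measurable
  then have "sets (vimage_algebra (space M) (\<lambda>\<omega>. 0 + (- 1) * (W t \<omega> - W s \<omega>)) borel) \<subseteq> sets ?V"
    by (intro sets_image_in_sets) simp_all
  then show "prob_space.indep_set (reflect P x) (sets (F (ennreal s)))
      (sets (vimage_algebra (space M) (\<lambda>\<omega>. (1 - W t \<omega>) - (1 - W s \<omega>)) borel))"
    using independent_increments[OF x st]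
    unfolding diff reflect_def prob_space.indep_sets2_eq[OF prob_P[OF x]] by blast
qed (rule subalgebra_F)

lemma killed_reflect: "killed (\<lambda>t \<omega>. 1 - W t \<omega>) t \<omega> = map_option (\<lambda>z. 1 - z) (killed W t \<omega>)"
proof -
  have "lifetime (\<lambda>t \<omega>. 1 - W t \<omega>) \<omega> = lifetime W \<omega>"
    unfolding lifetime_def by (intro arg_cong[where f=Inf]) auto
  then show ?thesis by (simp add: killed_def)
qed

lemma ext0_killed_reflect:
  "ext0 (reflect \<phi>) (killed (\<lambda>t \<omega>. 1 - W t \<omega>) t \<omega>) = ext0 \<phi> (killed W t \<omega>)"
  by (simp add: killed_reflect ext0_def reflect_def split: option.split)

lemma hit_reflect:
  assumes "\<And>z. z \<in> A' \<longleftrightarrow> 1 - z \<in> A"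
  shows "hit (\<lambda>t \<omega>. 1 - W t \<omega>) A' = hit W A"
proof
  fix \<omega>
  have "killed (\<lambda>t \<omega>. 1 - W t \<omega>) t \<omega> \<in> Some ` A' \<longleftrightarrow> killed W t \<omega> \<in> Some ` A" for t
    using assms by (cases "killed W t \<omega>") (auto simp: killed_reflect)
  moreover have "lifetime (\<lambda>t \<omega>. 1 - W t \<omega>) \<omega> = lifetime W \<omega>"
    unfolding lifetime_def by (intro arg_cong[where f=Inf]) auto
  ultimately show "hit (\<lambda>t \<omega>. 1 - W t \<omega>) A' \<omega> = hit W A \<omega>"
    unfolding hit_def by (simp only:)
qed

lemma payoff_reflect:
  "payoff (\<lambda>t \<omega>. 1 - W t \<omega>) (reflect P) (reflect f) (reflect g) (reflect h) x \<sigma> \<rho> =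
   payoff W P f g h (1 - x) \<sigma> \<rho>"
  by (simp add: payoff_def ext0_killed_reflect) (simp add: reflect_def)

lemma response_set_reflect:
  assumes "\<And>z. z \<in> A' \<longleftrightarrow> 1 - z \<in> A"
  shows "x \<in> response_set F (\<lambda>t \<omega>. 1 - W t \<omega>) (reflect P) (reflect f) (reflect g) A' \<longleftrightarrow>
    1 - x \<in> response_set F W P f g A"
proof -
  have "value_against F (\<lambda>t \<omega>. 1 - W t \<omega>) (reflect P) (reflect f) (reflect g) A' x =
      value_against F W P f g A (1 - x)"
    by (simp add: value_against_def ext0_killed_reflect hit_reflect[OF assms]) (simp add: reflect_def)
  then show ?thesis by (auto simp: response_set_def reflect_def assms)
qed

lemma eventually_nhds_reflect:
  fixes r :: real
  assumes "\<forall>\<^sub>F y in nhds r. Q y" shows "\<forall>\<^sub>F x in nhds (1 - r). Q (1 - x)"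
proof -
  have "((\<lambda>x. 1 - x) \<longlongrightarrow> 1 - (1 - r)) (nhds (1 - r))"
    by (intro tendsto_diff tendsto_const filterlim_ident)
  then show ?thesis using assms by (auto simp: filterlim_iff)
qed

lemma strictly_convex_on_reflect:
  assumes f: "strictly_convex_on {u..v} f"
  shows "strictly_convex_on {1 - v..1 - u} (reflect f)"
  unfolding strictly_convex_on_def
proof (intro conjI ballI allI impI)
  fix x y t :: real
  assume "x \<in> {1 - v..1 - u}" "y \<in> {1 - v..1 - u}" and t: "0 < t" "t < 1" and "x \<noteq> y"
  then have xy: "1 - x \<in> {u..v}" "1 - y \<in> {u..v}" "1 - x \<noteq> 1 - y" by auto
  have "1 - ((1 - t) * x + t * y) = (1 - t) * (1 - x) + t * (1 - y)" by (simp add: algebra_simps)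
  then show "reflect f ((1 - t) * x + t * y) < (1 - t) * reflect f x + t * reflect f y"
    using f xy t unfolding reflect_def strictly_convex_on_def by metis
qed simp

lemma strictly_concave_on_reflect:
  assumes "strictly_concave_on {u..v} f"
  shows "strictly_concave_on {1 - v..1 - u} (reflect f)"
  using strictly_convex_on_reflect[of u v "\<lambda>x. - f x"] assms
  by (simp add: strictly_concave_on_def reflect_def[abs_def])

lemma admissible_rewards_reflect:
  assumes "admissible_rewards f g h"
  shows "admissible_rewards (reflect f) (reflect g) (reflect h)"
proof -
  have "continuous_on {0..1} (reflect \<phi>)" if "continuous_on {0..1} \<phi>" for \<phi> :: "real \<Rightarrow> real"
    unfolding reflect_def[abs_def]
    by (intro continuous_on_compose2[OF that] continuous_intros) auto
  moreover have "bounded (reflect \<phi> ` {0..1})" if "bounded (\<phi> ` {0..1})" for \<phi> :: "real \<Rightarrow> real"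
    by (rule bounded_subset[OF that]) (auto simp: reflect_def)
  ultimately show ?thesis
    using assms by (simp add: admissible_rewards_def) (simp add: reflect_def)
qed

lemma DERIV_reflect:
  assumes "(f has_real_derivative D) (at (1 - x))"
  shows "(reflect f has_real_derivative - D) (at x)"
proof -
  have "((\<lambda>x. 1 - x) has_real_derivative - 1) (at x)" by (auto intro!: derivative_eq_intros)
  from DERIV_chain2[OF assms this] show ?thesis by (simp add: reflect_def[abs_def])
qed

text \<open>Reflection makes \<open>1 - r\<close> the opponent's and \<open>1 - l\<close> the own
  threshold. First derivatives change sign and second ones do not, so the condition on
  \<open>K\<close> keeps its form.\<close>

lemma (in brownian_setting) response_set_local_left:
  assumes lr: "l \<in> {0<..<a}" "r \<in> {a<..<1}" and adm: "admissible_rewards f g h"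
    and conc: "strictly_concave_on {0..a} f" and conv: "strictly_convex_on {a..1} f"
    and f': "\<And>y. y \<in> {0<..<1} \<Longrightarrow> (f has_real_derivative f' y) (at y)"
    and f'': "(f' has_real_derivative f'') (at l)" and g': "(g has_real_derivative g') (at r)"
    and br: "best_response (reflect f) (reflect g) (1 - a) (1 - r) (1 - l)"
    and profit: "\<forall>\<^sub>F y in nhds r. \<exists>x\<in>{0..a}. f x > g y * (x / y)"
    and K: "K > 0" "\<bar>f' l - g'\<bar> < K * (- f'') * (r - l)"
  shows "\<forall>\<^sub>F y in nhds r. \<exists>x. response_set F W P f g {y..1} = {0..x} \<and> \<bar>x - l\<bar> \<le> K * \<bar>y - r\<bar>"
proof -
  interpret R: brownian_setting M F "\<lambda>t \<omega>. 1 - W t \<omega>" "reflect P" by (rule brownian_setting_reflect)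
  let ?R = "\<lambda>A. response_set F (\<lambda>t \<omega>. 1 - W t \<omega>) (reflect P) (reflect f) (reflect g) A"
  have "\<forall>\<^sub>F x in nhds (1 - r). \<exists>\<rho>. ?R {0..x} = {\<rho>..1} \<and> \<bar>\<rho> - (1 - l)\<bar> \<le> K * \<bar>x - (1 - r)\<bar>"
  proof (rule R.response_set_local[where b="1 - a" and f'="\<lambda>y. - f' (1 - y)" and f''=f'' and g'="- g'"])
    show "strictly_convex_on {0..1 - a} (reflect f)"
      using strictly_convex_on_reflect[OF conv] by simp
    show "strictly_concave_on {1 - a..1} (reflect f)"
      using strictly_concave_on_reflect[OF conc] by simp
    show "(reflect f has_real_derivative - f' (1 - y)) (at y)" if "y \<in> {0<..<1}" for y
      by (rule DERIV_reflect[OF f']) (use that in auto)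
    have "(reflect f' has_real_derivative - f'') (at (1 - l))"
      by (rule DERIV_reflect) (use f'' in simp)
    then show "((\<lambda>y. - f' (1 - y)) has_real_derivative f'') (at (1 - l))"
      using DERIV_minus by (fastforce simp: reflect_def[abs_def])
    show "(reflect g has_real_derivative - g') (at (1 - r))"
      by (rule DERIV_reflect) (use g' in simp)
    show "\<forall>\<^sub>F x in nhds (1 - r). \<exists>y\<in>{1 - a..1}. reflect g x * ((1 - y) / (1 - x)) < reflect f y"
      using eventually_nhds_reflect[OF profit]
    proof eventually_elim
      case (elim x)
      then obtain x' where "x' \<in> {0..a}" "f x' > g (1 - x) * (x' / (1 - x))" by blast
      then show ?case by (intro bexI[of _ "1 - x'"]) (auto simp: reflect_def)
    qed
    show "\<bar>- f' (1 - (1 - l)) - - g'\<bar> < K * - f'' * (1 - l - (1 - r))" using K(2) by simp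
  qed (use lr K(1) br admissible_rewards_reflect[OF adm] in auto)
  from eventually_nhds_reflect[OF this]
  have "\<forall>\<^sub>F y in nhds r. \<exists>\<rho>. ?R {0..1 - y} = {\<rho>..1} \<and> \<bar>\<rho> - (1 - l)\<bar> \<le> K * \<bar>(1 - y) - (1 - r)\<bar>"
    by simp
  then show ?thesis
  proof eventually_elim
    case (elim y)
    then obtain \<rho> where \<rho>: "?R {0..1 - y} = {\<rho>..1}" "\<bar>\<rho> - (1 - l)\<bar> \<le> K * \<bar>(1 - y) - (1 - r)\<bar>" by blast
    have "z \<in> response_set F W P f g {y..1} \<longleftrightarrow> z \<in> {0..1 - \<rho>}" for z
    proof -
      have "z \<in> response_set F W P f g {y..1} \<longleftrightarrow> 1 - z \<in> ?R {0..1 - y}"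
        by (subst response_set_reflect[where A="{y..1}"]) auto
      then show ?thesis unfolding \<rho>(1) by auto
    qed
    then have "response_set F W P f g {y..1} = {0..1 - \<rho>}" by blast
    moreover have "\<bar>(1 - \<rho>) - l\<bar> \<le> K * \<bar>y - r\<bar>" using \<rho>(2) by (simp add: abs_minus_commute algebra_simps)
    ultimately show ?case by blast
  qed
qed

section \<open>Convergence of the iteration\<close>

lemma iter_set_converges:
  assumes right: "\<forall>\<^sub>F x in nhds l. \<exists>\<rho>. response_set F W P (f 2) (g 2) {0..x} = {\<rho>..1} \<and> \<bar>\<rho> - r\<bar> \<le> K2 * \<bar>x - l\<bar>"
    and left: "\<forall>\<^sub>F y in nhds r. \<exists>x. response_set F W P (f 1) (g 1) {y..1} = {0..x} \<and> \<bar>x - l\<bar> \<le> K1 * \<bar>y - r\<bar>"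
    and K: "0 < K1" "0 < K2" "K1 * K2 < 1"
  shows "\<forall>\<^sub>F x in nhds l. \<exists>u v. u \<longlonglongrightarrow> l \<and> v \<longlonglongrightarrow> r \<and>
    (\<forall>n. iter_set F W P f g x (2 * n + 1) = {0..u n} \<and> iter_set F W P f g x (2 * n + 2) = {v n..1})"
proof -
  obtain d2 where d2: "d2 > 0" "\<And>x. \<bar>x - l\<bar> < d2 \<Longrightarrow>
      \<exists>\<rho>. response_set F W P (f 2) (g 2) {0..x} = {\<rho>..1} \<and> \<bar>\<rho> - r\<bar> \<le> K2 * \<bar>x - l\<bar>"
    using right unfolding eventually_nhds_metric dist_real_def by blast
  obtain d1 where d1: "d1 > 0" "\<And>y. \<bar>y - r\<bar> < d1 \<Longrightarrow>
      \<exists>x. response_set F W P (f 1) (g 1) {y..1} = {0..x} \<and> \<bar>x - l\<bar> \<le> K1 * \<bar>y - r\<bar>"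
    using left unfolding eventually_nhds_metric dist_real_def by blast
  \<comment> \<open>\<open>d2\<close> admits the estimate for player 2, and \<open>d1 / K2\<close>
    makes the resulting threshold close enough to \<open>r\<close> for the estimate of player 1. As
    \<open>K1 * K2 < 1\<close>, each round ends no further from \<open>l\<close> than it began, so
    both stay applicable.\<close>
  define e where "e = min d2 (d1 / K2)"
  have e: "e > 0" using d1(1) d2(1) K by (simp add: e_def)
  have converges: "\<exists>u v. u \<longlonglongrightarrow> l \<and> v \<longlonglongrightarrow> r \<and>
    (\<forall>n. iter_set F W P f g x (2 * n + 1) = {0..u n} \<and> iter_set F W P f g x (2 * n + 2) = {v n..1})"
    if x: "\<bar>x - l\<bar> < e" for x
  proof -
    let ?A = "iter_set F W P f g x" and ?q = "K1 * K2"
    have q: "0 \<le> ?q ^ n" "?q ^ n \<le> 1" for n using K by (auto intro: power_le_one)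
    have near: "\<bar>z - l\<bar> < d2 \<and> K2 * \<bar>z - l\<bar> < d1" if "\<bar>z - l\<bar> \<le> ?q ^ n * \<bar>x - l\<bar>" for z n
    proof -
      have "?q ^ n * \<bar>x - l\<bar> \<le> 1 * \<bar>x - l\<bar>" using q by (intro mult_right_mono) auto
      then have "\<bar>z - l\<bar> < e" using that x by simp
      then show ?thesis using K by (auto simp: e_def pos_less_divide_eq mult.commute)
    qed
    have odd: "\<exists>z. ?A (2 * n + 1) = {0..z} \<and> \<bar>z - l\<bar> \<le> ?q ^ n * \<bar>x - l\<bar>" for n
    proof (induction n)
      case 0
      show ?case by (intro exI[of _ x]) simp
    next
      case (Suc n)
      then obtain z where z: "?A (2 * n + 1) = {0..z}" "\<bar>z - l\<bar> \<le> ?q ^ n * \<bar>x - l\<bar>" by blast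
      obtain \<rho> where \<rho>: "response_set F W P (f 2) (g 2) {0..z} = {\<rho>..1}" "\<bar>\<rho> - r\<bar> \<le> K2 * \<bar>z - l\<bar>"
        using d2(2) near[OF z(2)] by blast
      then obtain y where y: "response_set F W P (f 1) (g 1) {\<rho>..1} = {0..y}" "\<bar>y - l\<bar> \<le> K1 * \<bar>\<rho> - r\<bar>"
        using d1(2)[of \<rho>] near[OF z(2)] by fastforce
      have "\<bar>y - l\<bar> \<le> K1 * (K2 * (?q ^ n * \<bar>x - l\<bar>))"
        using y(2) \<rho>(2) z(2) K by (smt (verit) mult_left_mono)
      moreover have "?A (2 * Suc n + 1) = {0..y}" using z(1) \<rho>(1) y(1) by simp
      ultimately show ?case by (intro exI[of _ y]) (simp add: mult.assoc mult.left_commute)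
    qed
    then obtain u where u: "\<And>n. ?A (2 * n + 1) = {0..u n}" "\<And>n. \<bar>u n - l\<bar> \<le> ?q ^ n * \<bar>x - l\<bar>"
      by metis
    have "\<exists>\<rho>. ?A (2 * n + 2) = {\<rho>..1} \<and> \<bar>\<rho> - r\<bar> \<le> K2 * \<bar>u n - l\<bar>" for n
    proof -
      have "?A (2 * n + 2) = response_set F W P (f 2) (g 2) {0..u n}"
        using u(1)[of n] by simp
      then show ?thesis using d2(2)[of "u n"] near[OF u(2)[of n]] by simp
    qed
    then obtain v where v: "\<And>n. ?A (2 * n + 2) = {v n..1}" "\<And>n. \<bar>v n - r\<bar> \<le> K2 * \<bar>u n - l\<bar>"
      by metis
    have q0: "(\<lambda>n. ?q ^ n * \<bar>x - l\<bar>) \<longlonglongrightarrow> 0"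
      using tendsto_mult_left_zero[OF LIMSEQ_realpow_zero[of ?q]] K by simp
    have lim: "(\<lambda>n. \<bar>u n - l\<bar>) \<longlonglongrightarrow> 0"
      by (rule tendsto_sandwich[OF _ _ tendsto_const q0]) (use u(2) in auto)
    then have "u \<longlonglongrightarrow> l" by (simp add: LIM_zero_iff tendsto_rabs_zero_iff)
    moreover have "(\<lambda>n. \<bar>v n - r\<bar>) \<longlonglongrightarrow> 0"
      by (rule tendsto_sandwich[OF _ _ tendsto_const tendsto_mult_right_zero[OF lim, of K2]]) (use v(2) in auto)
    then have "v \<longlonglongrightarrow> r" by (simp add: LIM_zero_iff tendsto_rabs_zero_iff)
    ultimately show ?thesis using u(1) v(1) by blast
  qed
  then show ?thesis unfolding eventually_nhds_metric dist_real_def using e by blast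
qed

theorem corollary5p2:
  fixes M :: "'w measure" and F :: "ennreal \<Rightarrow> 'w measure"
    and W :: "real \<Rightarrow> 'w \<Rightarrow> real" and P :: "real \<Rightarrow> 'w measure"
    and f g h :: "nat \<Rightarrow> real \<Rightarrow> real" and a b l r :: real
  assumes "brownian_setting M F W P"
    and "\<And>i. i \<in> {1, 2} \<Longrightarrow> admissible_rewards (f i) (g i) (h i)"
    and "a \<in> {0<..<1}" and "b \<in> {0<..<1}" and "a < b"
    and "strictly_concave_on {0..a} (f 1)" and "strictly_convex_on {a..1} (f 1)"
    and "strictly_convex_on {0..b} (f 2)" and "strictly_concave_on {b..1} (f 2)"
    and "\<And>i. i \<in> {1, 2} \<Longrightarrow> C2_on {0..1} (f i) \<and> C2_on {0..1} (g i)"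
    and "\<And>x y. x \<in> {0..a} \<Longrightarrow> y \<in> {b..1} \<Longrightarrow>
           \<exists>x'\<in>{0<..a}. \<exists>y'\<in>{b..1}.
             f 1 x' > g 1 y * (x' / y) \<and> f 2 y' > g 2 x * ((1 - y') / (1 - x))"
    and "DP_solution F W P f g h (hit W {0..l}) (hit W {r..1})"
    and "l \<in> {0<..<a}" and "r \<in> {b<..<1}"
    and "pd_x (pd_x (U1 (f 1) (g 1))) l r \<noteq> 0"
    and "pd_y (pd_y (U2 (f 2) (g 2))) l r \<noteq> 0"
    and "\<bar>pd_y (pd_x (U1 (f 1) (g 1))) l r / pd_x (pd_x (U1 (f 1) (g 1))) l r *
          (pd_y (pd_x (U2 (f 2) (g 2))) l r / pd_y (pd_y (U2 (f 2) (g 2))) l r)\<bar> < 1"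
  shows "locally_stable F W P f g h a l r"
proof -
  interpret brownian_setting M F W P by (rule assms(1))
  interpret R: brownian_setting M F "\<lambda>t \<omega>. 1 - W t \<omega>" "reflect P" by (rule brownian_setting_reflect)
  have adm1: "admissible_rewards (f 1) (g 1) (h 1)" and adm2: "admissible_rewards (f 2) (g 2) (h 2)"
    by (rule assms(2); simp)+
  have lr: "l \<in> {0<..<a}" "r \<in> {a<..<1}" "l \<in> {0<..<b}" "r \<in> {b<..<1}" "0 < l" "l < r" "r < 1"
    using assms(3-5,13,14) by auto
  have lr': "1 - r \<in> {0<..<1 - a}" "1 - l \<in> {1 - a<..<1}" using lr by auto
  have C2: "C2_on {0..1} (f 1)" "C2_on {0..1} (g 1)" "C2_on {0..1} (f 2)" "C2_on {0..1} (g 2)"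
    using assms(10)[of 1] assms(10)[of 2] by simp_all
  obtain f1' f1'' where f1: "\<And>x. x \<in> {0<..<1} \<Longrightarrow> (f 1 has_real_derivative f1' x) (at x)"
    "\<And>x. x \<in> {0<..<1} \<Longrightarrow> (f1' has_real_derivative f1'' x) (at x)"
    using C2_on_unit_interval[OF C2(1)] by metis
  obtain f2' f2'' where f2: "\<And>x. x \<in> {0<..<1} \<Longrightarrow> (f 2 has_real_derivative f2' x) (at x)"
    "\<And>x. x \<in> {0<..<1} \<Longrightarrow> (f2' has_real_derivative f2'' x) (at x)"
    using C2_on_unit_interval[OF C2(3)] by metis
  obtain g1' where g1: "\<And>x. x \<in> {0<..<1} \<Longrightarrow> (g 1 has_real_derivative g1' x) (at x)"
    using C2_on_unit_interval[OF C2(2)] by metis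
  obtain g2' where g2: "\<And>x. x \<in> {0<..<1} \<Longrightarrow> (g 2 has_real_derivative g2' x) (at x)"
    using C2_on_unit_interval[OF C2(4)] by metis
  have unit: "l \<in> {0<..<1}" "r \<in> {0<..<1}" using lr by auto
  note f1'' = f1(2)[OF unit(1)] and f2'' = f2(2)[OF unit(2)]
  note g1r = g1[OF unit(2)] and g2l = g2[OF unit(1)]

  have br2: "best_response (f 2) (g 2) b l r"
    using assms(12) by (intro best_response_of_equilibrium[OF lr(3,4) adm2]) (simp add: DP_solution_def)
  have br1: "best_response (reflect (f 1)) (reflect (g 1)) (1 - a) (1 - r) (1 - l)"
  proof (rule R.best_response_of_equilibrium[OF lr' admissible_rewards_reflect[OF adm1]])
    fix x :: real assume "x \<in> {0<..<1}"
    then have x: "1 - x \<in> {0<..<1}" by auto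
    have "hit (\<lambda>t \<omega>. 1 - W t \<omega>) {1 - l..1} = hit W {0..l}" "hit (\<lambda>t \<omega>. 1 - W t \<omega>) {0..1 - r} = hit W {r..1}"
      by (rule hit_reflect; auto)+
    then show "payoff (\<lambda>t \<omega>. 1 - W t \<omega>) (reflect P) (reflect (f 1)) (reflect (g 1)) (reflect (h 1)) x
        (hit (\<lambda>t \<omega>. 1 - W t \<omega>) {1 - l..1}) (hit (\<lambda>t \<omega>. 1 - W t \<omega>) {0..1 - r}) =
      (SUP \<sigma>\<in>Collect (stopping_time F). payoff (\<lambda>t \<omega>. 1 - W t \<omega>) (reflect P) (reflect (f 1)) (reflect (g 1)) (reflect (h 1)) x
        \<sigma> (hit (\<lambda>t \<omega>. 1 - W t \<omega>) {0..1 - r}))"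
      using assms(12) x by (simp add: payoff_reflect DP_solution_def)
  qed
  have f1_refl: "(reflect (f 1) has_real_derivative - f1' (1 - y)) (at y)" if "y \<in> {0<..<1}" for y
    by (rule DERIV_reflect[OF f1(1)]) (use that in auto)
  have conc1: "strictly_concave_on {1 - a..1} (reflect (f 1))"
    using strictly_concave_on_reflect[OF assms(6)] by simp
  have foc2: "f 2 r - g 2 l = f2' r * (r - l)"
    by (rule best_response_first_order[OF br2 _ lr(4) f2(1)[OF unit(2)]]) (use lr in auto)
  have "reflect (f 1) (1 - l) - reflect (g 1) (1 - r) = - f1' (1 - (1 - l)) * ((1 - l) - (1 - r))"
    by (rule best_response_first_order[OF br1 _ lr'(2) f1_refl]) (use lr' unit in auto)
  then have foc1: "f 1 l - g 1 r = - f1' l * (r - l)" by (simp add: reflect_def)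
  have pd1: "pd_x (pd_x (U1 (f 1) (g 1))) l r = f1'' l / (r - l)"
    "pd_y (pd_x (U1 (f 1) (g 1))) l r = (f1' l - g1' r) / (r - l)\<^sup>2"
    by (rule pd_U1[OF lr(5-7) f1(1) f1'' g1r foc1]; assumption)+
  have pd2: "pd_y (pd_y (U2 (f 2) (g 2))) l r = f2'' r / (r - l)"
    "pd_y (pd_x (U2 (f 2) (g 2))) l r = - (f2' r - g2' l) / (r - l)\<^sup>2"
    by (rule pd_U2[OF lr(5-7) f2(1) f2'' g2l foc2]; assumption)+

  have "f2'' r \<le> 0"
    by (rule strictly_concave_on_second_derivative[OF assms(9) lr(4) f2(1) f2'']) (use assms(4) in auto)
  \<comment> \<open>Strict concavity alone allows a zero second derivative; the nonvanishing
    denominator of the quotient excludes it.\<close>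
  then have neg2: "f2'' r < 0" using assms(16) pd2 by (cases "f2'' r = 0") auto
  have "((\<lambda>y. - f1' (1 - y)) has_real_derivative f1'' l) (at (1 - l))"
    using DERIV_minus[OF DERIV_reflect[of f1' "f1'' l" "1 - l"]] f1'' by (simp add: reflect_def)
  then have "f1'' l \<le> 0"
    by (intro strictly_concave_on_second_derivative[OF conc1 lr'(2) f1_refl]) (use assms(3) in auto)
  then have neg1: "f1'' l < 0" using assms(15) pd1 by (cases "f1'' l = 0") auto

  \<comment> \<open>The thresholds that \<open>K1\<close> and \<open>K2\<close> must exceed, written
    with denominators that are positive; they are the moduli of the two quotients in the
    assumption.\<close>
  define q1 where "q1 = \<bar>f1' l - g1' r\<bar> / (- f1'' l * (r - l))"
  define q2 where "q2 = \<bar>f2' r - g2' l\<bar> / (- f2'' r * (r - l))"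
  have pos: "0 < - f1'' l * (r - l)" "0 < - f2'' r * (r - l)" using neg1 neg2 lr(6) by (simp_all add: mult_neg_pos)
  have q: "0 \<le> q1" "0 \<le> q2" unfolding q1_def q2_def by (intro divide_nonneg_pos pos abs_ge_zero)+
  have quotient: "\<bar>u\<bar> / (- v * w) = \<bar>u / w\<^sup>2 / (v / w)\<bar>" if "v < 0" "0 < w" for u v w :: real
    using that by (simp add: abs_mult power2_eq_square)
  have "q1 = \<bar>pd_y (pd_x (U1 (f 1) (g 1))) l r / pd_x (pd_x (U1 (f 1) (g 1))) l r\<bar>"
    "q2 = \<bar>pd_y (pd_x (U2 (f 2) (g 2))) l r / pd_y (pd_y (U2 (f 2) (g 2))) l r\<bar>"
    unfolding pd1 pd2 q1_def q2_def
    using quotient[OF neg1, of "r - l" "f1' l - g1' r"] quotient[OF neg2, of "r - l" "- (f2' r - g2' l)"] lr(6)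
    by (simp_all only: diff_gt_0_iff_gt abs_minus_cancel simp_thms True_implies_equals)
  then have "q1 * q2 < 1" using assms(17) by (simp add: abs_mult)
  then obtain K1 K2 where K: "q1 < K1" "q2 < K2" "K1 * K2 < 1"
    using product_less_one_perturb[OF q] by blast
  have K_pos: "0 < K1" "0 < K2" using K q by auto
  have K1: "\<bar>f1' l - g1' r\<bar> < K1 * - f1'' l * (r - l)" and K2: "\<bar>f2' r - g2' l\<bar> < K2 * - f2'' r * (r - l)"
    using K(1)[unfolded q1_def pos_divide_less_eq[OF pos(1)]] K(2)[unfolded q2_def pos_divide_less_eq[OF pos(2)]]
    by (simp_all only: mult.assoc)

  have "\<forall>\<^sub>F x in nhds l. x \<in> {0<..<a}" using lr by (intro eventually_nhds_in_open) auto
  then have profit2: "\<forall>\<^sub>F x in nhds l. \<exists>y\<in>{b..1}. f 2 y > g 2 x * ((1 - y) / (1 - x))"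
  proof eventually_elim
    case (elim x)
    \<comment> \<open>Condition (4) speaks of pairs; to extract the inequality for player 2, the
      other coordinate is set to 1. For player 1 below it is set to 0.\<close>
    then show ?case using assms(11)[of x 1] assms(4) by auto
  qed
  have "\<forall>\<^sub>F y in nhds r. y \<in> {b<..<1}" using lr by (intro eventually_nhds_in_open) auto
  then have profit1: "\<forall>\<^sub>F y in nhds r. \<exists>x\<in>{0..a}. f 1 x > g 1 y * (x / y)"
  proof eventually_elim
    case (elim y)
    then show ?case using assms(11)[of 0 y] assms(3) by fastforce
  qed
  have right: "\<forall>\<^sub>F x in nhds l. \<exists>\<rho>. response_set F W P (f 2) (g 2) {0..x} = {\<rho>..1} \<and> \<bar>\<rho> - r\<bar> \<le> K2 * \<bar>x - l\<bar>"
    by (rule response_set_local[OF lr(3,4) adm2 assms(8,9) f2(1) f2'' g2l br2 profit2 K_pos(2) K2])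
  have left: "\<forall>\<^sub>F y in nhds r. \<exists>x. response_set F W P (f 1) (g 1) {y..1} = {0..x} \<and> \<bar>x - l\<bar> \<le> K1 * \<bar>y - r\<bar>"
    by (rule response_set_local_left[OF lr(1,2) adm1 assms(6,7) f1(1) f1'' g1r br1 profit1 K_pos(1) K1])
  have "\<forall>\<^sub>F x in nhds l. \<exists>u v. u \<longlonglongrightarrow> l \<and> v \<longlonglongrightarrow> r \<and>
    (\<forall>n. iter_set F W P f g x (2 * n + 1) = {0..u n} \<and> iter_set F W P f g x (2 * n + 2) = {v n..1})"
    by (rule iter_set_converges[OF right left K_pos K(3)])
  then have "\<forall>\<^sub>F x in nhds l. x \<in> {0..a} \<longrightarrow>
        (let A = iter_set F W P f g x in
           PK_liminf (\<lambda>n. A (2 * n + 1)) = {0..l} \<and> PK_limsup (\<lambda>n. A (2 * n + 1)) = {0..l} \<and>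
           PK_liminf (\<lambda>n. A (2 * n + 2)) = {r..1} \<and> PK_limsup (\<lambda>n. A (2 * n + 2)) = {r..1})"
  proof eventually_elim
    case (elim x)
    then obtain u v where uv: "u \<longlonglongrightarrow> l" "v \<longlonglongrightarrow> r"
      "\<And>n. iter_set F W P f g x (2 * n + 1) = {0..u n}" "\<And>n. iter_set F W P f g x (2 * n + 2) = {v n..1}"
      by blast
    show ?case
      unfolding Let_def uv(3,4)
      using PK_limits_interval[OF tendsto_const uv(1) lr(5)] PK_limits_interval[OF uv(2) tendsto_const lr(7)]
      by blast
  qed
  then show ?thesis using assms(12) by (simp add: locally_stable_def)
qed

end
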